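(* There is a linear-time algorithm that, given an outerplanar graph $G$, tests whether $G$ admits a $2$-star coloring and, if one exists, constructs a $2$-star coloring of $G$.
   Context: A $\kappa$-star coloring of a graph $G$ is an assignment of one of $\kappa$ colors to each vertex of $G$ such that every monochromatic component (a connected component of the subgraph induced by the vertices of one color) is acyclic and has diameter at most $2$, i.e., is a star (possibly a single vertex or a single edge). A graph is outerplanar if it has a planar embedding with all vertices on the outer face. Linear time is measured in the size of $G$. *)

theory Defs
  imports "HOL-Analysis.Analysis"
begin

section \<open>Finite simple graphs\<close>

text \<open>A graph is given by its vertex set \<open>V\<close> and its set \<open>E\<close> of two-element edges.\<close>

definition simple_graph :: "'a set \<Rightarrow> 'a set set \<Rightarrow> bool" where
  "simple_graph V E \<longleftrightarrow> finite V \<and> (\<forall>e\<in>E. e \<subseteq> V \<and> card e = 2)"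

definition induced_edges :: "'a set set \<Rightarrow> 'a set \<Rightarrow> 'a set set" where
  "induced_edges E S = {e \<in> E. e \<subseteq> S}"

definition walk :: "'a set \<Rightarrow> 'a set set \<Rightarrow> 'a list \<Rightarrow> bool" where
  "walk V E p \<longleftrightarrow> p \<noteq> [] \<and> set p \<subseteq> V \<and> successively (\<lambda>u v. {u, v} \<in> E) p"

definition walk_between :: "'a set \<Rightarrow> 'a set set \<Rightarrow> 'a \<Rightarrow> 'a list \<Rightarrow> 'a \<Rightarrow> bool" where
  "walk_between V E u p v \<longleftrightarrow> walk V E p \<and> hd p = u \<and> last p = v"

definition graph_components :: "'a set \<Rightarrow> 'a set set \<Rightarrow> 'a set set" where
  "graph_components V E = (\<lambda>u. {v \<in> V. \<exists>p. walk_between V E u p v}) ` V"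

definition graph_cycle :: "'a set \<Rightarrow> 'a set set \<Rightarrow> 'a list \<Rightarrow> bool" where
  "graph_cycle V E p \<longleftrightarrow>
     walk V E p \<and> distinct p \<and> length p \<ge> 3 \<and> {last p, hd p} \<in> E"

definition acyclic_graph :: "'a set \<Rightarrow> 'a set set \<Rightarrow> bool" where
  "acyclic_graph V E \<longleftrightarrow> (\<nexists>p. graph_cycle V E p)"

text \<open>
  A walk with \<open>l\<close> edges visits \<open>l + 1\<close> vertices.  Distance and diameter are meaningful
  only for nonempty finite connected graphs; they are applied to connected components only.
\<close>

definition graph_dist :: "'a set \<Rightarrow> 'a set set \<Rightarrow> 'a \<Rightarrow> 'a \<Rightarrow> nat" where
  "graph_dist V E u v = (LEAST l. \<exists>p. walk_between V E u p v \<and> length p = Suc l)"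

definition graph_diameter :: "'a set \<Rightarrow> 'a set set \<Rightarrow> nat" where
  "graph_diameter V E = Max ((\<lambda>(u, v). graph_dist V E u v) ` (V \<times> V))"

definition star_coloring :: "nat \<Rightarrow> 'a set \<Rightarrow> 'a set set \<Rightarrow> ('a \<Rightarrow> nat) \<Rightarrow> bool" where
  "star_coloring \<kappa> V E c \<longleftrightarrow>
     (\<forall>v\<in>V. c v < \<kappa>) \<and>
     (\<forall>i<\<kappa>. let S = {v \<in> V. c v = i} in
        \<forall>C \<in> graph_components S (induced_edges E S).
          acyclic_graph C (induced_edges E C) \<and>
          graph_diameter C (induced_edges E C) \<le> 2)"


section \<open>Outerplanarity\<close>

text \<open>
  Planar embeddings are topological: vertices are distinct points, and edges are arcs that
  meet each other and the vertices only in common endpoints.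
\<close>

definition planar_embedding ::
  "'a set \<Rightarrow> 'a set set \<Rightarrow> ('a \<Rightarrow> complex) \<Rightarrow> ('a set \<Rightarrow> real \<Rightarrow> complex) \<Rightarrow> bool" where
  "planar_embedding V E pos \<gamma> \<longleftrightarrow>
     inj_on pos V \<and>
     (\<forall>e\<in>E. arc (\<gamma> e) \<and> {pathstart (\<gamma> e), pathfinish (\<gamma> e)} = pos ` e \<and>
            path_image (\<gamma> e) \<inter> pos ` V = pos ` e) \<and>
     (\<forall>e\<in>E. \<forall>f\<in>E. e \<noteq> f \<longrightarrow>
            path_image (\<gamma> e) \<inter> path_image (\<gamma> f) = pos ` (e \<inter> f))"

definition drawing ::
  "'a set \<Rightarrow> 'a set set \<Rightarrow> ('a \<Rightarrow> complex) \<Rightarrow> ('a set \<Rightarrow> real \<Rightarrow> complex) \<Rightarrow> complex set" where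
  "drawing V E pos \<gamma> = pos ` V \<union> (\<Union>e\<in>E. path_image (\<gamma> e))"

text \<open>
  As the drawing is compact, its complement has exactly one unbounded component, the outer
  face; this is what the library constant \<^const>\<open>outside\<close> yields.
\<close>

definition outerplanar :: "'a set \<Rightarrow> 'a set set \<Rightarrow> bool" where
  "outerplanar V E \<longleftrightarrow> simple_graph V E \<and>
     (\<exists>pos \<gamma>. planar_embedding V E pos \<gamma> \<and>
        (\<forall>v\<in>V. pos v \<in> frontier (outside (drawing V E pos \<gamma>))))"


section \<open>A random-access machine with bounded words\<close>

text \<open>
  Programs are structured programs of a random-access machine: finitely many registers and
  finitely many zero-initialised arrays (those named in the program), all holding natural
  numbers, with indirect addressing of array cells.  Finitely many arrays can be interleaved
  in a single memory with constant overhead, so this is the usual machine with one memory.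
\<close>

type_synonym reg = nat
type_synonym arr = nat

datatype test = Less reg reg | Equal reg reg

datatype prog =
    Skip
  | Const reg nat
  | Copy reg reg
  | Add reg reg reg
  | Sub reg reg reg
  | Load reg arr reg
  | Store arr reg reg
  | Seq prog prog
  | Cond test prog prog
  | Loop test prog

record state =
  regs :: "reg \<Rightarrow> nat"
  arrs :: "arr \<Rightarrow> nat \<Rightarrow> nat"

fun holds :: "test \<Rightarrow> state \<Rightarrow> bool" where
  "holds (Less x y) s \<longleftrightarrow> regs s x < regs s y"
| "holds (Equal x y) s \<longleftrightarrow> regs s x = regs s y"

definition set_reg :: "reg \<Rightarrow> nat \<Rightarrow> state \<Rightarrow> state" where
  "set_reg x k s = s\<lparr>regs := (regs s)(x := k)\<rparr>"

definition set_cell :: "arr \<Rightarrow> nat \<Rightarrow> nat \<Rightarrow> state \<Rightarrow> state" where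
  "set_cell a i k s = s\<lparr>arrs := (arrs s)(a := (arrs s a)(i := k))\<rparr>"

text \<open>
  \<open>exec W P s t s'\<close>: started in \<open>s\<close>, program \<open>P\<close> halts in \<open>s'\<close> after exactly \<open>t\<close> unit-cost
  steps, where every instruction and every evaluation of a test is one step.  Words are the
  numbers below \<open>W\<close>: an instruction whose result is not below \<open>W\<close> is stuck, so that no run
  can exploit large numbers.
\<close>

inductive exec :: "nat \<Rightarrow> prog \<Rightarrow> state \<Rightarrow> nat \<Rightarrow> state \<Rightarrow> bool" for W :: nat where
  Skip: "exec W Skip s 1 s"
| Const: "k < W \<Longrightarrow> exec W (Const x k) s 1 (set_reg x k s)"
| Copy: "regs s y < W \<Longrightarrow> exec W (Copy x y) s 1 (set_reg x (regs s y) s)"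
| Add: "regs s y + regs s z < W \<Longrightarrow>
    exec W (Add x y z) s 1 (set_reg x (regs s y + regs s z) s)"
| Sub: "regs s y - regs s z < W \<Longrightarrow>
    exec W (Sub x y z) s 1 (set_reg x (regs s y - regs s z) s)"
| Load: "arrs s a (regs s y) < W \<Longrightarrow>
    exec W (Load x a y) s 1 (set_reg x (arrs s a (regs s y)) s)"
| Store: "regs s x < W \<Longrightarrow>
    exec W (Store a y x) s 1 (set_cell a (regs s y) (regs s x) s)"
| Seq: "exec W P s t s' \<Longrightarrow> exec W Q s' u s'' \<Longrightarrow> exec W (Seq P Q) s (t + u) s''"
| CondT: "holds b s \<Longrightarrow> exec W P s t s' \<Longrightarrow> exec W (Cond b P Q) s (t + 1) s'"
| CondF: "\<not> holds b s \<Longrightarrow> exec W Q s t s' \<Longrightarrow> exec W (Cond b P Q) s (t + 1) s'"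
| LoopF: "\<not> holds b s \<Longrightarrow> exec W (Loop b P) s 1 s"
| LoopT: "holds b s \<Longrightarrow> exec W P s t s' \<Longrightarrow> exec W (Loop b P) s' u s'' \<Longrightarrow>
    exec W (Loop b P) s (t + u + 1) s''"

inductive_cases exec_SeqE: "exec W (Seq P Q) s t s'"
inductive_cases exec_CondE: "exec W (Cond b P Q) s t s'"
inductive_cases exec_LoopE: "exec W (Loop b P) s t s'"

lemma exec_deterministic:
  assumes "exec W P s t s'" and "exec W P s u s''"
  shows "u = t \<and> s'' = s'"
  using assms
proof (induction arbitrary: u s'' rule: exec.induct)
  case (Seq P s t s' Q v r)
  from Seq.prems show ?case
  proof (rule exec_SeqE)
    fix t1 s1 t2 assume u: "u = t1 + t2" "exec W P s t1 s1" and Q: "exec W Q s1 t2 s''"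
    from Seq.IH(1)[OF u(2)] have "t1 = t" "s1 = s'" by simp_all
    with Seq.IH(2) Q u(1) show ?thesis by simp
  qed
next
  case (CondT b s P t s' Q)
  from CondT.prems show ?case
    by (rule exec_CondE) (simp_all add: CondT.IH CondT.hyps)
next
  case (CondF b s Q t s' P)
  from CondF.prems show ?case
    by (rule exec_CondE) (simp_all add: CondF.IH CondF.hyps)
next
  case (LoopF b s P)
  from LoopF.prems show ?case
    by (rule exec_LoopE) (simp_all add: LoopF.hyps)
next
  case (LoopT b s P t s' v r)
  from LoopT.prems show ?case
  proof (rule exec_LoopE)
    assume "\<not> holds b s"
    with LoopT.hyps show ?thesis by simp
  next
    fix t1 s1 t2
    assume u: "u = Suc (t1 + t2)" "exec W P s t1 s1" and Q: "exec W (Loop b P) s1 t2 s''"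
    from LoopT.IH(1)[OF u(2)] have "t1 = t" "s1 = s'" by simp_all
    with LoopT.IH(2) Q u(1) show ?thesis by simp
  qed
qed (erule exec.cases; simp; fail)+


section \<open>Graphs as machine inputs\<close>

text \<open>
  The input graph has vertices \<open>0, \<dots>, n - 1\<close> and is presented as a list of its edges, each
  occurring exactly once, in arbitrary order and orientation.
\<close>

definition lists_graph :: "nat \<Rightarrow> (nat \<times> nat) list \<Rightarrow> nat set \<Rightarrow> nat set set \<Rightarrow> bool" where
  "lists_graph n es V E \<longleftrightarrow>
     V = {..<n} \<and> E = (\<lambda>(u, v). {u, v}) ` set es \<and>
     distinct (map (\<lambda>(u, v). {u, v}) es) \<and> simple_graph V E"

text \<open>
  Registers 0 and 1 hold the numbers of vertices and edges, arrays 0 and 1 the first and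
  second endpoints of the edges.
\<close>

definition input_state :: "nat \<Rightarrow> (nat \<times> nat) list \<Rightarrow> state" where
  "input_state n es =
     \<lparr>regs = (\<lambda>_. 0)(0 := n, 1 := length es),
      arrs = (\<lambda>_ _. 0)
        (0 := (\<lambda>i. if i < length es then fst (es ! i) else 0),
         1 := (\<lambda>i. if i < length es then snd (es ! i) else 0))\<rparr>"

text \<open>The answer of a halted run is in register 0, the computed colors are in array 0.\<close>

definition accepts :: "state \<Rightarrow> bool" where
  "accepts s \<longleftrightarrow> regs s 0 \<noteq> 0"

definition output_coloring :: "state \<Rightarrow> nat \<Rightarrow> nat" where
  "output_coloring s = arrs s 0"

end

theory Submission
  imports Defs
begin

text \<open>
  A 2-coloring is a star coloring iff its vertices can be declared centers and leaves such that
  every monochromatic edge joins a center and a leaf and every leaf has at most one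
  monochromatic edge.  This is a local condition, so it can be tested by repeatedly eliminating
  a vertex of degree at most 2: the edges at it are replaced by one link between its neighbors,
  which carries the finite table of the colors, roles and edge counts at its ends that extend to
  the eliminated part.  Parallel links are merged by combining their tables.  A coloring exists
  iff no table becomes empty, and undoing the operations in reverse order then reads it off.

  The graph of live links stays outerplanar, and an outerplanar graph has a vertex of degree at
  most 2 because it contains no subdivided \<open>K\<^sub>4\<close>: in a planar drawing of one, some vertex is
  enclosed by a cycle of the others.  A vertex enters the work list whenever a link at it is
  created, and parallel links are looked for only among the first links at a scanned vertex, so a
  potential linear in the size of the graph decreases with every machine step.  Tables are numbers
  of constant size and are combined by decision trees.
\<close>

section \<open>Arcs in the plane\<close>

text \<open>Roles make the star condition additive: a monochromatic edge charges one unit to its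
  leaf end, and a vertex may be charged at most one unit in total. So a link has to remember,
  besides the states of its two ends, only one bit per end about everything eliminated behind it. A
  solution survives every operation with the same vertex states, hence a solvable input never
  produces an empty table. Conversely, if no table is empty, the links that remain at the end have a
  solution, and each operation can be undone from it. The dummy vertex \<open>n\<close> removes the
  distinction by degree: eliminating a vertex with one neighbor leaves a link to \<open>n\<close>,
  and with no neighbor a link from \<open>n\<close> to \<open>n\<close>. Finding all parallel links
  at a vertex of large degree would amount to sorting. A scan therefore ends at the first parallel
  pair, at the third distinct neighbor, or at the end of the list, and in the last case at most
  three links are present. Word size is treated separately: correctness and running time are shown
  for unbounded words, and a run of linear length is then seen to produce only linearly large
  numbers.\<close>

definition arc_set :: "complex set \<Rightarrow> complex \<Rightarrow> complex \<Rightarrow> bool" where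
  "arc_set A a b \<longleftrightarrow> (\<exists>g. arc g \<and> pathstart g = a \<and> pathfinish g = b \<and> path_image g = A)"

lemma arc_set_sym: "arc_set A a b \<Longrightarrow> arc_set A b a"
  unfolding arc_set_def by (metis arc_reversepath path_image_reversepath pathfinish_reversepath pathstart_reversepath)

lemma arc_set_props:
  assumes "arc_set A a b"
  shows "a \<noteq> b" "a \<in> A" "b \<in> A" "compact A" "connected A" "connected (A - {a,b})" "A - {a,b} \<noteq> {}"
proof -
  obtain g where g: "arc g" "pathstart g = a" "pathfinish g = b" "path_image g = A"
    using assms unfolding arc_set_def by blast
  have sp: "simple_path g" using g arc_imp_simple_path by blast
  show "a \<noteq> b" using g arc_distinct_ends by blast
  show "a \<in> A" "b \<in> A" using g by auto
  show "compact A" "connected A"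
    using g arc_imp_path compact_path_image connected_path_image by blast+
  show "connected (A - {a,b})" using connected_simple_path_endless[OF sp] g by simp
  show "A - {a,b} \<noteq> {}" using nonempty_simple_path_endless[OF sp] g by simp
qed

lemma arc_set_join:
  assumes "arc_set A a b" "arc_set B b c" "A \<inter> B \<subseteq> {b}"
  shows "arc_set (A \<union> B) a c"
proof -
  obtain g h where g: "arc g" "pathstart g = a" "pathfinish g = b" "path_image g = A"
    and h: "arc h" "pathstart h = b" "pathfinish h = c" "path_image h = B"
    using assms unfolding arc_set_def by metis
  have "arc (g +++ h)" using g h assms by (intro arc_join) auto
  then show ?thesis using g h unfolding arc_set_def
    by (intro exI[of _ "g +++ h"]) (auto simp: path_image_join)
qed

text \<open>A connected set with more than one point has no isolated point, and removing two points
  from a set keeps all its limit points.\<close>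

lemma arc_set_closure_endless:
  assumes "arc_set A a b"
  shows "A \<subseteq> closure (A - {a,b})"
proof -
  note p = arc_set_props[OF assms]
  have "\<not> (\<exists>x. A = {x})" using p(1-3) by auto
  then have lim: "x islimpt A" if "x \<in> A" for x
    using connected_imp_perfect[OF p(5) that] by blast
  have "x islimpt (A - {a,b})" if "x \<in> A" for x
    using lim[OF that] islimpt_Un_finite[of "{a,b}" x "A - {a,b}"]
    by (metis Un_Diff_cancel2 finite.emptyI finite.insertI islimpt_Un sup.commute islimpt_finite)
  then show ?thesis unfolding closure_def by auto
qed

lemma Jordan_two_arcs:
  assumes "arc_set A a b" "arc_set B a b" "A \<inter> B = {a,b}"
  shows "inside (A \<union> B) \<noteq> {}" "open (inside (A \<union> B))" "connected (inside (A \<union> B))"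
    "open (outside (A \<union> B))" "connected (outside (A \<union> B))" "outside (A \<union> B) \<noteq> {}"
    "frontier (inside (A \<union> B)) = A \<union> B"
proof -
  obtain g h where g: "arc g" "pathstart g = a" "pathfinish g = b" "path_image g = A"
    and h: "arc h" "pathstart h = b" "pathfinish h = a" "path_image h = B"
    using assms arc_set_sym unfolding arc_set_def by metis
  have sp: "simple_path (g +++ h)" using g h assms by (intro simple_path_join_loop) auto
  have im: "path_image (g +++ h) = A \<union> B" using g h by (simp add: path_image_join)
  have cl: "pathfinish (g +++ h) = pathstart (g +++ h)" using g h by simp
  show "inside (A \<union> B) \<noteq> {}" "open (inside (A \<union> B))" "connected (inside (A \<union> B))"
    "open (outside (A \<union> B))" "connected (outside (A \<union> B))" "outside (A \<union> B) \<noteq> {}"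
    "frontier (inside (A \<union> B)) = A \<union> B"
    using Jordan_inside_outside[OF sp cl] unfolding im by auto
qed

lemma split_inside_arcs:
  assumes "arc_set A a b" "arc_set B a b" "arc_set C a b"
    "A \<inter> B = {a,b}" "A \<inter> C = {a,b}" "B \<inter> C = {a,b}" "C \<inter> inside (A \<union> B) \<noteq> {}"
  shows "inside (A \<union> C) \<inter> inside (B \<union> C) = {}"
    "inside (A \<union> C) \<union> inside (B \<union> C) \<union> (C - {a,b}) = inside (A \<union> B)"
proof -
  obtain g h k where g: "arc g" "pathstart g = a" "pathfinish g = b" "path_image g = A"
    and h: "arc h" "pathstart h = a" "pathfinish h = b" "path_image h = B"
    and k: "arc k" "pathstart k = a" "pathfinish k = b" "path_image k = C"
    using assms unfolding arc_set_def by metis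
  have "inside (A \<union> C) \<inter> inside (B \<union> C) = {} \<and>
    inside (A \<union> C) \<union> inside (B \<union> C) \<union> (C - {a,b}) = inside (A \<union> B)"
    by (rule split_inside_simple_closed_curve[of g a b h k])
      (use g h k assms arc_set_props[OF assms(1)] arc_imp_simple_path in auto)
  then show "inside (A \<union> C) \<inter> inside (B \<union> C) = {}"
    "inside (A \<union> C) \<union> inside (B \<union> C) \<union> (C - {a,b}) = inside (A \<union> B)" by auto
qed

text \<open>Without its end points the arc is connected and misses the closed curve
  \<open>A \<union> B\<close>, so it cannot meet both sides.\<close>

lemma arc_endless_dichotomy:
  assumes C: "arc_set C a b" and AB: "arc_set A a b" "arc_set B a b" "A \<inter> B = {a,b}"
    and "A \<inter> C = {a,b}" "B \<inter> C = {a,b}"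
  shows "C - {a,b} \<subseteq> inside (A \<union> B) \<or> C - {a,b} \<subseteq> outside (A \<union> B)"
proof (rule ccontr)
  assume n: "\<not> ?thesis"
  have sub: "C - {a,b} \<subseteq> inside (A \<union> B) \<union> outside (A \<union> B)" using assms by auto
  have "inside (A \<union> B) \<inter> (C - {a,b}) \<noteq> {}" "outside (A \<union> B) \<inter> (C - {a,b}) \<noteq> {}"
    using n sub by blast+
  from inside_outside_intersect_connected[OF arc_set_props(6)[OF C] this]
  show False using assms by auto
qed

text \<open>
  In a theta graph one of the three arcs is enclosed by the other two: otherwise a point
  inside \<open>A \<union> B\<close> could be joined to infinity in the complement of \<open>A \<union> C\<close> and of
  \<open>B \<union> C\<close>, hence by Janiszewski in the complement of the whole theta graph.
\<close>

lemma theta_not_all_outside: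
  assumes A: "arc_set A a b" and B: "arc_set B a b" and C: "arc_set C a b"
    and AB: "A \<inter> B = {a,b}" and AC: "A \<inter> C = {a,b}" and BC: "B \<inter> C = {a,b}"
    and oA: "A - {a,b} \<subseteq> outside (B \<union> C)"
    and oB: "B - {a,b} \<subseteq> outside (A \<union> C)"
    and oC: "C - {a,b} \<subseteq> outside (A \<union> B)"
  shows False
proof -
  note jAB = Jordan_two_arcs[OF A B AB]
  note jAC = Jordan_two_arcs[OF A C AC]
  note jBC = Jordan_two_arcs[OF B C BC]
  \<comment> \<open>Each of the two insides is connected and misses the other curve. If they met,
    each would contain the other, and equal insides have equal frontiers, which would identify
    \<open>P \<union> Q\<close> with \<open>P \<union> R\<close>.\<close>
  have inside_disj: "inside (P \<union> Q) \<inter> inside (P \<union> R) = {}"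
    if P: "arc_set P a b" and Q: "arc_set Q a b" and R: "arc_set R a b"
      and PQ: "P \<inter> Q = {a,b}" and PR: "P \<inter> R = {a,b}" and QR: "Q \<inter> R = {a,b}"
      and oR: "R - {a,b} \<subseteq> outside (P \<union> Q)" and oQ: "Q - {a,b} \<subseteq> outside (P \<union> R)" for P Q R
  proof (rule ccontr)
    assume ne: "inside (P \<union> Q) \<inter> inside (P \<union> R) \<noteq> {}"
    have sub: "inside (U \<union> V) \<subseteq> inside (U \<union> W)"
      if "arc_set U a b" "arc_set V a b" "arc_set W a b" "U \<inter> V = {a,b}"
        "W - {a,b} \<subseteq> outside (U \<union> V)" "inside (U \<union> V) \<inter> inside (U \<union> W) \<noteq> {}" for U V W
    proof -
      have con: "connected (inside (U \<union> V))" using Jordan_two_arcs that by blast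
      have "inside (U \<union> V) \<inter> (U \<union> W) = {}"
        using that(5) inside_no_overlap[of "U \<union> V"] inside_Int_outside[of "U \<union> V"]
          arc_set_props(2,3)[OF that(1)] by blast
      then show ?thesis
        using inside_outside_intersect_connected[OF con, of "U \<union> W"] that(6)
          inside_Un_outside[of "U \<union> W"] by blast
    qed
    have "inside (P \<union> Q) \<subseteq> inside (P \<union> R)" using sub[OF P Q R PQ oR ne] .
    moreover have "inside (P \<union> R) \<subseteq> inside (P \<union> Q)" using sub[OF P R Q PR oQ] ne by blast
    ultimately have "frontier (inside (P \<union> R)) = frontier (inside (P \<union> Q))" by auto
    then have "P \<union> R = P \<union> Q"
      using Jordan_two_arcs(7)[OF P Q PQ] Jordan_two_arcs(7)[OF P R PR] by simp
    then show False using arc_set_props(7)[OF R] PR QR by blast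
  qed
  obtain x where x: "x \<in> inside (A \<union> B)" using jAB(1) by blast
  have bnd: "bounded (A \<union> B \<union> C)"
    using arc_set_props(4) A B C compact_imp_bounded by (meson bounded_Un)
  obtain y where y: "y \<in> outside (A \<union> B \<union> C)"
    using outside_bounded_nonempty[OF bnd] by blast
  have xC: "x \<notin> C" using x oC inside_Int_outside[of "A \<union> B"] inside_no_overlap[of "A \<union> B"]
      arc_set_props(2,3)[OF A] by blast
  have xAB: "x \<notin> A \<union> B" using x inside_no_overlap[of "A \<union> B"] by blast
  have "x \<notin> inside (A \<union> C)" using inside_disj[OF A B C AB AC BC oC oB] x by blast
  then have xo1: "x \<in> outside (A \<union> C)" using xC xAB inside_Un_outside[of "A \<union> C"] by blast
  have "inside (B \<union> A) \<inter> inside (B \<union> C) = {}"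
    by (rule inside_disj) (use A B C AB AC BC oA oB oC in \<open>auto simp: Un_commute Int_commute\<close>)
  then have "x \<notin> inside (B \<union> C)" using x by (auto simp: Un_commute)
  then have xo2: "x \<in> outside (B \<union> C)" using xC xAB inside_Un_outside[of "B \<union> C"] by blast
  have yo: "y \<in> outside (A \<union> C)" "y \<in> outside (B \<union> C)" "y \<in> outside (A \<union> B)"
    using y outside_mono[of _ "A \<union> B \<union> C"] by blast+
  have c1: "connected_component (- (A \<union> C)) x y"
    unfolding connected_component_def using jAC(5) xo1 yo(1) outside_no_overlap by blast
  have c2: "connected_component (- (B \<union> C)) x y"
    unfolding connected_component_def using jBC(5) xo2 yo(2) outside_no_overlap by blast
  \<comment> \<open>Janiszewski's theorem needs the two compact sets to meet in a connected set;
    that set is the arc \<open>C\<close>.\<close>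
  have "(A \<union> C) \<inter> (B \<union> C) = C" using AB arc_set_props(2,3)[OF C] by auto
  then have "connected ((A \<union> C) \<inter> (B \<union> C))" using arc_set_props(5)[OF C] by simp
  then have "connected_component (- ((A \<union> C) \<union> (B \<union> C))) x y"
    using Janiszewski[OF _ _ _ c1 c2] arc_set_props(4) A B C compact_imp_closed by (meson compact_Un)
  then have "connected_component (- (A \<union> B)) x y"
    by (rule connected_component_of_subset) blast
  then have "y \<in> inside (A \<union> B)" using inside_same_component x by blast
  then show False using yo(3) inside_Int_outside[of "A \<union> B"] by blast
qed

text \<open>A point bordering the outer face cannot lie in the open inside of a cycle of the
  drawing. Hence the arc \<open>A\<close> runs outside the cycle of \<open>B\<close> and
  \<open>C\<close>, and likewise \<open>B\<close> outside that of \<open>A\<close> and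
  \<open>C\<close>. Not all three arcs can be outside, so \<open>C\<close> is the enclosed
  one.\<close>

lemma theta_third_arc_inside:
  assumes A: "arc_set A a b" and B: "arc_set B a b" and C: "arc_set C a b"
    and AB: "A \<inter> B = {a,b}" and AC: "A \<inter> C = {a,b}" and BC: "B \<inter> C = {a,b}"
    and p: "p \<in> A - {a,b}" "p \<in> closure (outside (A \<union> B \<union> C))"
    and q: "q \<in> B - {a,b}" "q \<in> closure (outside (A \<union> B \<union> C))"
  shows "C - {a,b} \<subseteq> inside (A \<union> B)"
proof (rule ccontr)
  have out: "P - {a,b} \<subseteq> outside (Q \<union> R)"
    if P: "arc_set P a b" and Q: "arc_set Q a b" and R: "arc_set R a b"
      and PQ: "P \<inter> Q = {a,b}" and PR: "P \<inter> R = {a,b}" and QR: "Q \<inter> R = {a,b}"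
      and r: "r \<in> P - {a,b}" "r \<in> closure (outside (P \<union> Q \<union> R))" for P Q R r
  proof -
    have "open (inside (Q \<union> R))" using Jordan_two_arcs(2)[OF Q R QR] .
    moreover have "inside (Q \<union> R) \<inter> outside (P \<union> Q \<union> R) = {}"
      using outside_mono[of "Q \<union> R" "P \<union> Q \<union> R"] inside_Int_outside[of "Q \<union> R"] by blast
    ultimately have "r \<notin> inside (Q \<union> R)" using r(2) open_Int_closure_eq_empty by blast
    then show ?thesis
      using arc_endless_dichotomy[OF P Q R QR] PQ PR r(1) by (auto simp: Int_commute)
  qed
  assume "\<not> ?thesis"
  then have oC: "C - {a,b} \<subseteq> outside (A \<union> B)"
    using arc_endless_dichotomy[OF C A B AB AC BC] by blast
  have oA: "A - {a,b} \<subseteq> outside (B \<union> C)" using out[OF A B C AB AC BC p] .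
  have oB: "B - {a,b} \<subseteq> outside (A \<union> C)"
    by (rule out[OF B A C _ BC AC q(1)]) (use q AB in \<open>auto simp: Un_commute Int_commute\<close>)
  show False using theta_not_all_outside[OF A B C AB AC BC oA oB oC] .
qed

text \<open>The 4-cycle through \<open>a\<close>, \<open>c\<close>, \<open>b\<close>,
  \<open>d\<close> forms a theta graph with either diagonal, and two outer points lie on the two
  sides of the cycle; so both diagonals run inside the cycle. The diagonal \<open>AB\<close> cuts
  the inside into two regions. \<open>CD\<close> is disjoint from \<open>AB\<close> and must stay in
  one of them, but \<open>c\<close> borders only the one and \<open>d\<close> only the
  other.\<close>

lemma no_outerplanar_K4:
  assumes ab: "arc_set AB a b" and ac: "arc_set AC a c" and ad: "arc_set AD a d"
    and bc: "arc_set BC b c" and bd: "arc_set BD b d" and cd: "arc_set CD c d"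
    and i: "AB \<inter> AC \<subseteq> {a}" "AB \<inter> AD \<subseteq> {a}" "AC \<inter> AD \<subseteq> {a}"
      "AB \<inter> BC \<subseteq> {b}" "AB \<inter> BD \<subseteq> {b}" "BC \<inter> BD \<subseteq> {b}"
      "AC \<inter> BC \<subseteq> {c}" "AC \<inter> CD \<subseteq> {c}" "BC \<inter> CD \<subseteq> {c}"
      "AD \<inter> BD \<subseteq> {d}" "AD \<inter> CD \<subseteq> {d}" "BD \<inter> CD \<subseteq> {d}"
      "AB \<inter> CD = {}" "AC \<inter> BD = {}" "AD \<inter> BC = {}"
    and U: "AB \<union> AC \<union> AD \<union> BC \<union> BD \<union> CD \<subseteq> U"
    and fr: "{a,b,c,d} \<subseteq> closure (outside U)"
  shows False
proof -
  note mem = arc_set_props(2,3)[OF ab] arc_set_props(2,3)[OF ac] arc_set_props(2,3)[OF ad]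
    arc_set_props(2,3)[OF bc] arc_set_props(2,3)[OF bd] arc_set_props(2,3)[OF cd]
  note ne = arc_set_props(1)[OF ab] arc_set_props(1)[OF ac] arc_set_props(1)[OF ad]
    arc_set_props(1)[OF bc] arc_set_props(1)[OF bd] arc_set_props(1)[OF cd]
  have clo: "{a,b,c,d} \<subseteq> closure (outside W)" if "W \<subseteq> U" for W
    using fr closure_mono[OF outside_mono[OF that]] by blast
  let ?Q = "AC \<union> BC \<union> (AD \<union> BD)"
  have acb: "arc_set (AC \<union> BC) a b" using arc_set_join[OF ac arc_set_sym[OF bc]] i by blast
  have adb: "arc_set (AD \<union> BD) a b" using arc_set_join[OF ad arc_set_sym[OF bd]] i by blast
  have cad: "arc_set (AC \<union> AD) c d" using arc_set_join[OF arc_set_sym[OF ac] ad] i by blast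
  have cbd: "arc_set (BC \<union> BD) c d" using arc_set_join[OF arc_set_sym[OF bc] bd] i by blast
  have x: "AC \<inter> AD = {a}" "AB \<inter> AC = {a}" "AB \<inter> AD = {a}" "BC \<inter> BD = {b}"
      "AB \<inter> BC = {b}" "AB \<inter> BD = {b}" "AC \<inter> BC = {c}" "AC \<inter> CD = {c}"
      "BC \<inter> CD = {c}" "AD \<inter> BD = {d}" "AD \<inter> CD = {d}" "BD \<inter> CD = {d}" "AD \<inter> BC = {}"
    using i mem by (simp_all add: subset_singleton_iff) (metis IntI empty_iff)+
  have e1: "(AC \<union> BC) \<inter> (AD \<union> BD) = {a,b}" "(AC \<union> BC) \<inter> AB = {a,b}" "(AD \<union> BD) \<inter> AB = {a,b}"
    using x i(14) by (simp_all add: Int_Un_distrib Int_Un_distrib2 Int_commute insert_commute)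
  have e2: "(AC \<union> AD) \<inter> (BC \<union> BD) = {c,d}" "(AC \<union> AD) \<inter> CD = {c,d}" "(BC \<union> BD) \<inter> CD = {c,d}"
    using x i(14) by (simp_all add: Int_Un_distrib Int_Un_distrib2 Int_commute insert_commute)
  have inAB: "AB - {a,b} \<subseteq> inside ?Q"
    by (rule theta_third_arc_inside[OF acb adb ab e1, of c d])
      (use mem ne clo[of "?Q \<union> AB"] U in auto)
  have "CD - {c,d} \<subseteq> inside (AC \<union> AD \<union> (BC \<union> BD))"
    by (rule theta_third_arc_inside[OF cad cbd cd e2, of a b])
      (use mem ne clo[of "AC \<union> AD \<union> (BC \<union> BD) \<union> CD"] U in auto)
  moreover have Qeq: "AC \<union> AD \<union> (BC \<union> BD) = ?Q" by blast
  ultimately have inCD: "CD - {c,d} \<subseteq> inside ?Q" by simp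
  have "AB \<inter> inside ?Q \<noteq> {}" using inAB arc_set_props(7)[OF ab] by blast
  note sp = split_inside_arcs[OF acb adb ab e1 this]
  let ?I = "inside (AC \<union> BC \<union> AB)" and ?J = "inside (AD \<union> BD \<union> AB)"
  have cover: "CD - {c,d} \<subseteq> ?I \<union> ?J" using inCD sp(2) i(13) by blast
  have opI: "open ?I" "open ?J" using Jordan_two_arcs(2) acb adb ab e1 by blast+
  have "CD - {c,d} \<subseteq> ?I \<or> CD - {c,d} \<subseteq> ?J"
    using connectedD[OF arc_set_props(6)[OF cd] opI] sp(1) cover by blast
  moreover have cl: "{c,d} \<subseteq> closure (CD - {c,d})" using arc_set_closure_endless[OF cd] mem by blast
  have clI: "closure ?I = ?I \<union> (AC \<union> BC \<union> AB)" "closure ?J = ?J \<union> (AD \<union> BD \<union> AB)"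
    using closure_Un_frontier Jordan_two_arcs(7)[OF acb ab e1(2)] Jordan_two_arcs(7)[OF adb ab e1(3)]
    by blast+
  have notQ: "c \<notin> inside ?Q" "d \<notin> inside ?Q" using inside_no_overlap[of ?Q] mem by blast+
  note cdm = arc_set_props(1-3)[OF cd]
  have "\<not> CD - {c,d} \<subseteq> ?I"
  proof
    assume "CD - {c,d} \<subseteq> ?I"
    then have "d \<in> closure ?I" using cl closure_mono by blast
    then have "d \<in> ?I \<or> d \<in> AC \<union> BC \<union> AB" using clI by blast
    moreover have "d \<notin> AC \<union> BC \<union> AB" using x(8,9) i(13) cdm by auto
    ultimately show False using notQ sp(2) by blast
  qed
  moreover have "\<not> CD - {c,d} \<subseteq> ?J"
  proof
    assume "CD - {c,d} \<subseteq> ?J"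
    then have "c \<in> closure ?J" using cl closure_mono by blast
    then have "c \<in> ?J \<or> c \<in> AD \<union> BD \<union> AB" using clI by blast
    moreover have "c \<notin> AD \<union> BD \<union> AB" using x(11,12) i(13) cdm by auto
    ultimately show False using notQ sp(2) by blast
  qed
  ultimately show False by blast
qed

section \<open>Outerplanar graphs\<close>

fun walk_edges :: "'a list \<Rightarrow> 'a set set" where
  "walk_edges (u # v # p) = insert {u, v} (walk_edges (v # p))"
| "walk_edges _ = {}"

definition walk_image :: "('a set \<Rightarrow> real \<Rightarrow> complex) \<Rightarrow> 'a list \<Rightarrow> complex set" where
  "walk_image \<gamma> p = (\<Union>e\<in>walk_edges p. path_image (\<gamma> e))"

lemma walk_edges_subset: "e \<in> walk_edges p \<Longrightarrow> e \<subseteq> set p"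
  by (induction p rule: walk_edges.induct) auto

lemma walk_edges_in: "walk V E p \<Longrightarrow> walk_edges p \<subseteq> E"
  unfolding walk_def by (induction p rule: walk_edges.induct) auto

text \<open>A common edge would have both of its end points among the shared vertices. Sharing at
  most one vertex therefore makes all edges of the two walks distinct, and distinct edges meet only
  in common end points.\<close>

lemma walk_image_Int:
  assumes pe: "planar_embedding V E pos \<gamma>" and sg: "simple_graph V E"
    and p: "walk V E p" and q: "walk V E q" and pq: "set p \<inter> set q \<subseteq> {w}"
  shows "walk_image \<gamma> p \<inter> walk_image \<gamma> q \<subseteq> pos ` (set p \<inter> set q)"
proof
  fix x assume "x \<in> walk_image \<gamma> p \<inter> walk_image \<gamma> q"
  then obtain e f where e: "e \<in> walk_edges p" "x \<in> path_image (\<gamma> e)"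
    and f: "f \<in> walk_edges q" "x \<in> path_image (\<gamma> f)" unfolding walk_image_def by blast
  have E: "e \<in> E" "f \<in> E" using e f walk_edges_in p q by blast+
  have sub: "e \<subseteq> set p" "f \<subseteq> set q" using e f walk_edges_subset by blast+
  have "e \<noteq> f"
  proof
    assume "e = f"
    then have "e \<subseteq> {w}" using sub pq by blast
    then have "card e \<le> 1" by (metis card.empty card_insert_disjoint card_mono empty_iff
          finite.emptyI finite.insertI One_nat_def)
    then show False using E sg unfolding simple_graph_def by auto
  qed
  then have "x \<in> pos ` (e \<inter> f)" using pe E e f unfolding planar_embedding_def by blast
  then show "x \<in> pos ` (set p \<inter> set q)" using sub by blast
qed

lemma edge_arc_set:
  assumes "planar_embedding V E pos \<gamma>" "{u, v} \<in> E" "u \<noteq> v" "u \<in> V" "v \<in> V"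
  shows "arc_set (path_image (\<gamma> {u, v})) (pos u) (pos v)"
proof -
  have a: "arc (\<gamma> {u,v})" and b: "{pathstart (\<gamma> {u,v}), pathfinish (\<gamma> {u,v})} = {pos u, pos v}"
    using assms unfolding planar_embedding_def by auto
  from b consider "pathstart (\<gamma> {u,v}) = pos u" "pathfinish (\<gamma> {u,v}) = pos v"
    | "pathstart (\<gamma> {u,v}) = pos v" "pathfinish (\<gamma> {u,v}) = pos u"
    by (auto simp: doubleton_eq_iff)
  then show ?thesis
  proof cases
    case 1 then show ?thesis using a unfolding arc_set_def by blast
  next
    case 2
    then have "arc_set (path_image (\<gamma> {u, v})) (pos v) (pos u)" using a unfolding arc_set_def by blast
    then show ?thesis by (rule arc_set_sym)
  qed
qed

lemma walk_arc_set:
  assumes pe: "planar_embedding V E pos \<gamma>" and sg: "simple_graph V E"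
    and "walk V E p" "distinct p" "2 \<le> length p"
  shows "arc_set (walk_image \<gamma> p) (pos (hd p)) (pos (last p))"
  using assms(3-5)
proof (induction p rule: walk_edges.induct)
  case (1 u v p)
  have uv: "{u,v} \<in> E" "u \<noteq> v" "u \<in> V" "v \<in> V" using 1 by (auto simp: walk_def)
  note e = edge_arc_set[OF pe uv]
  show ?case
  proof (cases p)
    case Nil
    then show ?thesis using e by (simp add: walk_image_def)
  next
    case (Cons w r)
    have wv: "walk V E (v # p)" using 1(2) by (auto simp: walk_def)
    have IH: "arc_set (walk_image \<gamma> (v # p)) (pos v) (pos (last (v # p)))"
      using 1 wv Cons by simp
    have w2: "walk V E [u, v]" using uv by (simp add: walk_def)
    have "walk_image \<gamma> [u,v] \<inter> walk_image \<gamma> (v # p) \<subseteq> pos ` (set [u,v] \<inter> set (v # p))"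
      by (rule walk_image_Int[OF pe sg w2 wv, of v]) (use 1 in auto)
    also have "\<dots> \<subseteq> {pos v}" using 1 by auto
    finally have "path_image (\<gamma> {u,v}) \<inter> walk_image \<gamma> (v # p) \<subseteq> {pos v}"
      by (simp add: walk_image_def)
    from arc_set_join[OF e IH this] show ?thesis by (simp add: walk_image_def)
  qed
qed auto

text \<open>The six walks are drawn as six arcs; sharing vertices only at branch vertices becomes
  the intersection pattern required by \<open>no_outerplanar_K4\<close>.\<close>

lemma outerplanar_no_K4_subdivision:
  assumes op: "outerplanar V E"
    and w: "walk_between V E a pab b" "walk_between V E a pac c" "walk_between V E a pad d"
      "walk_between V E b pbc c" "walk_between V E b pbd d" "walk_between V E c pcd d"
    and d: "distinct pab" "distinct pac" "distinct pad" "distinct pbc" "distinct pbd" "distinct pcd"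
    and ne: "a \<noteq> b" "a \<noteq> c" "a \<noteq> d" "b \<noteq> c" "b \<noteq> d" "c \<noteq> d"
    and i: "set pab \<inter> set pac = {a}" "set pab \<inter> set pad = {a}" "set pac \<inter> set pad = {a}"
      "set pab \<inter> set pbc = {b}" "set pab \<inter> set pbd = {b}" "set pbc \<inter> set pbd = {b}"
      "set pac \<inter> set pbc = {c}" "set pac \<inter> set pcd = {c}" "set pbc \<inter> set pcd = {c}"
      "set pad \<inter> set pbd = {d}" "set pad \<inter> set pcd = {d}" "set pbd \<inter> set pcd = {d}"
      "set pab \<inter> set pcd = {}" "set pac \<inter> set pbd = {}" "set pad \<inter> set pbc = {}"
  shows False
proof -
  obtain pos \<gamma> where pe: "planar_embedding V E pos \<gamma>" and sg: "simple_graph V E"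
    and fr: "\<And>v. v \<in> V \<Longrightarrow> pos v \<in> frontier (outside (drawing V E pos \<gamma>))"
    using op unfolding outerplanar_def by blast
  have arcs: "arc_set (walk_image \<gamma> p) (pos u) (pos v)"
    if "walk_between V E u p v" "distinct p" "u \<noteq> v" for u v p
  proof -
    have "2 \<le> length p" using that unfolding walk_between_def walk_def
      by (cases p rule: walk_edges.cases) auto
    then show ?thesis using walk_arc_set[OF pe sg _ that(2)] that unfolding walk_between_def by blast
  qed
  have I: "walk_image \<gamma> p \<inter> walk_image \<gamma> q \<subseteq> pos ` (set p \<inter> set q)"
    if "walk_between V E u p v" "walk_between V E u' q v'" "set p \<inter> set q \<subseteq> {x}" for p q u v u' v' x
    using walk_image_Int[OF pe sg] that unfolding walk_between_def by blast
  have U: "walk_image \<gamma> p \<subseteq> drawing V E pos \<gamma>" if "walk_between V E u p v" for u p v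
    using walk_edges_in that unfolding walk_between_def walk_image_def drawing_def by blast
  have V: "u \<in> V" "v \<in> V" if "walk_between V E u p v" for u p v
    using that unfolding walk_between_def walk_def by auto
  have c: "{pos a, pos b, pos c, pos d} \<subseteq> closure (outside (drawing V E pos \<gamma>))"
    using fr V w unfolding frontier_def by blast
  show False
    by (rule no_outerplanar_K4[OF arcs[OF w(1) d(1) ne(1)] arcs[OF w(2) d(2) ne(2)]
          arcs[OF w(3) d(3) ne(3)] arcs[OF w(4) d(4) ne(4)] arcs[OF w(5) d(5) ne(5)]
          arcs[OF w(6) d(6) ne(6)] _ _ _ _ _ _ _ _ _ _ _ _ _ _ _ _ c])
      (use I[OF w(1) w(2)] I[OF w(1) w(3)] I[OF w(2) w(3)] I[OF w(1) w(4)] I[OF w(1) w(5)]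
        I[OF w(4) w(5)] I[OF w(2) w(4)] I[OF w(2) w(6)] I[OF w(4) w(6)] I[OF w(3) w(5)]
        I[OF w(3) w(6)] I[OF w(5) w(6)] I[OF w(1) w(6)] I[OF w(2) w(5)] I[OF w(3) w(4)]
        i U w in simp_all)
qed

text \<open>
  Take a longest path \<open>v 0, \<dots>, v k\<close> whose first chord \<open>{v 0, v i}\<close> is as short as possible.
  Reversing \<open>v 0, \<dots>, v (i - 1)\<close> gives another longest path, so a third neighbor of
  \<open>v (i - 1)\<close> lies beyond \<open>v i\<close>; together with a second chord at \<open>v 0\<close> this makes a
  subdivided \<open>K\<^sub>4\<close>.
\<close>

lemma outerplanar_low_degree:
  assumes op: "outerplanar V E" and ne: "V \<noteq> {}"
  shows "\<exists>v\<in>V. card {u. {u, v} \<in> E} \<le> 2"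
proof (rule ccontr)
  assume "\<not> ?thesis"
  then have deg: "card {u. {u, v} \<in> E} \<ge> 3" if "v \<in> V" for v using that by force
  have sg: "finite V" "\<And>e. e \<in> E \<Longrightarrow> e \<subseteq> V \<and> card e = 2"
    using op unfolding outerplanar_def simple_graph_def by auto
  have irr: "{u,u} \<notin> E" for u using sg(2)[of "{u,u}"] by auto
  define path where "path k v \<longleftrightarrow>
    inj_on v {..k} \<and> v ` {..k} \<subseteq> V \<and> (\<forall>i<k. {v i, v (Suc i)} \<in> E)" for k and v :: "nat \<Rightarrow> 'a"
  have bound: "k < card V" if "path k v" for k v
  proof -
    have "card (v ` {..k}) \<le> card V" using that sg unfolding path_def by (intro card_mono) auto
    then show ?thesis using that unfolding path_def by (simp add: card_image)
  qed
  obtain x where "x \<in> V" using ne by blast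
  then have "path 0 (\<lambda>_. x)" unfolding path_def by auto
  then obtain k where k: "\<exists>v. path k v" and kmax: "\<And>l. \<exists>v. path l v \<Longrightarrow> l \<le> k"
    using Greatest_le_nat[of "\<lambda>k. \<exists>v. path k v" _ "card V"] GreatestI_nat[of "\<lambda>k. \<exists>v. path k v" 0 "card V"]
      bound by (metis less_imp_le)
  \<comment> \<open>A neighbor of \<open>v 0\<close> off the path could be put in front of it,
    against the maximality of \<open>k\<close>.\<close>
  have nbr: "\<exists>l. 1 \<le> l \<and> l \<le> k \<and> u = v l" if v: "path k v" and u: "{u, v 0} \<in> E" for u v
  proof -
    have "u \<in> v ` {..k}"
    proof (rule ccontr)
      assume n: "u \<notin> v ` {..k}"
      define w where "w i = (case i of 0 \<Rightarrow> u | Suc j \<Rightarrow> v j)" for i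
      have "path (Suc k) w" unfolding path_def
      proof (intro conjI allI impI)
        show "inj_on w {..Suc k}"
          using v n unfolding path_def inj_on_def w_def by (auto split: nat.splits)
        show "w ` {..Suc k} \<subseteq> V"
          using v u sg(2)[OF u] unfolding path_def w_def image_subset_iff by (auto split: nat.splits)
        show "{w i, w (Suc i)} \<in> E" if "i < Suc k" for i
          using v u that unfolding path_def w_def by (auto split: nat.splits)
      qed
      then show False using kmax by fastforce
    qed
    then obtain l where "l \<le> k" "u = v l" by blast
    moreover have "l \<noteq> 0" using u irr calculation by (metis)
    ultimately show ?thesis by (intro exI[of _ l]) auto
  qed
  \<comment> \<open>Minimum degree 3 leaves a neighbor of \<open>v 0\<close> outside any two
    prescribed positions. One of them will always be \<open>1\<close>, so that the edge obtained is
    a chord.\<close>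
  have third: "\<exists>l. l \<le> k \<and> 1 \<le> l \<and> l \<noteq> p \<and> l \<noteq> q \<and> {v l, v 0} \<in> E" if v: "path k v" for v p q
  proof (rule ccontr)
    assume n: "\<not> ?thesis"
    have "{u. {u, v 0} \<in> E} \<subseteq> {v p, v q}" using nbr[OF v] n by fastforce
    then have "card {u. {u, v 0} \<in> E} \<le> card {v p, v q}" by (intro card_mono) auto
    also have "\<dots> \<le> 2" by (simp add: card_insert_if)
    finally show False using deg[of "v 0"] v unfolding path_def by fastforce
  qed
  define C where "C i \<longleftrightarrow> (\<exists>v. path k v \<and> 2 \<le> i \<and> i \<le> k \<and> {v i, v 0} \<in> E)" for i
  obtain v0 where "path k v0" using k by blast
  from third[OF this, of 1 1] have "\<exists>i. C i" unfolding C_def using \<open>path k v0\<close>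
    by (metis Suc_1 Suc_leI le_neq_implies_less One_nat_def)
  then obtain i where "C i" and imin: "\<And>l. C l \<Longrightarrow> i \<le> l" using LeastI_ex Least_le by metis
  then obtain v where v: "path k v" and i: "2 \<le> i" "i \<le> k" "{v i, v 0} \<in> E" unfolding C_def by blast
  obtain j where j: "j \<le> k" "i < j" "{v j, v 0} \<in> E"
  proof -
    obtain j where j: "j \<le> k" "1 \<le> j" "j \<noteq> 1" "j \<noteq> i" "{v j, v 0} \<in> E" using third[OF v] by blast
    then have "C j" unfolding C_def using v by (intro exI[of _ v]) auto
    then show ?thesis using imin[of j] j that by auto
  qed
  \<comment> \<open>The positions below \<open>i\<close> are reversed, and the chord from
    \<open>v 0\<close> to \<open>v i\<close> reconnects them to the rest. This is again a longest
    path, now starting at \<open>v (i - 1)\<close>.\<close>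
  define w where "w t = (if t < i then v (i - 1 - t) else v t)" for t
  have inj: "inj_on v {..k}" using v unfolding path_def by auto
  have vV: "v l \<in> V" if "l \<le> k" for l using v that unfolding path_def by auto
  have edge: "{v l, v (Suc l)} \<in> E" if "l < k" for l using v that unfolding path_def by auto
  have pw: "path k w" unfolding path_def
  proof (intro conjI allI impI)
    show "inj_on w {..k}"
    proof (rule inj_onI)
      fix s t assume st: "s \<in> {..k}" "t \<in> {..k}" "w s = w t"
      define f where "f t = (if t < i then i - 1 - t else t)" for t
      have "f s \<in> {..k}" "f t \<in> {..k}" "v (f s) = v (f t)"
        using st i unfolding f_def w_def by (auto split: if_splits)
      then have "f s = f t" using inj_onD[OF inj] by auto
      then show "s = t" unfolding f_def by (auto split: if_splits)
    qed
    show "w ` {..k} \<subseteq> V" using vV i unfolding w_def by auto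
    show "{w l, w (Suc l)} \<in> E" if l: "l < k" for l
    proof -
      consider "Suc l < i" | "Suc l = i" | "i \<le> l" by linarith
      then show ?thesis
      proof cases
        case 1
        then have "{v (i - 1 - Suc l), v (Suc (i - 1 - Suc l))} \<in> E" using i by (intro edge) auto
        moreover have "Suc (i - 1 - Suc l) = i - 1 - l" using 1 by auto
        ultimately show ?thesis using 1 unfolding w_def by (simp add: insert_commute)
      next
        case 2 then show ?thesis using i unfolding w_def by (auto simp: insert_commute)
      next
        case 3 then show ?thesis using edge[OF l] unfolding w_def by auto
      qed
    qed
  qed
  obtain m where m: "m \<le> k" "i < m" "{v m, v (i - 1)} \<in> E"
  proof -
    obtain m where m: "m \<le> k" "1 \<le> m" "m \<noteq> 1" "m \<noteq> i" "{w m, w 0} \<in> E" using third[OF pw] by blast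
    then have "C m" unfolding C_def using pw by (intro exI[of _ w]) auto
    \<comment> \<open>The path \<open>w\<close> competes for the same minimum as \<open>v\<close>,
      so its chord cannot end before position \<open>i\<close>; from \<open>i\<close> on the two
      paths agree.\<close>
    then have "i < m" using imin[of m] m by auto
    then show ?thesis using that[of m] m i unfolding w_def by auto
  qed
  \<comment> \<open>The branch vertices are \<open>v 0\<close>, \<open>v (i - 1)\<close>,
    \<open>v i\<close> and \<open>v l\<close>. As \<open>l\<close> is the smaller of the two chord
    ends, at least one of the connections from \<open>v 0\<close> and from \<open>v (i - 1)\<close>
    to \<open>v l\<close> is a single edge, while the other jumps ahead and descends the path to
    \<open>v l\<close>; so they meet only there.\<close>
  define l where "l = min j m"
  have l: "i < l" "l \<le> k" "l \<le> j" "l \<le> m" "l = j \<or> l = m" using j m unfolding l_def by auto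
  let ?pab = "map v [0..<i]" and ?pac = "map v [0, i]" and ?pad = "map v (0 # rev [l..<Suc j])"
    and ?pbc = "map v [i - 1, i]" and ?pbd = "map v ((i - 1) # rev [l..<Suc m])"
    and ?pcd = "map v [i..<Suc l]"
  have wb: "walk_between V E (v s) (map v p) (v t)"
    if "p \<noteq> []" "hd p = s" "last p = t" "set p \<subseteq> {..k}"
      "\<And>n. Suc n < length p \<Longrightarrow> {v (p ! n), v (p ! Suc n)} \<in> E" for s t p
    using that vV unfolding walk_between_def walk_def
    by (auto simp: hd_map last_map successively_conv_nth)
  have dist: "distinct (map v p)" if "distinct p" "set p \<subseteq> {..k}" for p
    using that inj_on_subset[OF inj] by (auto simp: distinct_map)
  have Int: "set (map v p) \<inter> set (map v q) = v ` S" if "set p \<inter> set q = S" "set p \<subseteq> {..k}" "set q \<subseteq> {..k}" for p q S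
    using inj_on_image_Int[OF inj that(2,3)] that by simp
  have neq: "v s \<noteq> v t" if "s \<noteq> t" "s \<le> k" "t \<le> k" for s t using inj that unfolding inj_on_def by auto
  have down: "{v ((x # rev [l..<Suc y]) ! n), v ((x # rev [l..<Suc y]) ! Suc n)} \<in> E"
    if "Suc n < length (x # rev [l..<Suc y])" "{v y, v x} \<in> E" "l \<le> y" "y \<le> k" for x y n
  proof (cases n)
    case 0
    then show ?thesis using that by (simp add: rev_nth nth_append insert_commute)
  next
    case (Suc n')
    have lt: "Suc n' < Suc y - l" using that Suc by simp
    have "{v (y - Suc n'), v (Suc (y - Suc n'))} \<in> E" using lt that by (intro edge) auto
    moreover have "rev [l..<Suc y] ! n' = y - n'" "rev [l..<Suc y] ! Suc n' = y - Suc n'"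
      using lt by (subst rev_nth; simp del: upt_Suc)+
    moreover have "Suc (y - Suc n') = y - n'" using lt by auto
    ultimately show ?thesis using Suc by (simp add: insert_commute del: upt_Suc)
  qed
  show False
  proof (rule outerplanar_no_K4_subdivision[OF op])
    show "walk_between V E (v 0) ?pab (v (i - 1))" using i by (intro wb) (auto intro!: edge)
    show "walk_between V E (v 0) ?pac (v i)"
      using i by (intro wb) (auto simp: insert_commute less_Suc_eq)
    show "walk_between V E (v 0) ?pad (v l)"
      using l j i by (intro wb down) (auto simp: last_rev hd_conv_nth simp del: upt_Suc)
    show "walk_between V E (v (i - 1)) ?pbc (v i)"
      using i edge[of "i - 1"] by (intro wb) (auto simp: less_Suc_eq)
    show "walk_between V E (v (i - 1)) ?pbd (v l)"
      using l m i by (intro wb down) (auto simp: last_rev hd_conv_nth simp del: upt_Suc)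
    show "walk_between V E (v i) ?pcd (v l)"
      using l i by (intro wb) (auto intro!: edge simp del: upt_Suc)
    show "distinct ?pab" "distinct ?pac" "distinct ?pad" "distinct ?pbc" "distinct ?pbd" "distinct ?pcd"
      using i l j m by (intro dist; auto)+
    show "v 0 \<noteq> v (i - 1)" "v 0 \<noteq> v i" "v 0 \<noteq> v l" "v (i - 1) \<noteq> v i" "v (i - 1) \<noteq> v l" "v i \<noteq> v l"
      using i l by (intro neq; auto)+
    show "set ?pab \<inter> set ?pac = {v 0}" by (subst Int[where S="{0}"]) (use i in auto)
    show "set ?pab \<inter> set ?pad = {v 0}" by (subst Int[where S="{0}"]) (use i j l in auto)
    show "set ?pac \<inter> set ?pad = {v 0}" by (subst Int[where S="{0}"]) (use i j l in auto)
    show "set ?pab \<inter> set ?pbc = {v (i - 1)}" by (subst Int[where S="{i - 1}"]) (use i in auto)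
    show "set ?pab \<inter> set ?pbd = {v (i - 1)}" by (subst Int[where S="{i - 1}"]) (use i m l in auto)
    show "set ?pbc \<inter> set ?pbd = {v (i - 1)}" by (subst Int[where S="{i - 1}"]) (use i m l in auto)
    show "set ?pac \<inter> set ?pbc = {v i}" by (subst Int[where S="{i}"]) (use i in auto)
    show "set ?pac \<inter> set ?pcd = {v i}" by (subst Int[where S="{i}"]) (use i l in auto)
    show "set ?pbc \<inter> set ?pcd = {v i}" by (subst Int[where S="{i}"]) (use i l in auto)
    show "set ?pad \<inter> set ?pbd = {v l}" by (subst Int[where S="{l}"]) (use i l j m in auto)
    show "set ?pad \<inter> set ?pcd = {v l}" by (subst Int[where S="{l}"]) (use i l j in auto)
    show "set ?pbd \<inter> set ?pcd = {v l}" by (subst Int[where S="{l}"]) (use i l m in auto)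
    show "set ?pab \<inter> set ?pcd = {}" by (subst Int[where S="{}"]) (use i l in auto)
    show "set ?pac \<inter> set ?pbd = {}" by (subst Int[where S="{}"]) (use i l m in auto)
    show "set ?pad \<inter> set ?pbc = {}" by (subst Int[where S="{}"]) (use i l j in auto)
  qed
qed

text \<open>Shrinking a drawing enlarges its outside, and a point of the drawing is never interior
  to the outside; so only membership in the closure has to be checked.\<close>

lemma frontier_outside_subset:
  assumes "D' \<subseteq> D" "x \<in> D'" "x \<in> frontier (outside D)"
  shows "x \<in> frontier (outside D')"
proof -
  have "x \<in> closure (outside D')"
    using assms closure_mono[OF outside_mono[OF assms(1)]] unfolding frontier_def by blast
  moreover have "x \<notin> interior (outside D')"
    using assms(2) interior_subset[of "outside D'"] outside_no_overlap[of D'] by blast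
  ultimately show ?thesis unfolding frontier_def by blast
qed

lemma outerplanar_delete_vertex:
  assumes "outerplanar V E"
  shows "outerplanar (V - {v}) {e \<in> E. v \<notin> e}"
proof -
  obtain pos \<gamma> where pe: "planar_embedding V E pos \<gamma>" and sg: "simple_graph V E"
    and fr: "\<And>v. v \<in> V \<Longrightarrow> pos v \<in> frontier (outside (drawing V E pos \<gamma>))"
    using assms unfolding outerplanar_def by blast
  have inj: "inj_on pos V" using pe unfolding planar_embedding_def by blast
  let ?V = "V - {v}" and ?E = "{e \<in> E. v \<notin> e}"
  have sg': "simple_graph ?V ?E" using sg unfolding simple_graph_def by auto
  have "path_image (\<gamma> e) \<inter> pos ` ?V = pos ` e" if e: "e \<in> ?E" for e
  proof -
    have "path_image (\<gamma> e) \<inter> pos ` V = pos ` e" "e \<subseteq> ?V"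
      using pe e sg' unfolding planar_embedding_def simple_graph_def by auto
    then show ?thesis by blast
  qed
  then have pe': "planar_embedding ?V ?E pos \<gamma>"
    using pe inj_on_subset[OF inj, of ?V] unfolding planar_embedding_def by simp
  have "pos u \<in> frontier (outside (drawing ?V ?E pos \<gamma>))" if "u \<in> ?V" for u
    by (rule frontier_outside_subset[OF _ _ fr]) (use that in \<open>auto simp: drawing_def\<close>)
  then show ?thesis using sg' pe' unfolding outerplanar_def by blast
qed

text \<open>The new edge is drawn along the two old arcs at \<open>v\<close>, so the drawing does
  not grow and the outer face does not shrink. If \<open>{a, b}\<close> is already an edge, deleting
  \<open>v\<close> is enough.\<close>

lemma outerplanar_suppress_vertex:
  assumes op: "outerplanar V E" and av: "{a, v} \<in> E" and bv: "{b, v} \<in> E" and ab: "a \<noteq> b"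
  shows "outerplanar (V - {v}) (insert {a, b} {e \<in> E. v \<notin> e})"
proof (cases "{a, b} \<in> E")
  case True
  have "a \<noteq> v" "b \<noteq> v"
    using op av bv unfolding outerplanar_def simple_graph_def by fastforce+
  then have "insert {a, b} {e \<in> E. v \<notin> e} = {e \<in> E. v \<notin> e}" using True by auto
  then show ?thesis using outerplanar_delete_vertex[OF op] by simp
next
  case False
  obtain pos \<gamma> where pe: "planar_embedding V E pos \<gamma>" and sg: "simple_graph V E"
    and fr: "\<And>v. v \<in> V \<Longrightarrow> pos v \<in> frontier (outside (drawing V E pos \<gamma>))"
    using op unfolding outerplanar_def by blast
  have inj: "inj_on pos V" using pe unfolding planar_embedding_def by blast
  have V: "a \<in> V" "b \<in> V" "v \<in> V" "a \<noteq> v" "b \<noteq> v"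
    using sg av bv unfolding simple_graph_def by fastforce+
  let ?V = "V - {v}" and ?F = "{e \<in> E. v \<notin> e}"
  let ?E = "insert {a, b} ?F"
  have w: "walk V E [a, v, b]" "distinct [a, v, b]"
    using V av bv ab by (auto simp: walk_def insert_commute)
  have arc: "arc_set (path_image (\<gamma> {a,v}) \<union> path_image (\<gamma> {b,v})) (pos a) (pos b)"
    using walk_arc_set[OF pe sg w] by (simp add: walk_image_def insert_commute Un_commute)
  then obtain g where g: "arc g" "pathstart g = pos a" "pathfinish g = pos b"
    "path_image g = path_image (\<gamma> {a,v}) \<union> path_image (\<gamma> {b,v})" unfolding arc_set_def by blast
  define \<delta> where "\<delta> = \<gamma>({a,b} := g)"
  have \<delta>: "\<delta> {a,b} = g" "\<And>e. e \<in> ?F \<Longrightarrow> \<delta> e = \<gamma> e" using False unfolding \<delta>_def by auto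
  have sg': "simple_graph ?V ?E" using sg V ab unfolding simple_graph_def by auto
  have img: "path_image (\<gamma> e) \<inter> pos ` V = pos ` e" if "e \<in> E" for e
    using pe that unfolding planar_embedding_def by blast
  have crs: "path_image (\<gamma> e) \<inter> path_image (\<gamma> f) = pos ` (e \<inter> f)" if "e \<in> E" "f \<in> E" "e \<noteq> f" for e f
    using pe that unfolding planar_embedding_def by blast
  have pV: "pos ` ?V = pos ` V - {pos v}" using V inj unfolding inj_on_def by auto
  have pv: "pos a \<noteq> pos v" "pos b \<noteq> pos v" using V inj unfolding inj_on_def by auto
  have gV: "path_image g \<inter> pos ` ?V = pos ` {a,b}"
    using img[OF av] img[OF bv] g(4) pv unfolding pV by auto
  have gf: "path_image g \<inter> path_image (\<gamma> f) = pos ` ({a,b} \<inter> f)" if "f \<in> ?F" for f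
  proof -
    have "f \<noteq> {a,v}" "f \<noteq> {b,v}" using that by auto
    then show ?thesis using crs[OF av, of f] crs[OF bv, of f] that g(4) by auto
  qed
  have pe': "planar_embedding ?V ?E pos \<delta>" unfolding planar_embedding_def
  proof (intro conjI ballI impI)
    show "inj_on pos ?V" using inj by (rule inj_on_subset) auto
    fix e assume e: "e \<in> ?E"
    show "arc (\<delta> e)" using e g \<delta> pe unfolding planar_embedding_def by auto
    show "{pathstart (\<delta> e), pathfinish (\<delta> e)} = pos ` e"
    proof (cases "e = {a,b}")
      case True then show ?thesis using g \<delta> by simp
    next
      case False
      then have "e \<in> ?F" using e by blast
      then show ?thesis using \<delta>(2) pe unfolding planar_embedding_def by simp
    qed
    show "path_image (\<delta> e) \<inter> pos ` ?V = pos ` e"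
    proof (cases "e = {a,b}")
      case True then show ?thesis using gV \<delta> by simp
    next
      case False
      then have F: "e \<in> ?F" "e \<in> E" "e \<subseteq> ?V" using e sg' unfolding simple_graph_def by auto
      then show ?thesis using \<delta>(2)[OF F(1)] img[OF F(2)] by auto
    qed
    fix f assume f: "f \<in> ?E" and ef: "e \<noteq> f"
    show "path_image (\<delta> e) \<inter> path_image (\<delta> f) = pos ` (e \<inter> f)"
    proof (cases "e = {a,b}")
      case True
      then have "f \<in> ?F" using f ef by blast
      then show ?thesis using \<delta> gf True by simp
    next
      case eF: False
      then have e': "e \<in> ?F" using e by blast
      show ?thesis
      proof (cases "f = {a,b}")
        case True
        then show ?thesis using \<delta>(1) \<delta>(2)[OF e'] gf[OF e'] by (simp add: Int_commute)
      next
        case False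
        then have f': "f \<in> ?F" using f by blast
        then show ?thesis using \<delta>(2)[OF e'] \<delta>(2)[OF f'] crs[of e f] e' ef by simp
      qed
    qed
  qed
  have sub: "drawing ?V ?E pos \<delta> \<subseteq> drawing V E pos \<gamma>"
    using g(4) av bv \<delta> unfolding drawing_def by auto
  have "pos u \<in> frontier (outside (drawing ?V ?E pos \<delta>))" if "u \<in> ?V" for u
    by (rule frontier_outside_subset[OF sub _ fr]) (use that in \<open>auto simp: drawing_def\<close>)
  then show ?thesis using sg' pe' unfolding outerplanar_def by blast
qed

section \<open>Star colorings and roles\<close>

lemma walk_snoc:
  assumes "walk_between V E u p v" "{v, w} \<in> E" "w \<in> V"
  shows "walk_between V E u (p @ [w]) w"
  using assms unfolding walk_between_def walk_def by (simp add: successively_append_iff)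

lemma component_step:
  assumes "C \<in> graph_components V E" "v \<in> C" "{v, w} \<in> E" "w \<in> V"
  shows "w \<in> C"
proof -
  obtain u where C: "C = {v \<in> V. \<exists>p. walk_between V E u p v}"
    using assms(1) unfolding graph_components_def by blast
  then obtain p where "walk_between V E u p v" using assms(2) by blast
  from walk_snoc[OF this assms(3,4)] show ?thesis using C assms(4) by blast
qed

definition same_color_nbrs :: "'a set set \<Rightarrow> ('a \<Rightarrow> nat) \<Rightarrow> 'a \<Rightarrow> 'a set" where
  "same_color_nbrs E c v = {u. {u, v} \<in> E \<and> c u = c v}"

text \<open>\<open>r v\<close> says that \<open>v\<close> is the center, not a leaf, of its monochromatic star.\<close>

definition star_roles :: "'a set \<Rightarrow> 'a set set \<Rightarrow> ('a \<Rightarrow> nat) \<Rightarrow> ('a \<Rightarrow> bool) \<Rightarrow> bool" where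
  "star_roles V E c r \<longleftrightarrow>
     (\<forall>u v. {u, v} \<in> E \<and> c u = c v \<longrightarrow> r u \<noteq> r v) \<and>
     (\<forall>v\<in>V. \<not> r v \<longrightarrow> card (same_color_nbrs E c v) \<le> 1)"

text \<open>A vertex with at least two neighbors of its own color is the center of its star. A star
  that is a single edge has no distinguished end; there the linear order selects the smaller
  one.\<close>

lemma star_coloring_roles:
  fixes V :: "'a :: linorder set"
  assumes sg: "simple_graph V E" and sc: "star_coloring \<kappa> V E c"
  shows "\<exists>r. star_roles V E c r"
proof -
  have finV: "finite V" and EV: "\<And>u v. {u, v} \<in> E \<Longrightarrow> u \<in> V \<and> v \<in> V \<and> u \<noteq> v"
    using sg unfolding simple_graph_def by fastforce+
  define S where "S i = {v \<in> V. c v = i}" for i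
  define C where "C x = {v \<in> S (c x). \<exists>p. walk_between (S (c x)) (induced_edges E (S (c x))) x p v}" for x
  have lt: "c x < \<kappa>" if "x \<in> V" for x using sc that unfolding star_coloring_def by blast
  have CC: "C x \<in> graph_components (S (c x)) (induced_edges E (S (c x)))" if "x \<in> V" for x
    using that unfolding graph_components_def C_def S_def by auto
  then have ac: "acyclic_graph (C x) (induced_edges E (C x))"
    and di: "graph_diameter (C x) (induced_edges E (C x)) \<le> 2" if "x \<in> V" for x
    using sc lt[OF that] that unfolding star_coloring_def S_def Let_def by blast+
  have Cx: "x \<in> C x" if "x \<in> V" for x
    using that unfolding C_def S_def walk_between_def walk_def by (auto intro!: exI[of _ "[x]"])
  have step: "w \<in> C x" if "v \<in> C x" "{v, w} \<in> E" "c w = c v" "x \<in> V" for v w x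
  proof (rule component_step[OF CC[OF that(4)] that(1)])
    have "c v = c x" using that(1) unfolding C_def S_def by blast
    then show "{v, w} \<in> induced_edges E (S (c x))" "w \<in> S (c x)"
      using that EV unfolding induced_edges_def S_def by auto
  qed
  have iE: "{u, v} \<in> induced_edges E (C x)" if "u \<in> C x" "v \<in> C x" "{u, v} \<in> E" for u v x
    using that unfolding induced_edges_def by auto
  have no_cycle: False if "p \<noteq> []" "x \<in> V" "set p \<subseteq> C x" "distinct p" "length p \<ge> 3" "{last p, hd p} \<in> E"
    "successively (\<lambda>u v. {u, v} \<in> E) p" for p x
  proof -
    have "successively (\<lambda>u v. {u, v} \<in> induced_edges E (C x)) p"
      using that(3,7) iE by (induction p rule: induct_list012) auto
    moreover have "{last p, hd p} \<in> induced_edges E (C x)" using that by (intro iE) auto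
    ultimately have "graph_cycle (C x) (induced_edges E (C x)) p"
      using that unfolding graph_cycle_def walk_def by simp
    then show False using ac[OF that(2)] unfolding acyclic_graph_def by blast
  qed
  have no_triangle: False if "{u, v} \<in> E" "{v, w} \<in> E" "{w, u} \<in> E" "c u = c v" "c v = c w" for u v w
  proof (rule no_cycle[of "[u, v, w]" u])
    have "u \<in> C u" "v \<in> C u" "w \<in> C u" using that EV Cx step[of u u v] step[of v u w] by metis+
    then show "set [u, v, w] \<subseteq> C u" by simp
  qed (use that EV in \<open>auto simp: insert_commute\<close>)
  \<comment> \<open>The ends of a monochromatic path with three edges are at distance at most 2 by
    the diameter bound, and the short connection closes a cycle of length 3, 4 or 5.\<close>
  have no_path: False if e: "{a, b} \<in> E" "{b, d} \<in> E" "{d, f} \<in> E" and ne: "a \<noteq> d" "b \<noteq> f"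
    and cc: "c a = c b" "c b = c d" "c d = c f" for a b d f
  proof -
    have V: "a \<in> V" using EV e by blast
    have m: "a \<in> C a" "b \<in> C a" "d \<in> C a" "f \<in> C a"
      using Cx[OF V] step[of a a b] step[of b a d] step[of d a f] e cc V by auto
    have af: "a \<noteq> f" using no_triangle[of a b d] e cc by auto
    let ?F = "induced_edges E (C a)"
    let ?P = "\<lambda>l. \<exists>p. walk_between (C a) ?F a p f \<and> length p = Suc l"
    have "walk_between (C a) ?F a [a, b, d, f] f"
      using m e iE unfolding walk_between_def walk_def by auto
    then have "?P 3" by (intro exI[of _ "[a, b, d, f]"]) simp
    then have P: "?P (graph_dist (C a) ?F a f)" unfolding graph_dist_def by (rule LeastI)
    have "finite (C a)" using finV unfolding C_def S_def by auto
    then have "graph_dist (C a) ?F a f \<le> graph_diameter (C a) ?F"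
      unfolding graph_diameter_def using m by (intro Max_ge) auto
    then have "graph_dist (C a) ?F a f \<le> 2" using di[OF V] by simp
    with P obtain p where p: "walk_between (C a) ?F a p f" "length p \<le> 3" by auto
    have FE: "?F \<subseteq> E" unfolding induced_edges_def by blast
    have cC: "c y = c a" if "y \<in> C a" for y using that unfolding C_def S_def by blast
    have "p \<noteq> []" using p unfolding walk_between_def walk_def by blast
    then consider y where "p = [y]" | y z where "p = [y, z]" | y x z where "p = [y, x, z]"
      using p(2) by (cases p rule: remdups_adj.cases; cases "tl (tl p)") auto
    then show False
    proof cases
      case 1 then show False using p af unfolding walk_between_def by auto
    next
      case 2
      then have "{f, a} \<in> E" using p FE unfolding walk_between_def walk_def by (auto simp: insert_commute)
      then show False
        by (intro no_cycle[of "[a, b, d, f]" a]) (use e EV ne af m V in auto)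
    next
      case (3 y x z)
      then have x: "{a, x} \<in> E" "{x, f} \<in> E" "x \<in> C a"
        using p FE unfolding walk_between_def walk_def by auto
      consider "x = b" | "x = d" | "x \<noteq> b" "x \<noteq> d" by blast
      then show False
      proof cases
        case 1 then show False using no_triangle[of b d f] x e cc by (auto simp: insert_commute)
      next
        case 2 then show False using no_triangle[of a b d] x e cc by (auto simp: insert_commute)
      next
        case 3
        then show False
          by (intro no_cycle[of "[a, b, d, f, x]" a]) (use e EV ne af m V x in \<open>auto simp: insert_commute\<close>)
      qed
    qed
  qed
  let ?N = "same_color_nbrs E c"
  have finN: "finite (?N v)" for v
    using finV EV unfolding same_color_nbrs_def by (rule_tac finite_subset[of _ V]) auto
  have Nsym: "u \<in> ?N v \<longleftrightarrow> v \<in> ?N u" for u v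
    unfolding same_color_nbrs_def by (auto simp: insert_commute)
  define r where "r v \<longleftrightarrow> card (?N v) \<ge> 2 \<or> (\<exists>u. ?N v = {u} \<and> ?N u = {v} \<and> v < u)" for v
  have "r u \<noteq> r v" if uv: "{u, v} \<in> E" "c u = c v" for u v
  proof -
    have mem: "u \<in> ?N v" "v \<in> ?N u" using uv unfolding same_color_nbrs_def by (auto simp: insert_commute)
    have other: "\<exists>x. x \<in> ?N y \<and> x \<noteq> z" if "card (?N y) \<ge> 2" for y z
    proof (rule ccontr)
      assume "\<not> ?thesis"
      then have "?N y \<subseteq> {z}" by blast
      then have "card (?N y) \<le> 1" using card_mono[of "{z}" "?N y"] by simp
      then show False using that by simp
    qed
    \<comment> \<open>If both ends had a further neighbor of the same color, these two neighbors
      would extend the edge to the path excluded by \<open>no_path\<close>.\<close>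
    have not2: "\<not> (card (?N u) \<ge> 2 \<and> card (?N v) \<ge> 2)"
    proof
      assume "card (?N u) \<ge> 2 \<and> card (?N v) \<ge> 2"
      then obtain x y where xy: "x \<in> ?N u" "x \<noteq> v" "y \<in> ?N v" "y \<noteq> u" using other by metis
      then have "{x, u} \<in> E" "c x = c u" "{y, v} \<in> E" "c y = c v"
        unfolding same_color_nbrs_def by auto
      moreover have "{v, y} \<in> E" using calculation by (simp add: insert_commute)
      ultimately show False using xy uv by (intro no_path[of x u v y]) auto
    qed
    have single: "?N y = {z}" if "z \<in> ?N y" "\<not> card (?N y) \<ge> 2" for y z
    proof -
      have "card (?N y) = 1" using that finN[of y] card_0_eq[OF finN[of y]]
        by (metis One_nat_def Suc_1 Suc_leI empty_iff less_one linorder_neqE_nat not_less)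
      then show ?thesis using that(1) by (metis card_1_singletonE singletonD)
    qed
    consider "card (?N u) \<ge> 2" "?N v = {u}" | "card (?N v) \<ge> 2" "?N u = {v}"
      | "?N u = {v}" "?N v = {u}" "\<not> card (?N u) \<ge> 2" "\<not> card (?N v) \<ge> 2"
      using not2 single mem by blast
    then show ?thesis
    proof cases
      case 1 then show ?thesis unfolding r_def by auto
    next
      case 2 then show ?thesis unfolding r_def by auto
    next
      case 3
      then show ?thesis using EV[OF uv(1)] unfolding r_def by (auto simp: neq_iff)
    qed
  qed
  then have "star_roles V E c r" unfolding star_roles_def r_def by auto
  then show ?thesis by blast
qed

text \<open>\<open>hub\<close> sends a vertex to the center of its star. It is constant along
  monochromatic edges, hence on components, and vertices with the same hub are at distance at most
  2. A vertex on a monochromatic cycle has two neighbors of its color and so must be a center, but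
  adjacent vertices of one color cannot both be centers.\<close>

lemma roles_star_coloring:
  assumes sg: "simple_graph V E" and ck: "\<And>v. v \<in> V \<Longrightarrow> c v < \<kappa>" and r: "star_roles V E c r"
  shows "star_coloring \<kappa> V E c"
proof -
  have finV: "finite V" and EV: "\<And>u v. {u, v} \<in> E \<Longrightarrow> u \<in> V \<and> v \<in> V \<and> u \<noteq> v"
    using sg unfolding simple_graph_def by fastforce+
  let ?N = "same_color_nbrs E c"
  have finN: "finite (?N v)" for v
    using finV EV unfolding same_color_nbrs_def by (rule_tac finite_subset[of _ V]) auto
  have opp: "r u \<noteq> r v" if "{u, v} \<in> E" "c u = c v" for u v using r that unfolding star_roles_def by blast
  have leaf: "u = w" if "{u, v} \<in> E" "c u = c v" "{w, v} \<in> E" "c w = c v" "\<not> r v" for u v w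
  proof -
    have "u \<in> ?N v" "w \<in> ?N v" using that unfolding same_color_nbrs_def by auto
    moreover have "card (?N v) \<le> 1" using r EV[OF that(1)] that(5) unfolding star_roles_def by auto
    ultimately show ?thesis using card_le_Suc0_iff_eq[OF finN[of v]] by auto
  qed
  define hub where "hub v = (if r v \<or> ?N v = {} then v else (SOME u. u \<in> ?N v))" for v
  have hub_cases: "hub v = v \<or> ({hub v, v} \<in> E \<and> c (hub v) = c v)" for v
  proof (cases "r v \<or> ?N v = {}")
    case False
    then have "(SOME u. u \<in> ?N v) \<in> ?N v" by (simp add: some_in_eq)
    then show ?thesis using False unfolding hub_def same_color_nbrs_def by auto
  qed (auto simp: hub_def)
  have hub_leaf: "hub v = u" if "{u, v} \<in> E" "c u = c v" "\<not> r v" for u v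
  proof -
    have "u \<in> ?N v" using that unfolding same_color_nbrs_def by auto
    then have "?N v = {u}" using leaf that unfolding same_color_nbrs_def by blast
    then show ?thesis using that unfolding hub_def by simp
  qed
  have hub_edge: "hub u = hub v" if "{u, v} \<in> E" "c u = c v" for u v
    using opp[OF that] hub_leaf[of u v] hub_leaf[of v u] that
    by (cases "r u") (auto simp: insert_commute hub_def)
  show ?thesis unfolding star_coloring_def Let_def
  proof (intro conjI ballI allI impI)
    fix v assume "v \<in> V" then show "c v < \<kappa>" using ck by blast
  next
    fix i C
    let ?S = "{v \<in> V. c v = i}"
    let ?F = "induced_edges E ?S"
    assume "C \<in> graph_components ?S ?F"
    then obtain x where x: "x \<in> ?S" and C: "C = {v \<in> ?S. \<exists>p. walk_between ?S ?F x p v}"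
      unfolding graph_components_def by auto
    have CS: "v \<in> V" "c v = i" if "v \<in> C" for v using that C by auto
    have hub_walk: "hub (hd p) = hub (last p)" if "walk ?S ?F p" for p
      using that
    proof (induction p rule: induct_list012)
      case (3 u v p)
      have "walk ?S ?F (v # p)" using 3 by (auto simp: walk_def)
      then have IH: "hub v = hub (last (v # p))" using 3 by auto
      have "{u, v} \<in> E" "c u = c v" using 3 by (auto simp: walk_def induced_edges_def)
      then show ?case using IH hub_edge by simp
    qed (auto simp: walk_def)
    have hubC: "hub y = hub x" if "y \<in> C" for y
      using that hub_walk C unfolding walk_between_def by force
    have stepC: "w \<in> C" if "v \<in> C" "{v, w} \<in> E" "c w = c v" for v w
    proof (rule component_step[OF \<open>C \<in> graph_components ?S ?F\<close> that(1)])
      show "{v, w} \<in> ?F" "w \<in> ?S" using that CS EV unfolding induced_edges_def by auto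
    qed
    have hubmem: "hub y \<in> C" if "y \<in> C" for y
      using hub_cases[of y] stepC[OF that, of "hub y"] that by (auto simp: insert_commute)
    let ?G = "induced_edges E C"
    show "acyclic_graph C ?G" unfolding acyclic_graph_def
    proof
      assume "\<exists>p. graph_cycle C ?G p"
      then obtain p where p: "walk C ?G p" "distinct p" "length p \<ge> 3" "{last p, hd p} \<in> ?G"
        unfolding graph_cycle_def by blast
      have nth: "{p ! i, p ! Suc i} \<in> ?G" if "Suc i < length p" for i
        using p(1) that unfolding walk_def by (simp add: successively_conv_nth)
      have G: "{u, v} \<in> E \<and> c u = c v" if "{u, v} \<in> ?G" for u v
        using that CS unfolding induced_edges_def by auto
      have e: "{p ! 0, p ! 1} \<in> ?G" "{p ! 1, p ! 2} \<in> ?G" "{last p, p ! 0} \<in> ?G"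
        using nth[of 0] nth[of 1] p by (auto simp: hd_conv_nth walk_def numeral_2_eq_2)
      have ne: "p ! 0 \<noteq> p ! 2" "last p \<noteq> p ! 1"
        using p by (auto simp: nth_eq_iff_index_eq last_conv_nth walk_def)
      have "r (p ! 1)" using leaf[of "p ! 0" "p ! 1" "p ! 2"] G[OF e(1)] G[OF e(2)] ne
        by (auto simp: insert_commute)
      moreover have "r (p ! 0)" using leaf[of "last p" "p ! 0" "p ! 1"] G[OF e(1)] G[OF e(3)] ne
        by (auto simp: insert_commute)
      ultimately show False using opp G[OF e(1)] by blast
    qed
    have dist: "graph_dist C ?G y z \<le> 2" if y: "y \<in> C" and z: "z \<in> C" for y z
    proof -
      have G: "{u, v} \<in> ?G" if "u \<in> C" "v \<in> C" "{u, v} \<in> E" for u v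
        using that unfolding induced_edges_def by auto
      have h: "hub z = hub y" using hubC y z by simp
      have "\<exists>l\<le>2. \<exists>p. walk_between C ?G y p z \<and> length p = Suc l"
      proof -
        consider "y = z" | "y \<noteq> z" "{y, z} \<in> E" | "{hub y, y} \<in> E" "{hub y, z} \<in> E"
          using hub_cases[of y] hub_cases[of z] h by (metis insert_commute)
        then show ?thesis
        proof cases
          case 1
          then show ?thesis using y
            by (intro exI[of _ 0]) (auto intro!: exI[of _ "[y]"] simp: walk_between_def walk_def)
        next
          case 2
          then show ?thesis using y z G
            by (intro exI[of _ 1]) (auto intro!: exI[of _ "[y, z]"] simp: walk_between_def walk_def)
        next
          case 3
          then show ?thesis using y z G hubmem[OF y]
            by (intro exI[of _ 2])
              (auto intro!: exI[of _ "[y, hub y, z]"] simp: walk_between_def walk_def insert_commute)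
        qed
      qed
      then obtain l where l: "l \<le> 2" "\<exists>p. walk_between C ?G y p z \<and> length p = Suc l" by blast
      have "graph_dist C ?G y z \<le> l" unfolding graph_dist_def by (rule Least_le) (rule l(2))
      then show ?thesis using l(1) by simp
    qed
    have "finite C" using finV C by auto
    moreover have "x \<in> C" using x C by (auto simp: walk_between_def walk_def intro!: exI[of _ "[x]"])
    ultimately show "graph_diameter C ?G \<le> 2"
      unfolding graph_diameter_def using dist by (subst Max_le_iff) auto
  qed
qed

section \<open>Tables of links\<close>

type_synonym vstate = "bool \<times> bool"
type_synonym tuple = "(vstate \<times> bool) \<times> (vstate \<times> bool)"

text \<open>
  A vertex state is a pair of color and role (center or leaf).  A tuple of a link \<open>{x, y}\<close> holds
  for both ends the state of the end and whether the link accounts for the one monochromatic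
  edge that a leaf may have.
\<close>

definition state0 :: vstate where "state0 = (False, False)"

definition trivial_table :: "tuple set" where
  "trivial_table = {((q, False), (q', False)) | q q'. True}"

text \<open>Charging exactly the leaf end makes the number of charges at a leaf equal to the number
  of its monochromatic edges, while a center is never charged.\<close>

definition edge_table :: "tuple set" where
  "edge_table = {((q, u), (q', u')) | q u q' u'.
     if fst q = fst q' then snd q \<noteq> snd q' \<and> u = (\<not> snd q) \<and> u' = (\<not> snd q') else \<not> u \<and> \<not> u'}"

text \<open>
  Kind \<open>0\<close>: the links \<open>(v, n)\<close>, \<open>(v, x)\<close>, \<open>(v, y)\<close> become \<open>(x, y)\<close> when \<open>v\<close> is eliminated;
  other kinds: two parallel links \<open>(v, y)\<close> are merged, and the first table is ignored.
\<close>

definition decomposes ::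
  "nat \<Rightarrow> tuple set \<Rightarrow> tuple set \<Rightarrow> tuple set \<Rightarrow> tuple \<Rightarrow> tuple \<times> tuple \<times> tuple \<Rightarrow> bool" where
  "decomposes k T0 T1 T2 t = (\<lambda>(a0, a1, a2).
     a1 \<in> T1 \<and> a2 \<in> T2 \<and>
     (if k = 0 then
        a0 \<in> T0 \<and> fst (fst a0) = fst (fst a1) \<and> fst (fst a2) = fst (fst a1) \<and>
        of_bool (snd (fst a0)) + of_bool (snd (fst a1)) + of_bool (snd (fst a2)) \<le> (1 :: nat) \<and>
        snd a0 = (state0, False) \<and> t = (snd a1, snd a2)
      else
        fst (fst a1) = fst (fst t) \<and> fst (fst a2) = fst (fst t) \<and>
        fst (snd a1) = fst (snd t) \<and> fst (snd a2) = fst (snd t) \<and>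
        of_bool (snd (fst a1)) + of_bool (snd (fst a2)) = (of_bool (snd (fst t)) :: nat) \<and>
        of_bool (snd (snd a1)) + of_bool (snd (snd a2)) = (of_bool (snd (snd t)) :: nat)))"

definition combine :: "nat \<Rightarrow> tuple set \<Rightarrow> tuple set \<Rightarrow> tuple set \<Rightarrow> tuple set" where
  "combine k T0 T1 T2 = {t. \<exists>a. decomposes k T0 T1 T2 t a}"

lemma combineI: "decomposes k T0 T1 T2 t a \<Longrightarrow> t \<in> combine k T0 T1 T2"
  unfolding combine_def by blast

record log =
  ex :: "nat \<Rightarrow> nat"
  ey :: "nat \<Rightarrow> nat"
  etab :: "nat \<Rightarrow> tuple set"
  kind :: "nat \<Rightarrow> nat"
  vtx :: "nat \<Rightarrow> nat"
  ch0 :: "nat \<Rightarrow> nat"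
  ch1 :: "nat \<Rightarrow> nat"
  ch2 :: "nat \<Rightarrow> nat"

text \<open>Tuples are stored in the order \<open>ex\<close>, \<open>ey\<close>, whereas an
  operation at \<open>v\<close> wants the end \<open>v\<close> first.\<close>

definition turn :: "'a log_scheme \<Rightarrow> nat \<Rightarrow> nat \<Rightarrow> tuple \<Rightarrow> tuple" where
  "turn L v e t = (if ex L e = v then t else prod.swap t)"

definition table_from :: "'a log_scheme \<Rightarrow> nat \<Rightarrow> nat \<Rightarrow> tuple set" where
  "table_from L v e = (if ex L e = v then etab L e else (etab L e)\<inverse>)"

definition load :: "'a log_scheme \<Rightarrow> (nat \<Rightarrow> tuple) \<Rightarrow> nat \<Rightarrow> nat \<Rightarrow> nat" where
  "load L A v e = of_bool (ex L e = v \<and> snd (fst (A e))) + of_bool (ey L e = v \<and> snd (snd (A e)))"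

text \<open>The bound on the loads is the capacity of a vertex: one monochromatic edge for a leaf,
  nothing for the dummy \<open>n\<close>. Centers need no clause of their own because
  \<open>edge_table\<close> never charges them.\<close>

definition solution ::
  "nat \<Rightarrow> 'a log_scheme \<Rightarrow> nat set \<Rightarrow> (nat \<Rightarrow> vstate) \<Rightarrow> (nat \<Rightarrow> tuple) \<Rightarrow> bool" where
  "solution n L R q A \<longleftrightarrow> q n = state0 \<and>
     (\<forall>e\<in>R. A e \<in> etab L e \<and> fst (fst (A e)) = q (ex L e) \<and> fst (snd (A e)) = q (ey L e)) \<and>
     (\<forall>v. (\<Sum>e\<in>R. load L A v e) \<le> of_bool (v \<noteq> n))"

lemma turn_turn [simp]: "turn L v e (turn L v e t) = t"
  by (simp add: turn_def)

lemma turn_in_table_from: "turn L v e t \<in> table_from L v e \<longleftrightarrow> t \<in> etab L e"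
  by (cases t) (simp add: turn_def table_from_def)

lemma turn_in_table: "turn L v e t \<in> etab L e \<longleftrightarrow> t \<in> table_from L v e"
  by (cases t) (simp add: turn_def table_from_def)

lemma turn_ends:
  assumes "{ex L e, ey L e} = {v, p}" "v \<noteq> p"
  shows "fst (fst t) = q (ex L e) \<and> fst (snd t) = q (ey L e) \<longleftrightarrow>
    fst (fst (turn L v e t)) = q v \<and> fst (snd (turn L v e t)) = q p"
  using assms by (cases t) (auto simp: turn_def doubleton_eq_iff)

lemma turn_load:
  assumes "{ex L e, ey L e} = {v, p}" "v \<noteq> p" "A e = turn L v e t"
  shows "load L A w e = of_bool (w = v \<and> snd (fst t)) + of_bool (w = p \<and> snd (snd t))"
  using assms by (cases t) (auto simp: turn_def load_def doubleton_eq_iff)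

lemma sum_remove_or_zero:
  fixes f :: "nat \<Rightarrow> nat"
  assumes "finite R" "0 \<notin> R" "c = 0 \<or> c \<in> R"
  shows "sum f R = (if c = 0 then 0 else f c) + sum f (R - {c})"
  using assms sum.remove[of R c f] by (cases "c = 0") auto

text \<open>Missing children are all \<open>0\<close>, which lies outside \<open>R\<close>; they
  contribute nothing and are the only children allowed to coincide.\<close>

lemma sum_remove_three:
  fixes f :: "nat \<Rightarrow> nat"
  assumes "finite R" "0 \<notin> R" "\<forall>c\<in>{c0, c1, c2}. c = 0 \<or> c \<in> R"
    "c0 = c1 \<longrightarrow> c0 = 0" "c0 = c2 \<longrightarrow> c0 = 0" "c1 = c2 \<longrightarrow> c1 = 0"
  shows "sum f R = (if c0 = 0 then 0 else f c0) + (if c1 = 0 then 0 else f c1) +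
    (if c2 = 0 then 0 else f c2) + sum f (R - {c0, c1, c2})"
proof -
  have "R - {c0} - {c1} - {c2} = R - {c0, c1, c2}" by auto
  moreover have "c1 = 0 \<or> c1 \<in> R - {c0}" "c2 = 0 \<or> c2 \<in> R - {c0} - {c1}"
    using assms by (metis insert_iff Diff_iff singletonD)+
  ultimately show ?thesis
    using sum_remove_or_zero[of R c0 f] sum_remove_or_zero[of "R - {c0}" c1 f]
      sum_remove_or_zero[of "R - {c0} - {c1}" c2 f] assms(1-3)
    by (simp only: finite_Diff) simp
qed

section \<open>Admissible operations and their effect on solutions\<close>

definition attached :: "'a log_scheme \<Rightarrow> nat \<Rightarrow> nat set \<Rightarrow> nat \<Rightarrow> nat \<Rightarrow> nat \<Rightarrow> bool" where
  "attached L n R v c p \<longleftrightarrow>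
     (if c = 0 then p = n else c \<in> R \<and> {ex L c, ey L c} = {v, p}) \<and> v \<noteq> p"

text \<open>The last clause makes elimination sound: no other link can charge the vertex, so its
  capacity is settled by the three children and can be forgotten afterwards.\<close>

definition elim_ok :: "nat \<Rightarrow> 'a log_scheme \<Rightarrow> nat set \<Rightarrow> nat \<Rightarrow> bool" where
  "elim_ok n L R g \<longleftrightarrow> vtx L g < n \<and>
     attached L n R (vtx L g) (ch0 L g) n \<and> attached L n R (vtx L g) (ch1 L g) (ex L g) \<and>
     attached L n R (vtx L g) (ch2 L g) (ey L g) \<and>
     (ch0 L g = ch1 L g \<longrightarrow> ch0 L g = 0) \<and> (ch0 L g = ch2 L g \<longrightarrow> ch0 L g = 0) \<and>
     (ch1 L g = ch2 L g \<longrightarrow> ch1 L g = 0) \<and>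
     (\<forall>e\<in>R. ex L e = vtx L g \<or> ey L e = vtx L g \<longrightarrow> e \<in> {ch0 L g, ch1 L g, ch2 L g})"

definition merge_ok :: "nat \<Rightarrow> 'a log_scheme \<Rightarrow> nat set \<Rightarrow> nat \<Rightarrow> bool" where
  "merge_ok n L R g \<longleftrightarrow> ex L g = vtx L g \<and>
     ch0 L g = 0 \<and> ch1 L g \<noteq> 0 \<and> ch2 L g \<noteq> 0 \<and> ch1 L g \<noteq> ch2 L g \<and>
     attached L n R (vtx L g) (ch1 L g) (ey L g) \<and> attached L n R (vtx L g) (ch2 L g) (ey L g)"

definition op_ok :: "nat \<Rightarrow> 'a log_scheme \<Rightarrow> nat set \<Rightarrow> nat \<Rightarrow> bool" where
  "op_ok n L R g \<longleftrightarrow>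
     etab L 0 = trivial_table \<and> 0 \<notin> R \<and> finite R \<and> g \<noteq> 0 \<and> g \<notin> R \<and>
     etab L g = combine (kind L g) (table_from L (vtx L g) (ch0 L g))
       (table_from L (vtx L g) (ch1 L g)) (table_from L (vtx L g) (ch2 L g)) \<and>
     (if kind L g = 0 then elim_ok n L R g else merge_ok n L R g)"

definition after_op :: "'a log_scheme \<Rightarrow> nat set \<Rightarrow> nat \<Rightarrow> nat set" where
  "after_op L R g = insert g (R - {ch0 L g, ch1 L g, ch2 L g})"

lemma trivial_table_converse: "trivial_table\<inverse> = trivial_table"
  unfolding trivial_table_def by auto

lemma attached_in: "attached L n R v c p \<Longrightarrow> c = 0 \<or> c \<in> R"
  unfolding attached_def by (auto split: if_splits)

lemma op_ok_children:
  assumes "op_ok n L R g"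
  shows "\<forall>c\<in>{ch0 L g, ch1 L g, ch2 L g}. c = 0 \<or> c \<in> R"
    "ch0 L g = ch1 L g \<longrightarrow> ch0 L g = 0" "ch0 L g = ch2 L g \<longrightarrow> ch0 L g = 0" "ch1 L g = ch2 L g \<longrightarrow> ch1 L g = 0"
    "finite R" "0 \<notin> R" "g \<notin> R"
proof -
  note a = attached_in[of L n R "vtx L g"]
  show "\<forall>c\<in>{ch0 L g, ch1 L g, ch2 L g}. c = 0 \<or> c \<in> R"
  proof (cases "kind L g = 0")
    case True
    then have "elim_ok n L R g" using assms unfolding op_ok_def by simp
    then show ?thesis using a[of "ch0 L g" n] a[of "ch1 L g" "ex L g"] a[of "ch2 L g" "ey L g"]
      by (simp add: elim_ok_def)
  next
    case False
    then have "merge_ok n L R g" using assms unfolding op_ok_def by simp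
    then show ?thesis using a[of "ch1 L g" "ey L g"] a[of "ch2 L g" "ey L g"]
      by (simp add: merge_ok_def)
  qed
qed (use assms in \<open>auto simp: op_ok_def elim_ok_def merge_ok_def split: if_splits\<close>)

text \<open>The missing link \<open>0\<close> behaves like a link to \<open>n\<close> with the trivial table.\<close>

lemma attached_tuple:
  assumes at: "attached L n R v c p" and sol: "solution n L R q A" and triv: "etab L 0 = trivial_table"
  obtains a where "a \<in> table_from L v c" "fst (fst a) = q v" "fst (snd a) = q p"
    "\<And>w. (if c = 0 then 0 else load L A w c) =
      of_bool (w = v \<and> snd (fst a)) + of_bool (w = p \<and> snd (snd a))"
proof (cases "c = 0")
  case True
  have "((q v, False), (q p, False)) \<in> table_from L v c"
    using True triv trivial_table_converse unfolding table_from_def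
    by (auto simp: trivial_table_def)
  then show ?thesis by (rule that) (simp_all add: True)
next
  case False
  then have c: "c \<in> R" "{ex L c, ey L c} = {v, p}" "v \<noteq> p" using at unfolding attached_def by auto
  let ?a = "turn L v c (A c)"
  have "A c \<in> etab L c" "fst (fst (A c)) = q (ex L c) \<and> fst (snd (A c)) = q (ey L c)"
    using sol c(1) unfolding solution_def by auto
  then have "?a \<in> table_from L v c" "fst (fst ?a) = q v" "fst (snd ?a) = q p"
    using turn_in_table_from turn_ends[OF c(2,3)] by blast+
  then show ?thesis using that[of ?a] turn_load[OF c(2,3), of A ?a] False by simp
qed

text \<open>The vertex states stay as they are, and the three tuples at the vertex are replaced by
  two of their far ends. The capacity of the vertex gives the inequality in
  \<open>decomposes\<close>; capacity zero at \<open>n\<close> shows that the far end of the first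
  tuple is uncharged.\<close>

lemma solution_elim:
  assumes op: "op_ok n L R g" and k: "kind L g = 0" and sol: "solution n L R q A"
  shows "\<exists>B. solution n L (after_op L R g) q B"
proof -
  let ?v = "vtx L g" and ?c0 = "ch0 L g" and ?c1 = "ch1 L g" and ?c2 = "ch2 L g"
  note o = op[unfolded op_ok_def] k
  have el: "elim_ok n L R g" and triv: "etab L 0 = trivial_table" using o by auto
  note e = el[unfolded elim_ok_def]
  obtain a0 where a0: "a0 \<in> table_from L ?v ?c0" "fst (fst a0) = q ?v" "fst (snd a0) = q n"
    "\<And>w. (if ?c0 = 0 then 0 else load L A w ?c0) =
      of_bool (w = ?v \<and> snd (fst a0)) + of_bool (w = n \<and> snd (snd a0))"
    using attached_tuple[OF _ sol triv, of ?v ?c0 n] e by blast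
  obtain a1 where a1: "a1 \<in> table_from L ?v ?c1" "fst (fst a1) = q ?v" "fst (snd a1) = q (ex L g)"
    "\<And>w. (if ?c1 = 0 then 0 else load L A w ?c1) =
      of_bool (w = ?v \<and> snd (fst a1)) + of_bool (w = ex L g \<and> snd (snd a1))"
    using attached_tuple[OF _ sol triv, of ?v ?c1 "ex L g"] e by blast
  obtain a2 where a2: "a2 \<in> table_from L ?v ?c2" "fst (fst a2) = q ?v" "fst (snd a2) = q (ey L g)"
    "\<And>w. (if ?c2 = 0 then 0 else load L A w ?c2) =
      of_bool (w = ?v \<and> snd (fst a2)) + of_bool (w = ey L g \<and> snd (snd a2))"
    using attached_tuple[OF _ sol triv, of ?v ?c2 "ey L g"] e by blast
  let ?R = "R - {?c0, ?c1, ?c2}"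
  \<comment> \<open>The load sums before and after the operation are each split into the part of the
    links involved and a common remainder.\<close>
  have old: "(\<Sum>x\<in>R. load L A w x) =
      of_bool (w = ?v \<and> snd (fst a0)) + of_bool (w = n \<and> snd (snd a0)) +
      (of_bool (w = ?v \<and> snd (fst a1)) + of_bool (w = ex L g \<and> snd (snd a1))) +
      (of_bool (w = ?v \<and> snd (fst a2)) + of_bool (w = ey L g \<and> snd (snd a2))) +
      (\<Sum>x\<in>?R. load L A w x)" for w
    unfolding a0(4)[symmetric] a1(4)[symmetric] a2(4)[symmetric]
    by (rule sum_remove_three) (fact op_ok_children[OF op])+
  have cap: "(\<Sum>x\<in>R. load L A w x) \<le> of_bool (w \<noteq> n)" for w
    using sol unfolding solution_def by blast
  define B where "B = A(g := (snd a1, snd a2))"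
  have "\<not> snd (snd a0)" using old[of n] cap[of n] by (cases "snd (snd a0)") auto
  then have "snd a0 = (state0, False)"
    using a0(3) sol unfolding solution_def by (metis prod.collapse)
  moreover have "of_bool (snd (fst a0)) + of_bool (snd (fst a1)) + of_bool (snd (fst a2)) \<le> (1::nat)"
    using old[of ?v] cap[of ?v] by (auto split: if_splits simp: of_bool_def)
  ultimately have "decomposes (kind L g) (table_from L ?v ?c0) (table_from L ?v ?c1)
      (table_from L ?v ?c2) (snd a1, snd a2) (a0, a1, a2)"
    unfolding decomposes_def using k a0(1,2) a1(1,2) a2(1,2) by simp
  then have "(snd a1, snd a2) \<in> etab L g" using o combineI by metis
  moreover have gR: "g \<notin> ?R" "finite ?R" using o by auto
  have new: "(\<Sum>x\<in>after_op L R g. load L B w x) =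
      of_bool (w = ex L g \<and> snd (snd a1)) + of_bool (w = ey L g \<and> snd (snd a2)) +
      (\<Sum>x\<in>?R. load L A w x)" for w
  proof -
    have "(\<Sum>x\<in>?R. load L B w x) = (\<Sum>x\<in>?R. load L A w x)"
      using gR unfolding load_def B_def by (intro sum.cong) auto
    moreover have "load L B w g = of_bool (w = ex L g \<and> snd (snd a1)) + of_bool (w = ey L g \<and> snd (snd a2))"
      by (auto simp: load_def B_def)
    ultimately show ?thesis using gR unfolding after_op_def by simp
  qed
  have "(\<Sum>x\<in>after_op L R g. load L B w x) \<le> of_bool (w \<noteq> n)" for w
    using new[of w] old[of w] cap[of w] by linarith
  ultimately have "solution n L (after_op L R g) q B"
    using sol gR a1 a2 unfolding solution_def after_op_def B_def by auto
  then show ?thesis by blast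
qed

text \<open>By the capacities at most one of the parallel links charges a given common end, so the
  two charges add up to one bit, and every vertex keeps its total load.\<close>

lemma solution_merge:
  assumes op: "op_ok n L R g" and k: "kind L g \<noteq> 0" and sol: "solution n L R q A"
  shows "\<exists>B. solution n L (after_op L R g) q B"
proof -
  let ?v = "vtx L g" and ?c1 = "ch1 L g" and ?c2 = "ch2 L g" and ?y = "ey L g"
  note o = op[unfolded op_ok_def] k
  have el: "merge_ok n L R g" and triv: "etab L 0 = trivial_table" using o by auto
  note e = el[unfolded merge_ok_def]
  obtain a1 where a1: "a1 \<in> table_from L ?v ?c1" "fst (fst a1) = q ?v" "fst (snd a1) = q ?y"
    "\<And>w. (if ?c1 = 0 then 0 else load L A w ?c1) =
      of_bool (w = ?v \<and> snd (fst a1)) + of_bool (w = ?y \<and> snd (snd a1))"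
    using attached_tuple[OF _ sol triv, of ?v ?c1 ?y] e by blast
  obtain a2 where a2: "a2 \<in> table_from L ?v ?c2" "fst (fst a2) = q ?v" "fst (snd a2) = q ?y"
    "\<And>w. (if ?c2 = 0 then 0 else load L A w ?c2) =
      of_bool (w = ?v \<and> snd (fst a2)) + of_bool (w = ?y \<and> snd (snd a2))"
    using attached_tuple[OF _ sol triv, of ?v ?c2 ?y] e by blast
  let ?R = "R - {ch0 L g, ?c1, ?c2}"
  have vy: "?v \<noteq> ?y" using e unfolding attached_def by blast
  have old: "(\<Sum>x\<in>R. load L A w x) = (if ch0 L g = 0 then 0 else load L A w (ch0 L g)) +
      (of_bool (w = ?v \<and> snd (fst a1)) + of_bool (w = ?y \<and> snd (snd a1))) +
      (of_bool (w = ?v \<and> snd (fst a2)) + of_bool (w = ?y \<and> snd (snd a2))) +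
      (\<Sum>x\<in>?R. load L A w x)" for w
    unfolding a1(4)[symmetric] a2(4)[symmetric]
    by (rule sum_remove_three) (fact op_ok_children[OF op])+
  have cap: "(\<Sum>x\<in>R. load L A w x) \<le> of_bool (w \<noteq> n)" for w
    using sol unfolding solution_def by blast
  have cap1: "(\<Sum>x\<in>R. load L A w x) \<le> 1" for w using cap[of w] by (auto simp: of_bool_def split: if_splits)
  define t where "t = ((q ?v, snd (fst a1) \<or> snd (fst a2)), (q ?y, snd (snd a1) \<or> snd (snd a2)))"
  define B where "B = A(g := t)"
  have one: "of_bool (snd (fst a1)) + of_bool (snd (fst a2)) = (of_bool (snd (fst t)) :: nat)"
    "of_bool (snd (snd a1)) + of_bool (snd (snd a2)) = (of_bool (snd (snd t)) :: nat)"
    using old[of ?v] cap1[of ?v] old[of ?y] cap1[of ?y] unfolding t_def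
    by (auto split: if_splits simp: of_bool_def)
  then have "decomposes (kind L g) (table_from L ?v (ch0 L g)) (table_from L ?v ?c1)
      (table_from L ?v ?c2) t (undefined, a1, a2)"
    unfolding decomposes_def using k a1(1-3) a2(1-3) by (simp add: t_def)
  then have t: "t \<in> etab L g" using o combineI by metis
  have gR: "g \<notin> ?R" "finite ?R" using o by auto
  have new: "(\<Sum>x\<in>after_op L R g. load L B w x) =
      of_bool (w = ?v \<and> snd (fst t)) + of_bool (w = ?y \<and> snd (snd t)) +
      (\<Sum>x\<in>?R. load L A w x)" for w
  proof -
    have "(\<Sum>x\<in>?R. load L B w x) = (\<Sum>x\<in>?R. load L A w x)"
      using gR unfolding load_def B_def by (intro sum.cong) auto
    moreover have "load L B w g = of_bool (w = ?v \<and> snd (fst t)) + of_bool (w = ?y \<and> snd (snd t))"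
      using e by (auto simp: load_def B_def)
    ultimately show ?thesis using gR unfolding after_op_def by simp
  qed
  have "(\<Sum>x\<in>after_op L R g. load L B w x) = (\<Sum>x\<in>R. load L A w x)" for w
    unfolding new old using one e vy by (cases "w = ?v"; cases "w = ?y") auto
  then have "(\<Sum>x\<in>after_op L R g. load L B w x) \<le> of_bool (w \<noteq> n)" for w using cap[of w] by simp
  then have "solution n L (after_op L R g) q B"
    using sol gR t e unfolding solution_def after_op_def B_def by (auto simp: t_def)
  then show ?thesis by blast
qed

text \<open>For a missing child the update happens at index \<open>0\<close>, which no live link
  uses.\<close>

definition undo :: "'a log_scheme \<Rightarrow> nat \<Rightarrow> tuple \<times> tuple \<times> tuple \<Rightarrow> (nat \<Rightarrow> tuple) \<Rightarrow> nat \<Rightarrow> tuple" where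
  "undo L g = (\<lambda>(a0, a1, a2) A.
     (((A(ch0 L g := turn L (vtx L g) (ch0 L g) a0))
         (ch1 L g := turn L (vtx L g) (ch1 L g) a1))
         (ch2 L g := turn L (vtx L g) (ch2 L g) a2)))"

lemma undo_at:
  assumes d: "ch0 L g = ch1 L g \<longrightarrow> ch0 L g = 0" "ch0 L g = ch2 L g \<longrightarrow> ch0 L g = 0" "ch1 L g = ch2 L g \<longrightarrow> ch1 L g = 0"
  shows "ch0 L g \<noteq> 0 \<Longrightarrow> undo L g (a0, a1, a2) A (ch0 L g) = turn L (vtx L g) (ch0 L g) a0"
    "ch1 L g \<noteq> 0 \<Longrightarrow> undo L g (a0, a1, a2) A (ch1 L g) = turn L (vtx L g) (ch1 L g) a1"
    "ch2 L g \<noteq> 0 \<Longrightarrow> undo L g (a0, a1, a2) A (ch2 L g) = turn L (vtx L g) (ch2 L g) a2"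
    "x \<notin> {ch0 L g, ch1 L g, ch2 L g} \<Longrightarrow> undo L g (a0, a1, a2) A x = A x"
proof -
  show "undo L g (a0, a1, a2) A (ch0 L g) = turn L (vtx L g) (ch0 L g) a0" if "ch0 L g \<noteq> 0"
  proof -
    have "ch0 L g \<noteq> ch1 L g" "ch0 L g \<noteq> ch2 L g" using d that by metis+
    then show ?thesis unfolding undo_def by simp
  qed
  show "undo L g (a0, a1, a2) A (ch1 L g) = turn L (vtx L g) (ch1 L g) a1" if "ch1 L g \<noteq> 0"
  proof -
    have "ch1 L g \<noteq> ch2 L g" using d that by metis
    then show ?thesis unfolding undo_def by simp
  qed
qed (simp_all add: undo_def)

text \<open>Any decomposition of the chosen tuple will do. An eliminated vertex takes its state from
  it, and its capacity holds because no link outside the three children touches it; at all other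
  vertices the load of the removed link passes to its children.\<close>

lemma solution_undo:
  assumes op: "op_ok n L R g" and sol: "solution n L (after_op L R g) q A"
    and dec: "decomposes (kind L g) (table_from L (vtx L g) (ch0 L g))
       (table_from L (vtx L g) (ch1 L g)) (table_from L (vtx L g) (ch2 L g)) (A g) a"
    and nz: "vtx L g \<noteq> n"
  shows "solution n L R (q(vtx L g := fst (fst (fst (snd a))))) (undo L g a A)"
proof -
  obtain a0 a1 a2 where a: "a = (a0, a1, a2)" by (metis prod_cases3)
  let ?v = "vtx L g" and ?c0 = "ch0 L g" and ?c1 = "ch1 L g" and ?c2 = "ch2 L g"
  let ?x = "ex L g" and ?y = "ey L g"
  let ?q = "q(?v := fst (fst a1))" and ?B = "undo L g a A"
  let ?R = "R - {?c0, ?c1, ?c2}"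
  note o = op[unfolded op_ok_def]
  have dist: "?c0 = ?c1 \<longrightarrow> ?c0 = 0" "?c0 = ?c2 \<longrightarrow> ?c0 = 0" "?c1 = ?c2 \<longrightarrow> ?c1 = 0"
    using op_ok_children[OF op] by blast+
  note B = undo_at[OF dist, where ?a0.0 = a0 and ?a1.0 = a1 and ?a2.0 = a2 and A = A, folded a]
  have mem: "\<forall>c\<in>{?c0, ?c1, ?c2}. c = 0 \<or> c \<in> R"
    using op_ok_children(1)[OF op] .
  have gR: "g \<notin> ?R" "finite ?R" "finite R" "0 \<notin> R" using o by auto
  have solg: "q n = state0" "A g \<in> etab L g" "fst (fst (A g)) = q ?x" "fst (snd (A g)) = q ?y"
    and solR: "\<And>e. e \<in> ?R \<Longrightarrow> A e \<in> etab L e \<and> fst (fst (A e)) = q (ex L e) \<and> fst (snd (A e)) = q (ey L e)"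
    using sol unfolding solution_def after_op_def by auto
  have qn: "?q n = state0" using nz solg by simp
  have restB: "(\<Sum>x\<in>?R. load L ?B w x) = (\<Sum>x\<in>?R. load L A w x)" for w
    unfolding load_def using B(4) by (intro sum.cong) auto
  have cap: "load L A w g + (\<Sum>x\<in>?R. load L A w x) \<le> of_bool (w \<noteq> n)" for w
    using sol gR unfolding solution_def after_op_def by auto
  have sum: "(\<Sum>x\<in>R. load L ?B w x) = (if ?c0 = 0 then 0 else load L ?B w ?c0) +
      (if ?c1 = 0 then 0 else load L ?B w ?c1) + (if ?c2 = 0 then 0 else load L ?B w ?c2) +
      (\<Sum>x\<in>?R. load L A w x)" for w
    using sum_remove_three[OF gR(3,4) mem dist, of "load L ?B w"] restB[of w] by simp
  have child: "?B c \<in> etab L c \<and> fst (fst (?B c)) = ?q (ex L c) \<and> fst (snd (?B c)) = ?q (ey L c)"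
    "load L ?B w c = of_bool (w = ?v \<and> snd (fst t)) + of_bool (w = p \<and> snd (snd t))"
    if "c \<noteq> 0" "attached L n R ?v c p" "?B c = turn L ?v c t" "t \<in> table_from L ?v c"
      "fst (fst t) = fst (fst a1)" "fst (snd t) = q p" for c p t w
  proof -
    have c: "{ex L c, ey L c} = {?v, p}" "?v \<noteq> p" using that unfolding attached_def by auto
    show "load L ?B w c = of_bool (w = ?v \<and> snd (fst t)) + of_bool (w = p \<and> snd (snd t))"
      using turn_load[OF c, of ?B t] that by simp
    show "?B c \<in> etab L c \<and> fst (fst (?B c)) = ?q (ex L c) \<and> fst (snd (?B c)) = ?q (ey L c)"
      using turn_ends[OF c, of "?B c" ?q] turn_in_table[of L ?v c t] that c by simp
  qed
  show ?thesis
  proof (cases "kind L g = 0")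
    case True
    have e: "elim_ok n L R g" using o True by simp
    note e = e[unfolded elim_ok_def]
    have d: "a0 \<in> table_from L ?v ?c0" "a1 \<in> table_from L ?v ?c1" "a2 \<in> table_from L ?v ?c2"
      "fst (fst a0) = fst (fst a1)" "fst (fst a2) = fst (fst a1)"
      "of_bool (snd (fst a0)) + of_bool (snd (fst a1)) + of_bool (snd (fst a2)) \<le> (1::nat)"
      "snd a0 = (state0, False)" "A g = (snd a1, snd a2)"
      using dec True unfolding decomposes_def a by auto
    have at: "attached L n R ?v ?c0 n" "attached L n R ?v ?c1 ?x" "attached L n R ?v ?c2 ?y"
      using e by auto
    have f: "fst (snd a0) = q n" "fst (snd a1) = q ?x" "fst (snd a2) = q ?y"
      using d solg by auto
    note ch0 = child[OF _ at(1) B(1) d(1) d(4) f(1)]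
    note ch1 = child[OF _ at(2) B(2) d(2) refl f(2)]
    note ch2 = child[OF _ at(3) B(3) d(3) d(5) f(3)]
    have Rv: "ex L x \<noteq> ?v" "ey L x \<noteq> ?v" if "x \<in> ?R" for x using e that by auto
    have rest: "?B x \<in> etab L x \<and> fst (fst (?B x)) = ?q (ex L x) \<and> fst (snd (?B x)) = ?q (ey L x)"
      if "x \<in> ?R" for x using solR[OF that] Rv[OF that] B(4)[of x] that by auto
    have "?B x \<in> etab L x \<and> fst (fst (?B x)) = ?q (ex L x) \<and> fst (snd (?B x)) = ?q (ey L x)"
      if x: "x \<in> R" for x
    proof -
      have nz: "x \<noteq> 0" using x gR(4) by metis
      consider "x = ?c0" | "x = ?c1" | "x = ?c2" | "x \<in> ?R" using x by blast
      then show ?thesis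
        by cases (use ch0(1) ch1(1) ch2(1) rest nz in \<open>simp_all only: simp_thms True_implies_equals\<close>)
    qed
    moreover have "(\<Sum>x\<in>R. load L ?B w x) \<le> of_bool (w \<noteq> n)" for w
    proof (cases "w = ?v")
      case True
      have "(\<Sum>x\<in>?R. load L A w x) = 0" using Rv True unfolding load_def by (intro sum.neutral) auto
      then have "(\<Sum>x\<in>R. load L ?B w x) \<le>
        of_bool (snd (fst a0)) + of_bool (snd (fst a1)) + of_bool (snd (fst a2))"
        unfolding sum using ch0(2)[of w] ch1(2)[of w] ch2(2)[of w] True at unfolding attached_def by auto
      then show ?thesis using d(6) True nz by simp
    next
      case False
      have "(\<Sum>x\<in>R. load L ?B w x) \<le> load L A w g + (\<Sum>x\<in>?R. load L A w x)"
        unfolding sum using ch0(2)[of w] ch1(2)[of w] ch2(2)[of w] False d(7,8)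
        unfolding load_def[of L A w g] by auto
      then show ?thesis using cap[of w] by linarith
    qed
    ultimately show ?thesis unfolding solution_def using qn a by simp
  next
    case False
    have e: "merge_ok n L R g" using o False by simp
    note e = e[unfolded merge_ok_def]
    have at: "attached L n R ?v ?c1 ?y" "attached L n R ?v ?c2 ?y" using e by auto
    have d: "a1 \<in> table_from L ?v ?c1" "a2 \<in> table_from L ?v ?c2"
      "fst (fst a1) = fst (fst (A g))" "fst (fst a2) = fst (fst (A g))"
      "fst (snd a1) = fst (snd (A g))" "fst (snd a2) = fst (snd (A g))"
      "of_bool (snd (fst a1)) + of_bool (snd (fst a2)) = (of_bool (snd (fst (A g))) :: nat)"
      "of_bool (snd (snd a1)) + of_bool (snd (snd a2)) = (of_bool (snd (snd (A g))) :: nat)"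
      using dec False unfolding decomposes_def a by auto
    \<comment> \<open>A merge has \<open>ex L g = vtx L g\<close>, so the state written back is the
      one the vertex already has.\<close>
    have qv: "?q = q" using d solg e by auto
    have f: "fst (snd a1) = q ?y" "fst (snd a2) = q ?y" "fst (fst a2) = fst (fst a1)"
      using d solg by auto
    note ch1 = child[OF _ at(1) B(2) d(1) refl f(1)]
    note ch2 = child[OF _ at(2) B(3) d(2) f(3) f(2)]
    have rest: "?B x \<in> etab L x \<and> fst (fst (?B x)) = ?q (ex L x) \<and> fst (snd (?B x)) = ?q (ey L x)"
      if "x \<in> ?R" for x unfolding qv using solR[OF that] B(4)[of x] that by auto
    have "?B x \<in> etab L x \<and> fst (fst (?B x)) = ?q (ex L x) \<and> fst (snd (?B x)) = ?q (ey L x)"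
      if x: "x \<in> R" for x
    proof -
      have nz: "x \<noteq> 0" using x gR(4) by metis
      consider "x = ?c1" | "x = ?c2" | "x \<in> ?R" using x e nz
        by (metis Diff_iff insert_iff empty_iff)
      then show ?thesis
        by cases (use ch1(1) ch2(1) rest nz in \<open>simp_all only: simp_thms True_implies_equals\<close>)
    qed
    moreover have "(\<Sum>x\<in>R. load L ?B w x) = load L A w g + (\<Sum>x\<in>?R. load L A w x)" for w
    proof -
      have "?v \<noteq> ?y" using at unfolding attached_def by blast
      then show ?thesis unfolding sum using ch1(2)[of w] ch2(2)[of w] d(7,8) e
        unfolding load_def[of L A w g] by (cases "w = ?v"; cases "w = ?y") auto
    qed
    ultimately show ?thesis unfolding solution_def using qn cap a by simp
  qed
qed

section \<open>Elimination of vertices\<close>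

text \<open>Input links will enter the same log with all three children equal to \<open>0\<close>,
  so one recursion covers both reading and elimination.\<close>

primrec live :: "'a log_scheme \<Rightarrow> nat \<Rightarrow> nat set" where
  "live L 0 = {}"
| "live L (Suc g) = after_op L (live L g) (Suc g)"

text \<open>
  Vertex \<open>n\<close> stands for a missing vertex and link \<open>0\<close> for a missing link.  Dead links leave the
  lists \<open>adj w\<close> only when they are met; \<open>adj (Suc n)\<close> is the work list.  While the links at
  vertex \<open>cur\<close> are scanned, \<open>s0\<close>, \<open>s1\<close>, \<open>s2\<close> hold the link to \<open>n\<close> and those to the two
  neighbors \<open>p1\<close>, \<open>p2\<close> met so far.
\<close>

record machine = log +
  rcnt :: nat
  rdead :: "nat set"
  vdead :: "nat set"
  adj :: "nat \<Rightarrow> nat list"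
  cur :: nat
  s0 :: nat
  s1 :: nat
  s2 :: nat
  p1 :: nat
  p2 :: nat
  feas :: bool
  go :: bool

abbreviation links :: "machine \<Rightarrow> nat set" where
  "links \<sigma> \<equiv> live \<sigma> (rcnt \<sigma>)"

definition push :: "nat \<Rightarrow> nat \<Rightarrow> (nat \<Rightarrow> nat list) \<Rightarrow> nat \<Rightarrow> nat list" where
  "push v x a = a(v := x # a v)"

text \<open>Both ends are queued even if they are \<open>n\<close>: since \<open>n\<close> counts as
  dead, such entries are discarded by the test that also discards eliminated vertices.\<close>

definition new_link :: "nat \<Rightarrow> nat \<Rightarrow> nat \<Rightarrow> nat \<Rightarrow> nat \<Rightarrow> nat \<Rightarrow> nat \<Rightarrow> machine \<Rightarrow> machine" where
  "new_link n k c0 c1 c2 x y \<sigma> =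
    (let g = Suc (rcnt \<sigma>); v = cur \<sigma>;
         T = combine k (table_from \<sigma> v c0) (table_from \<sigma> v c1) (table_from \<sigma> v c2)
     in \<sigma>\<lparr>ex := (ex \<sigma>)(g := x), ey := (ey \<sigma>)(g := y), etab := (etab \<sigma>)(g := T),
          kind := (kind \<sigma>)(g := k), vtx := (vtx \<sigma>)(g := v),
          ch0 := (ch0 \<sigma>)(g := c0), ch1 := (ch1 \<sigma>)(g := c1), ch2 := (ch2 \<sigma>)(g := c2),
          rcnt := g, rdead := rdead \<sigma> \<union> {c0, c1, c2},
          adj := push (Suc n) y (push (Suc n) x (push y g (push x g (adj \<sigma>)))),
          feas := (feas \<sigma> \<and> T \<noteq> {})\<rparr>)"

text \<open>Empty slots and links that were just merged are returned as well. Link \<open>0\<close>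
  and consumed links are marked dead, so these entries vanish when they are met again.\<close>

definition close :: "nat \<Rightarrow> nat \<Rightarrow> machine \<Rightarrow> machine" where
  "close n e \<sigma> = \<sigma>\<lparr>adj := push (cur \<sigma>) (s2 \<sigma>) (push (cur \<sigma>) (s1 \<sigma>) (push (cur \<sigma>) (s0 \<sigma>)
     (push (cur \<sigma>) e (adj \<sigma>)))), cur := n\<rparr>"

definition merge_links :: "nat \<Rightarrow> nat \<Rightarrow> nat \<Rightarrow> nat \<Rightarrow> machine \<Rightarrow> machine" where
  "merge_links n s e y \<sigma> = close n e (new_link n 1 0 s e (cur \<sigma>) y \<sigma>)"

text \<open>The entries pushed by \<open>close\<close> land in the list of a dead vertex, which is
  never opened again; in this way both operations can end with the same code.\<close>

definition eliminate :: "nat \<Rightarrow> machine \<Rightarrow> machine" where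
  "eliminate n \<sigma> = close n 0
     ((new_link n 0 (s0 \<sigma>) (s1 \<sigma>) (s2 \<sigma>) (p1 \<sigma>) (p2 \<sigma>) \<sigma>)\<lparr>vdead := insert (cur \<sigma>) (vdead \<sigma>)\<rparr>)"

text \<open>A third distinct neighbor puts the vertex aside without queueing it: only a new link at
  it makes another scan worthwhile.\<close>

definition step :: "nat \<Rightarrow> machine \<Rightarrow> machine" where
  "step n \<sigma> =
    (if cur \<sigma> = n then
       (case adj \<sigma> (Suc n) of
          [] \<Rightarrow> \<sigma>\<lparr>go := False\<rparr>
        | w # ws \<Rightarrow>
            if w \<in> vdead \<sigma> then \<sigma>\<lparr>adj := (adj \<sigma>)(Suc n := ws)\<rparr>
            else \<sigma>\<lparr>adj := (adj \<sigma>)(Suc n := ws), cur := w, s0 := 0, s1 := 0, s2 := 0, p1 := n, p2 := n\<rparr>)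
     else
       (case adj \<sigma> (cur \<sigma>) of
          [] \<Rightarrow> eliminate n \<sigma>
        | e # es \<Rightarrow>
            let \<tau> = \<sigma>\<lparr>adj := (adj \<sigma>)(cur \<sigma> := es)\<rparr>;
                y = (if ex \<sigma> e = cur \<sigma> then ey \<sigma> e else ex \<sigma> e) in
            if e \<in> rdead \<sigma> then \<tau>
            else if y = n then (if s0 \<sigma> = 0 then \<tau>\<lparr>s0 := e\<rparr> else merge_links n (s0 \<sigma>) e y \<tau>)
            else if p1 \<sigma> = n then \<tau>\<lparr>s1 := e, p1 := y\<rparr>
            else if p1 \<sigma> = y then merge_links n (s1 \<sigma>) e y \<tau>
            else if p2 \<sigma> = n then \<tau>\<lparr>s2 := e, p2 := y\<rparr>
            else if p2 \<sigma> = y then merge_links n (s2 \<sigma>) e y \<tau>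
            else close n e \<tau>))"

definition alive :: "nat \<Rightarrow> machine \<Rightarrow> nat set" where
  "alive n \<sigma> = {..<n} - vdead \<sigma>"

definition link_graph :: "nat \<Rightarrow> 'a log_scheme \<Rightarrow> nat set \<Rightarrow> nat set set" where
  "link_graph n L R = {{ex L e, ey L e} | e. e \<in> R \<and> ex L e < n \<and> ey L e < n}"

text \<open>The links \<open>1, \<dots>, m\<close> are the input edges; every later link was made by an operation.\<close>

definition log_ok :: "nat \<Rightarrow> nat \<Rightarrow> machine \<Rightarrow> bool" where
  "log_ok n m \<sigma> \<longleftrightarrow> m \<le> rcnt \<sigma> \<and> etab \<sigma> 0 = trivial_table \<and>
     (\<forall>g\<le>m. ch0 \<sigma> g = 0 \<and> ch1 \<sigma> g = 0 \<and> ch2 \<sigma> g = 0) \<and>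
     (\<forall>g. 1 \<le> g \<and> g \<le> m \<longrightarrow> ex \<sigma> g < n) \<and>
     (\<forall>g. m < g \<and> g \<le> rcnt \<sigma> \<longrightarrow> op_ok n \<sigma> (live \<sigma> (g - 1)) g \<and> vtx \<sigma> g < n \<and>
        (kind \<sigma> g = 0 \<longrightarrow> (ex \<sigma> g = n \<longrightarrow> ch1 \<sigma> g = 0) \<and> (ey \<sigma> g = n \<longrightarrow> ch2 \<sigma> g = 0))) \<and>
     (feas \<sigma> \<longleftrightarrow> (\<forall>g. m < g \<and> g \<le> rcnt \<sigma> \<longrightarrow> etab \<sigma> g \<noteq> {}))"

definition core :: "nat \<Rightarrow> nat \<Rightarrow> machine \<Rightarrow> bool" where
  "core n m \<sigma> \<longleftrightarrow>
     (\<forall>e\<le>rcnt \<sigma>. e \<in> rdead \<sigma> \<longleftrightarrow> e \<notin> links \<sigma>) \<and> rdead \<sigma> \<subseteq> {..rcnt \<sigma>} \<and>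
     vdead \<sigma> \<subseteq> {..n} \<and> n \<in> vdead \<sigma> \<and>
     (\<forall>e\<in>links \<sigma>. ex \<sigma> e \<in> insert n (alive n \<sigma>) \<and> ey \<sigma> e \<in> insert n (alive n \<sigma>) \<and>
        (ex \<sigma> e = ey \<sigma> e \<longrightarrow> ex \<sigma> e = n)) \<and>
     (\<forall>v<n. v \<in> vdead \<sigma> \<longrightarrow> (\<exists>g. m < g \<and> g \<le> rcnt \<sigma> \<and> kind \<sigma> g = 0 \<and> vtx \<sigma> g = v)) \<and>
     outerplanar (alive n \<sigma>) (link_graph n \<sigma> (links \<sigma>))"

definition incident :: "'a log_scheme \<Rightarrow> nat \<Rightarrow> nat \<Rightarrow> bool" where
  "incident L e w \<longleftrightarrow> ex L e = w \<or> ey L e = w"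

text \<open>A live link occurs exactly once at each of its real ends, in the list or in a slot.
  Hence a popped link differs from every slot, so no link is ever merged with itself, and once the
  list is empty the slots hold all live links of the vertex.\<close>

definition lists_ok :: "nat \<Rightarrow> machine \<Rightarrow> bool" where
  "lists_ok n \<sigma> \<longleftrightarrow>
     (\<forall>w\<le>n. set (adj \<sigma> w) \<subseteq> {..rcnt \<sigma>}) \<and> set (adj \<sigma> (Suc n)) \<subseteq> {..n} \<and>
     (\<forall>w\<in>alive n \<sigma>. \<forall>e\<in>links \<sigma>.
        (if w = cur \<sigma> then of_bool (s0 \<sigma> = e) + of_bool (s1 \<sigma> = e) + of_bool (s2 \<sigma> = e) else 0) +
        count_list (adj \<sigma> w) e = of_bool (incident \<sigma> e w))"

definition slots_ok :: "nat \<Rightarrow> machine \<Rightarrow> bool" where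
  "slots_ok n \<sigma> \<longleftrightarrow> (cur \<sigma> \<noteq> n \<longrightarrow> cur \<sigma> \<in> alive n \<sigma> \<and>
     attached \<sigma> n (links \<sigma>) (cur \<sigma>) (s0 \<sigma>) n \<and>
     attached \<sigma> n (links \<sigma>) (cur \<sigma>) (s1 \<sigma>) (p1 \<sigma>) \<and>
     attached \<sigma> n (links \<sigma>) (cur \<sigma>) (s2 \<sigma>) (p2 \<sigma>) \<and>
     (p1 \<sigma> = n \<longrightarrow> s1 \<sigma> = 0) \<and> (p2 \<sigma> = n \<longrightarrow> s2 \<sigma> = 0) \<and> (p1 \<sigma> = p2 \<sigma> \<longrightarrow> p1 \<sigma> = n) \<and>
     (p1 \<sigma> = n \<longrightarrow> p2 \<sigma> = n))"

text \<open>When the work list is exhausted, any remaining vertex would have degree at least 3, and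
  \<open>outerplanar_low_degree\<close> leaves no such graph except the empty one.\<close>

definition work_ok :: "nat \<Rightarrow> machine \<Rightarrow> bool" where
  "work_ok n \<sigma> \<longleftrightarrow>
     (\<forall>w\<in>alive n \<sigma>. w \<in> set (adj \<sigma> (Suc n)) \<or> w = cur \<sigma> \<or>
        3 \<le> card {u. {u, w} \<in> link_graph n \<sigma> (links \<sigma>)}) \<and>
     (\<not> go \<sigma> \<longrightarrow> adj \<sigma> (Suc n) = [] \<and> cur \<sigma> = n)"

definition valid :: "nat \<Rightarrow> nat \<Rightarrow> machine \<Rightarrow> bool" where
  "valid n m \<sigma> \<longleftrightarrow> log_ok n m \<sigma> \<and> core n m \<sigma> \<and> lists_ok n \<sigma> \<and> slots_ok n \<sigma> \<and> work_ok n \<sigma>"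

text \<open>
  The weights just pay for the list entries pushed by merging (one link less) and by
  eliminating a vertex (at most one link more).
\<close>

definition potential :: "nat \<Rightarrow> machine \<Rightarrow> nat" where
  "potential n \<sigma> = 27 * card (alive n \<sigma>) + 13 * card (links \<sigma>) + (\<Sum>w\<le>n. length (adj \<sigma> w)) +
     6 * length (adj \<sigma> (Suc n)) + 5 * of_bool (cur \<sigma> \<noteq> n) + of_bool (go \<sigma>)"

lemma live_subset: "live L g \<subseteq> {1..g}"
  by (induction g) (auto simp: after_op_def)

lemma finite_live: "finite (live L g)"
  using live_subset finite_subset by blast

lemma live_cong:
  "(\<And>h. h \<le> g \<Longrightarrow> ch0 L h = ch0 L' h \<and> ch1 L h = ch1 L' h \<and> ch2 L h = ch2 L' h) \<Longrightarrow>
    live L g = live L' g"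
  by (induction g) (auto simp: after_op_def)

lemma attached_cong:
  assumes "\<And>h. h \<le> g \<Longrightarrow> ex L h = ex L' h \<and> ey L h = ey L' h" "R \<subseteq> {..g}"
  shows "attached L n R v c p \<longleftrightarrow> attached L' n R v c p"
proof (cases "c \<in> R")
  case True
  then have "ex L c = ex L' c \<and> ey L c = ey L' c" using assms by blast
  then show ?thesis unfolding attached_def by simp
next
  case False
  then show ?thesis unfolding attached_def by auto
qed

text \<open>An operation speaks only about links up to its own index, so it stays admissible when
  the log grows.\<close>

lemma op_ok_cong:
  assumes agree: "\<And>h. h \<le> g \<Longrightarrow> ex L h = ex L' h \<and> ey L h = ey L' h \<and> etab L h = etab L' h \<and>
      kind L h = kind L' h \<and> vtx L h = vtx L' h \<and>
      ch0 L h = ch0 L' h \<and> ch1 L h = ch1 L' h \<and> ch2 L h = ch2 L' h"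
    and R: "R \<subseteq> {..g}" and op: "op_ok n L R g"
  shows "op_ok n L' R g"
proof -
  have at: "attached L' n R v c p \<longleftrightarrow> attached L n R v c p" for v c p
    by (rule attached_cong[OF _ R]) (simp add: agree)
  have tf: "table_from L' v c = table_from L v c" if "c \<in> {ch0 L g, ch1 L g, ch2 L g}" for v c
  proof -
    have "c = 0 \<or> c \<in> R" using op_ok_children(1)[OF op] that by (rule bspec)
    then have "c \<le> g" using R by auto
    then show ?thesis using agree[of c] unfolding table_from_def by simp
  qed
  have ends: "ex L' e = ex L e" "ey L' e = ey L e" if "e \<in> R" for e
    using agree[of e] that R by auto
  have g: "ex L' g = ex L g" "ey L' g = ey L g" "etab L' g = etab L g" "kind L' g = kind L g"
    "vtx L' g = vtx L g" "ch0 L' g = ch0 L g" "ch1 L' g = ch1 L g" "ch2 L' g = ch2 L g"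
    using agree[of g] by simp_all
  have el: "elim_ok n L' R g \<longleftrightarrow> elim_ok n L R g"
    unfolding elim_ok_def g at using ends by (simp cong: ball_cong)
  have me: "merge_ok n L' R g \<longleftrightarrow> merge_ok n L R g"
    unfolding merge_ok_def g at ..
  have z: "etab L' 0 = etab L 0" using agree[of 0] by simp
  show ?thesis
    using op unfolding op_ok_def el me g z by (simp add: tf)
qed

lemma new_link_sel [simp]:
  fixes \<sigma> :: machine
  defines "g \<equiv> Suc (rcnt \<sigma>)"
  shows "rcnt (new_link n k c0 c1 c2 x y \<sigma>) = g"
    "ex (new_link n k c0 c1 c2 x y \<sigma>) = (ex \<sigma>)(g := x)"
    "ey (new_link n k c0 c1 c2 x y \<sigma>) = (ey \<sigma>)(g := y)"
    "kind (new_link n k c0 c1 c2 x y \<sigma>) = (kind \<sigma>)(g := k)"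
    "vtx (new_link n k c0 c1 c2 x y \<sigma>) = (vtx \<sigma>)(g := cur \<sigma>)"
    "ch0 (new_link n k c0 c1 c2 x y \<sigma>) = (ch0 \<sigma>)(g := c0)"
    "ch1 (new_link n k c0 c1 c2 x y \<sigma>) = (ch1 \<sigma>)(g := c1)"
    "ch2 (new_link n k c0 c1 c2 x y \<sigma>) = (ch2 \<sigma>)(g := c2)"
    "etab (new_link n k c0 c1 c2 x y \<sigma>) = (etab \<sigma>)(g := combine k
      (table_from \<sigma> (cur \<sigma>) c0) (table_from \<sigma> (cur \<sigma>) c1) (table_from \<sigma> (cur \<sigma>) c2))"
    "rdead (new_link n k c0 c1 c2 x y \<sigma>) = rdead \<sigma> \<union> {c0, c1, c2}"
    "vdead (new_link n k c0 c1 c2 x y \<sigma>) = vdead \<sigma>"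
    "adj (new_link n k c0 c1 c2 x y \<sigma>) =
       push (Suc n) y (push (Suc n) x (push y g (push x g (adj \<sigma>))))"
    "cur (new_link n k c0 c1 c2 x y \<sigma>) = cur \<sigma>"
    "s0 (new_link n k c0 c1 c2 x y \<sigma>) = s0 \<sigma>" "s1 (new_link n k c0 c1 c2 x y \<sigma>) = s1 \<sigma>"
    "s2 (new_link n k c0 c1 c2 x y \<sigma>) = s2 \<sigma>" "p1 (new_link n k c0 c1 c2 x y \<sigma>) = p1 \<sigma>"
    "p2 (new_link n k c0 c1 c2 x y \<sigma>) = p2 \<sigma>" "go (new_link n k c0 c1 c2 x y \<sigma>) = go \<sigma>"
    "feas (new_link n k c0 c1 c2 x y \<sigma>) = (feas \<sigma> \<and> combine k
      (table_from \<sigma> (cur \<sigma>) c0) (table_from \<sigma> (cur \<sigma>) c1) (table_from \<sigma> (cur \<sigma>) c2) \<noteq> {})"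
  unfolding new_link_def Let_def g_def by simp_all

lemma close_sel [simp]:
  "rcnt (close n e \<sigma>) = rcnt \<sigma>" "ex (close n e \<sigma>) = ex \<sigma>" "ey (close n e \<sigma>) = ey \<sigma>"
  "kind (close n e \<sigma>) = kind \<sigma>" "vtx (close n e \<sigma>) = vtx \<sigma>" "etab (close n e \<sigma>) = etab \<sigma>"
  "ch0 (close n e \<sigma>) = ch0 \<sigma>" "ch1 (close n e \<sigma>) = ch1 \<sigma>" "ch2 (close n e \<sigma>) = ch2 \<sigma>"
  "rdead (close n e \<sigma>) = rdead \<sigma>" "vdead (close n e \<sigma>) = vdead \<sigma>"
  "cur (close n e \<sigma>) = n" "go (close n e \<sigma>) = go \<sigma>" "feas (close n e \<sigma>) = feas \<sigma>"
  "adj (close n e \<sigma>) = push (cur \<sigma>) (s2 \<sigma>) (push (cur \<sigma>) (s1 \<sigma>) (push (cur \<sigma>) (s0 \<sigma>)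
     (push (cur \<sigma>) e (adj \<sigma>))))"
  unfolding close_def by simp_all

lemma set_push [simp]: "set (push v x a w) = (if w = v then insert x (set (a w)) else set (a w))"
  by (simp add: push_def)

lemma count_push [simp]:
  "count_list (push v x a w) e = of_bool (w = v \<and> x = e) + count_list (a w) e"
  by (simp add: push_def)

lemma length_push: "length (push v x a w) = of_bool (w = v) + length (a w)"
  by (simp add: push_def)

lemma sum_length_push:
  "(\<Sum>w\<le>(n::nat). length (push v x a w)) = of_bool (v \<le> n) + (\<Sum>w\<le>n. length (a w))"
  by (simp add: length_push sum.distrib of_bool_def)

lemma live_eqI:
  assumes "ch0 L = ch0 L'" "ch1 L = ch1 L'" "ch2 L = ch2 L'"
  shows "live L g = live L' g"
  using assms by (intro live_cong) simp

lemma live_new_link: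
  fixes \<sigma> :: machine
  shows "h \<le> rcnt \<sigma> \<Longrightarrow> live (new_link n k c0 c1 c2 x y \<sigma>) h = live \<sigma> h"
    "live (new_link n k c0 c1 c2 x y \<sigma>) (Suc (rcnt \<sigma>)) = insert (Suc (rcnt \<sigma>)) (links \<sigma> - {c0, c1, c2})"
proof -
  show a: "live (new_link n k c0 c1 c2 x y \<sigma>) h = live \<sigma> h" if "h \<le> rcnt \<sigma>" for h
    using that by (intro live_cong) auto
  show "live (new_link n k c0 c1 c2 x y \<sigma>) (Suc (rcnt \<sigma>)) = insert (Suc (rcnt \<sigma>)) (links \<sigma> - {c0, c1, c2})"
    using a[OF order_refl] by (simp add: after_op_def)
qed

lemma log_ok_new_link:
  fixes \<sigma> :: machine
  assumes ok: "log_ok n m \<sigma>" and v: "cur \<sigma> < n"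
    and op: "op_ok n (new_link n k c0 c1 c2 x y \<sigma>) (links \<sigma>) (Suc (rcnt \<sigma>))"
    and k: "k = 0 \<Longrightarrow> (x = n \<longrightarrow> c1 = 0) \<and> (y = n \<longrightarrow> c2 = 0)"
  shows "log_ok n m (new_link n k c0 c1 c2 x y \<sigma>)"
proof -
  let ?\<tau> = "new_link n k c0 c1 c2 x y \<sigma>"
  have old: "op_ok n ?\<tau> (live ?\<tau> (g - 1)) g" if "m < g" "g \<le> rcnt \<sigma>" for g
  proof -
    have "op_ok n ?\<tau> (live \<sigma> (g - 1)) g"
    proof (rule op_ok_cong)
      show "op_ok n \<sigma> (live \<sigma> (g - 1)) g" using ok that unfolding log_ok_def by blast
      show "live \<sigma> (g - 1) \<subseteq> {..g}" using live_subset[of \<sigma> "g - 1"] by fastforce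
    qed (use that in auto)
    moreover have "live ?\<tau> (g - 1) = live \<sigma> (g - 1)" by (rule live_new_link(1)) (use that in simp)
    ultimately show ?thesis by (simp only:)
  qed
  have new: "op_ok n ?\<tau> (live ?\<tau> (Suc (rcnt \<sigma>) - 1)) (Suc (rcnt \<sigma>))"
    using op live_new_link(1)[of "rcnt \<sigma>" \<sigma>] by (simp only: diff_Suc_1 order_refl)
  have feas: "feas ?\<tau> \<longleftrightarrow> (\<forall>g. m < g \<and> g \<le> rcnt ?\<tau> \<longrightarrow> etab ?\<tau> g \<noteq> {})"
    using ok unfolding log_ok_def by (auto simp: le_Suc_eq)
  show ?thesis unfolding log_ok_def
  proof (intro conjI)
    show "\<forall>g. m < g \<and> g \<le> rcnt ?\<tau> \<longrightarrow> op_ok n ?\<tau> (live ?\<tau> (g - 1)) g \<and> vtx ?\<tau> g < n \<and>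
        (kind ?\<tau> g = 0 \<longrightarrow> (ex ?\<tau> g = n \<longrightarrow> ch1 ?\<tau> g = 0) \<and> (ey ?\<tau> g = n \<longrightarrow> ch2 ?\<tau> g = 0))"
    proof (intro allI impI)
      fix g assume g: "m < g \<and> g \<le> rcnt ?\<tau>"
      show "op_ok n ?\<tau> (live ?\<tau> (g - 1)) g \<and> vtx ?\<tau> g < n \<and>
        (kind ?\<tau> g = 0 \<longrightarrow> (ex ?\<tau> g = n \<longrightarrow> ch1 ?\<tau> g = 0) \<and> (ey ?\<tau> g = n \<longrightarrow> ch2 ?\<tau> g = 0))"
      proof (cases "g = Suc (rcnt \<sigma>)")
        case True
        then show ?thesis using new v k by simp
      next
        case False
        then have "g \<le> rcnt \<sigma>" using g by simp
        then show ?thesis using old[of g] g False ok unfolding log_ok_def by simp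
      qed
    qed
  qed (use ok feas in \<open>auto simp: log_ok_def\<close>)
qed

lemma op_ok_eqI:
  assumes "ex L = ex L'" "ey L = ey L'" "etab L = etab L'" "kind L = kind L'" "vtx L = vtx L'"
    "ch0 L = ch0 L'" "ch1 L = ch1 L'" "ch2 L = ch2 L'"
  shows "op_ok n L R g \<longleftrightarrow> op_ok n L' R g"
  using assms unfolding op_ok_def elim_ok_def merge_ok_def attached_def table_from_def by simp

text \<open>Most steps only move list entries and slots; for them the bulk of the invariant is
  inherited through this relation.\<close>

definition same_log :: "machine \<Rightarrow> machine \<Rightarrow> bool" where
  "same_log \<sigma> \<tau> \<longleftrightarrow> ex \<sigma> = ex \<tau> \<and> ey \<sigma> = ey \<tau> \<and> etab \<sigma> = etab \<tau> \<and> kind \<sigma> = kind \<tau> \<and> vtx \<sigma> = vtx \<tau> \<and>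
    ch0 \<sigma> = ch0 \<tau> \<and> ch1 \<sigma> = ch1 \<tau> \<and> ch2 \<sigma> = ch2 \<tau> \<and> rcnt \<sigma> = rcnt \<tau> \<and> feas \<sigma> = feas \<tau> \<and>
    rdead \<sigma> = rdead \<tau>"

lemma same_log_live: "same_log \<sigma> \<tau> \<Longrightarrow> live \<sigma> g = live \<tau> g"
  unfolding same_log_def by (intro live_eqI) simp_all

lemma same_log_log_ok: "same_log \<sigma> \<tau> \<Longrightarrow> log_ok n m \<sigma> = log_ok n m \<tau>"
  using same_log_live[of \<sigma> \<tau>] op_ok_eqI[of \<sigma> \<tau>] unfolding same_log_def log_ok_def by simp

lemma same_log_core: "same_log \<sigma> \<tau> \<Longrightarrow> vdead \<sigma> = vdead \<tau> \<Longrightarrow> core n m \<sigma> = core n m \<tau>"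
  using same_log_live[of \<sigma> \<tau>] unfolding same_log_def core_def alive_def link_graph_def by simp

lemma same_log_attached: "same_log \<sigma> \<tau> \<Longrightarrow> attached \<sigma> n R v c p = attached \<tau> n R v c p"
  unfolding same_log_def attached_def by simp

lemma attached_zero [simp]: "attached L n R v 0 n \<longleftrightarrow> v \<noteq> n"
  by (simp add: attached_def)

lemma link_graph_iff:
  "{u, w} \<in> link_graph n L R \<longleftrightarrow> (\<exists>e\<in>R. {ex L e, ey L e} = {u, w}) \<and> u < n \<and> w < n"
  unfolding link_graph_def by (auto simp: doubleton_eq_iff)

lemma live_pos: "0 \<notin> live L g"
  using live_subset[of L g] by auto

lemma live_gt0: "e \<in> live L g \<Longrightarrow> 0 < e"
  using live_subset[of L g] by auto

lemma live_le: "e \<in> live L g \<Longrightarrow> e \<le> g"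
  using live_subset[of L g] by auto

lemma op_ok_new_link:
  fixes \<sigma> :: machine
  assumes lo: "log_ok n m \<sigma>"
    and c: "if k = 0 then cur \<sigma> < n \<and> attached \<sigma> n (links \<sigma>) (cur \<sigma>) c0 n \<and>
        attached \<sigma> n (links \<sigma>) (cur \<sigma>) c1 x \<and> attached \<sigma> n (links \<sigma>) (cur \<sigma>) c2 y \<and>
        (c0 = c1 \<longrightarrow> c0 = 0) \<and> (c0 = c2 \<longrightarrow> c0 = 0) \<and> (c1 = c2 \<longrightarrow> c1 = 0) \<and>
        (\<forall>e\<in>links \<sigma>. ex \<sigma> e = cur \<sigma> \<or> ey \<sigma> e = cur \<sigma> \<longrightarrow> e \<in> {c0, c1, c2})
      else x = cur \<sigma> \<and> c0 = 0 \<and> c1 \<noteq> 0 \<and> c2 \<noteq> 0 \<and> c1 \<noteq> c2 \<and>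
        attached \<sigma> n (links \<sigma>) (cur \<sigma>) c1 y \<and> attached \<sigma> n (links \<sigma>) (cur \<sigma>) c2 y"
  shows "op_ok n (new_link n k c0 c1 c2 x y \<sigma>) (links \<sigma>) (Suc (rcnt \<sigma>))"
proof -
  let ?\<tau> = "new_link n k c0 c1 c2 x y \<sigma>" and ?g = "Suc (rcnt \<sigma>)"
  have at: "attached ?\<tau> n (links \<sigma>) v e p \<longleftrightarrow> attached \<sigma> n (links \<sigma>) v e p" for v e p
    by (rule attached_cong[of "rcnt \<sigma>"]) (use live_le in auto)
  have le: "e \<le> rcnt \<sigma>" if "attached \<sigma> n (links \<sigma>) v e p" for v e p
    using attached_in[OF that] live_le by auto
  have cs: "c0 \<le> rcnt \<sigma>" "c1 \<le> rcnt \<sigma>" "c2 \<le> rcnt \<sigma>"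
    using c le by (auto split: if_splits)
  have tf: "table_from ?\<tau> v e = table_from \<sigma> v e" if "e \<le> rcnt \<sigma>" for v e
    using that unfolding table_from_def by simp
  have ends: "ex ?\<tau> e = ex \<sigma> e" "ey ?\<tau> e = ey \<sigma> e" if "e \<in> links \<sigma>" for e
    using live_le[OF that] by auto
  have g: "?g \<notin> links \<sigma>" using live_le[of ?g \<sigma> "rcnt \<sigma>"] by auto
  have triv: "etab \<sigma> 0 = trivial_table" using lo unfolding log_ok_def by blast
  have "if k = 0 then elim_ok n ?\<tau> (links \<sigma>) ?g else merge_ok n ?\<tau> (links \<sigma>) ?g"
    using c ends unfolding elim_ok_def merge_ok_def at by (simp split: if_splits cong: ball_cong)
  then show ?thesis
    unfolding op_ok_def using g triv cs by (simp add: live_pos finite_live tf)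
qed

lemma lists_okI:
  assumes "\<And>w. w \<le> n \<Longrightarrow> set (adj \<sigma> w) \<subseteq> {..rcnt \<sigma>}" "set (adj \<sigma> (Suc n)) \<subseteq> {..n}"
    "\<And>w e. w \<in> alive n \<sigma> \<Longrightarrow> e \<in> links \<sigma> \<Longrightarrow>
        (if w = cur \<sigma> then of_bool (s0 \<sigma> = e) + of_bool (s1 \<sigma> = e) + of_bool (s2 \<sigma> = e) else 0) +
        count_list (adj \<sigma> w) e = of_bool (incident \<sigma> e w)"
  shows "lists_ok n \<sigma>"
  using assms unfolding lists_ok_def by blast

section \<open>Preservation of the invariant by one machine step\<close>

locale machine_inv =
  fixes n m :: nat and \<sigma> :: machine
  assumes inv: "valid n m \<sigma>"
begin

lemma log: "log_ok n m \<sigma>" and core: "core n m \<sigma>" and lists: "lists_ok n \<sigma>"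
  and slots: "slots_ok n \<sigma>" and work: "work_ok n \<sigma>"
  using inv unfolding valid_def by auto

lemma inv_sameI:
  assumes "same_log \<tau> \<sigma>" "vdead \<tau> = vdead \<sigma>" "lists_ok n \<tau>" "slots_ok n \<tau>" "work_ok n \<tau>"
  shows "valid n m \<tau>"
  using assms log core same_log_log_ok[OF assms(1)] same_log_core[OF assms(1,2)] unfolding valid_def by simp

lemma dead_iff: "e \<le> rcnt \<sigma> \<Longrightarrow> e \<in> rdead \<sigma> \<longleftrightarrow> e \<notin> links \<sigma>"
  using core unfolding core_def by blast

lemma link_ends:
  assumes "e \<in> links \<sigma>"
  shows "ex \<sigma> e \<in> insert n (alive n \<sigma>)" "ey \<sigma> e \<in> insert n (alive n \<sigma>)" "ex \<sigma> e = ey \<sigma> e \<Longrightarrow> ex \<sigma> e = n"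
  using core assms unfolding core_def by blast+

lemma count:
  assumes "w \<in> alive n \<sigma>" "e \<in> links \<sigma>"
  shows "(if w = cur \<sigma> then of_bool (s0 \<sigma> = e) + of_bool (s1 \<sigma> = e) + of_bool (s2 \<sigma> = e) else 0) +
        count_list (adj \<sigma> w) e = of_bool (incident \<sigma> e w)"
  using lists assms unfolding lists_ok_def by blast

lemma alive_lt: "w \<in> alive n \<sigma> \<Longrightarrow> w < n"
  unfolding alive_def by simp

lemma alive_Suc: "w \<in> alive n \<sigma> \<Longrightarrow> w \<noteq> n \<and> w \<noteq> Suc n"
  unfolding alive_def by auto

end

locale machine_open = machine_inv +
  fixes v :: nat
  assumes cur: "cur \<sigma> = v" and vn: "v \<noteq> n"
begin

lemma v_alive: "v \<in> alive n \<sigma>"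
  and at0: "attached \<sigma> n (links \<sigma>) v (s0 \<sigma>) n"
  and at1: "attached \<sigma> n (links \<sigma>) v (s1 \<sigma>) (p1 \<sigma>)"
  and at2: "attached \<sigma> n (links \<sigma>) v (s2 \<sigma>) (p2 \<sigma>)"
  and p1n: "p1 \<sigma> = n \<Longrightarrow> s1 \<sigma> = 0" and p2n: "p2 \<sigma> = n \<Longrightarrow> s2 \<sigma> = 0"
  and p12: "p1 \<sigma> = p2 \<sigma> \<Longrightarrow> p1 \<sigma> = n" and p1p2: "p1 \<sigma> = n \<Longrightarrow> p2 \<sigma> = n"
  using slots cur vn unfolding slots_ok_def by auto

lemma v_lt: "v < n"
  using v_alive alive_lt by blast

lemma count_v:
  "e \<in> links \<sigma> \<Longrightarrow> of_bool (s0 \<sigma> = e) + of_bool (s1 \<sigma> = e) + of_bool (s2 \<sigma> = e) +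
     count_list (adj \<sigma> v) e = of_bool (incident \<sigma> e v)"
  using count[OF v_alive] cur by simp

lemma slot_target:
  assumes "attached \<sigma> n (links \<sigma>) v c p" "c \<noteq> 0"
  shows "p \<in> insert n (alive n \<sigma>)" "c \<in> links \<sigma>" "{ex \<sigma> c, ey \<sigma> c} = {v, p}" "p \<noteq> v"
proof -
  show c: "c \<in> links \<sigma>" "{ex \<sigma> c, ey \<sigma> c} = {v, p}" "p \<noteq> v"
    using assms unfolding attached_def by auto
  then show "p \<in> insert n (alive n \<sigma>)" using link_ends[OF c(1)] by (auto simp: doubleton_eq_iff)
qed

lemma slots_le: "s0 \<sigma> \<le> rcnt \<sigma>" "s1 \<sigma> \<le> rcnt \<sigma>" "s2 \<sigma> \<le> rcnt \<sigma>"
  using attached_in[OF at0] attached_in[OF at1] attached_in[OF at2] live_le by auto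

text \<open>A nonzero link held by two slots would be counted twice, against the exact count in
  \<open>lists_ok\<close>.\<close>

lemma slots_distinct:
  "s0 \<sigma> = s1 \<sigma> \<Longrightarrow> s0 \<sigma> = 0" "s0 \<sigma> = s2 \<sigma> \<Longrightarrow> s0 \<sigma> = 0" "s1 \<sigma> = s2 \<sigma> \<Longrightarrow> s1 \<sigma> = 0"
proof -
  have "s0 \<sigma> \<noteq> 0 \<Longrightarrow> s0 \<sigma> \<in> links \<sigma>" "s1 \<sigma> \<noteq> 0 \<Longrightarrow> s1 \<sigma> \<in> links \<sigma>"
    using slot_target(2) at0 at1 by blast+
  moreover have le1: "(of_bool P :: nat) \<le> 1" for P by simp
  ultimately show "s0 \<sigma> = s1 \<sigma> \<Longrightarrow> s0 \<sigma> = 0" "s0 \<sigma> = s2 \<sigma> \<Longrightarrow> s0 \<sigma> = 0" "s1 \<sigma> = s2 \<sigma> \<Longrightarrow> s1 \<sigma> = 0"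
    using count_v[of "s0 \<sigma>"] count_v[of "s1 \<sigma>"] le1[of "incident \<sigma> (s0 \<sigma>) v"] le1[of "incident \<sigma> (s1 \<sigma>) v"] by fastforce+
qed

end

locale machine_pop = machine_open +
  fixes e :: nat and es :: "nat list"
  assumes adj_v: "adj \<sigma> v = e # es"
begin

abbreviation "\<tau> \<equiv> \<sigma>\<lparr>adj := (adj \<sigma>)(v := es)\<rparr>"

lemma e_le: "e \<le> rcnt \<sigma>" and es_le: "set es \<subseteq> {..rcnt \<sigma>}"
  using lists v_lt adj_v unfolding lists_ok_def by (metis less_imp_le list.set_intros(1) subsetD atMost_iff,
    metis less_imp_le set_subset_Cons subset_trans)

lemma count_pop:
  assumes "w \<in> alive n \<sigma>" "f \<in> links \<sigma>"
  shows "of_bool (w = v) * (of_bool (s0 \<sigma> = f) + of_bool (s1 \<sigma> = f) + of_bool (s2 \<sigma> = f) + of_bool (e = f)) +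
    count_list (adj \<tau> w) f = of_bool (incident \<sigma> f w)"
  using count[OF assms] adj_v cur by (cases "w = v"; cases "e = f") auto

lemma adj_le: "w \<le> n \<Longrightarrow> set (adj \<tau> w) \<subseteq> {..rcnt \<sigma>}"
  using lists es_le unfolding lists_ok_def by auto

lemma adj_work [simp]: "adj \<tau> (Suc n) = adj \<sigma> (Suc n)"
  using v_lt by simp

lemma work_le: "set (adj \<sigma> (Suc n)) \<subseteq> {..n}"
  using lists unfolding lists_ok_def by blast

lemma same_log_pop: "same_log \<tau> \<sigma>"
  unfolding same_log_def by simp

lemma go_open: "go \<sigma>"
  using work cur vn unfolding work_ok_def by auto

text \<open>Common part of all steps that pop one entry and create no link: live links must keep
  their number of occurrences, and leaving the scanned vertex without queueing it has to be
  justified by three neighbors.\<close>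

lemma inv_pop_sameI:
  assumes sl: "same_log \<rho> \<sigma>" and vd: "vdead \<rho> = vdead \<sigma>" and go: "go \<rho>"
    and adj: "\<And>w. w \<le> n \<Longrightarrow> set (adj \<rho> w) \<subseteq> {..rcnt \<sigma>}" and adjW: "adj \<rho> (Suc n) = adj \<sigma> (Suc n)"
    and cnt: "\<And>w f. w \<in> alive n \<sigma> \<Longrightarrow> f \<in> links \<sigma> \<Longrightarrow>
        (if w = cur \<rho> then of_bool (s0 \<rho> = f) + of_bool (s1 \<rho> = f) + of_bool (s2 \<rho> = f) else 0) +
        count_list (adj \<rho> w) f =
        of_bool (w = v) * (of_bool (s0 \<sigma> = f) + of_bool (s1 \<sigma> = f) + of_bool (s2 \<sigma> = f) + of_bool (e = f)) +
        count_list (adj \<tau> w) f"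
    and slots: "slots_ok n \<rho>"
    and wk: "cur \<rho> \<noteq> v \<Longrightarrow> 3 \<le> card {u. {u, v} \<in> link_graph n \<sigma> (links \<sigma>)}"
  shows "valid n m \<rho>"
proof (rule inv_sameI[OF sl vd _ slots])
  have al: "alive n \<rho> = alive n \<sigma>" unfolding alive_def vd ..
  have li: "links \<rho> = links \<sigma>" using same_log_live[OF sl] sl unfolding same_log_def by simp
  have lg: "link_graph n \<rho> R = link_graph n \<sigma> R" for R using sl unfolding same_log_def link_graph_def by simp
  have inc: "incident \<rho> f w = incident \<sigma> f w" for f w using sl unfolding same_log_def incident_def by simp
  have rc: "rcnt \<rho> = rcnt \<sigma>" using sl unfolding same_log_def by simp
  show "lists_ok n \<rho>"
  proof (rule lists_okI)
    fix w f assume "w \<in> alive n \<rho>" "f \<in> links \<rho>"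
    then have wf: "w \<in> alive n \<sigma>" "f \<in> links \<sigma>" using al li by auto
    show "(if w = cur \<rho> then of_bool (s0 \<rho> = f) + of_bool (s1 \<rho> = f) + of_bool (s2 \<rho> = f) else 0) +
        count_list (adj \<rho> w) f = of_bool (incident \<rho> f w)"
      unfolding inc cnt[OF wf] by (rule count_pop[OF wf])
  qed (use adj adjW work_le rc in auto)
  have "cur \<rho> = v \<or> 3 \<le> card {u. {u, v} \<in> link_graph n \<sigma> (links \<sigma>)}" using wk by blast
  then show "work_ok n \<rho>"
    using work cur vn go unfolding work_ok_def al li lg adjW by metis
qed

lemma inv_skip:
  assumes "e \<in> rdead \<sigma>"
  shows "valid n m \<tau>"
proof (rule inv_pop_sameI)
  have e: "e \<notin> links \<sigma>" using assms dead_iff e_le by blast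
  show "slots_ok n \<tau>"
    using slots unfolding slots_ok_def same_log_live[OF same_log_pop] same_log_attached[OF same_log_pop]
    by (simp add: alive_def)
  show "(if w = cur \<tau> then of_bool (s0 \<tau> = f) + of_bool (s1 \<tau> = f) + of_bool (s2 \<tau> = f) else 0) +
        count_list (adj \<tau> w) f =
        of_bool (w = v) * (of_bool (s0 \<sigma> = f) + of_bool (s1 \<sigma> = f) + of_bool (s2 \<sigma> = f) + of_bool (e = f)) +
        count_list (adj \<tau> w) f" if "f \<in> links \<sigma>" for w f
    using that e cur by auto
qed (use same_log_pop adj_le cur go_open v_lt in auto)

end

locale machine_link = machine_pop +
  fixes y :: nat
  assumes e_live: "e \<notin> rdead \<sigma>" and y_def: "y = (if ex \<sigma> e = v then ey \<sigma> e else ex \<sigma> e)"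
begin

lemma e_link: "e \<in> links \<sigma>"
  using e_live dead_iff e_le by blast

lemma e_pos: "e \<noteq> 0"
  using e_link live_pos by metis

text \<open>The popped occurrence already uses up the only one allowed, which excludes the slots and
  forces incidence with \<open>v\<close>.\<close>

lemma e_count: "s0 \<sigma> \<noteq> e" "s1 \<sigma> \<noteq> e" "s2 \<sigma> \<noteq> e" "incident \<sigma> e v"
proof -
  have le1: "(of_bool P :: nat) \<le> 1" for P by simp
  have "of_bool (s0 \<sigma> = e) + of_bool (s1 \<sigma> = e) + of_bool (s2 \<sigma> = e) + 1 \<le> (of_bool (incident \<sigma> e v) :: nat)"
    using count_pop[OF v_alive e_link] by simp
  then show "s0 \<sigma> \<noteq> e" "s1 \<sigma> \<noteq> e" "s2 \<sigma> \<noteq> e" "incident \<sigma> e v"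
    by (auto split: if_splits simp: of_bool_def)
qed

lemma e_ends: "{ex \<sigma> e, ey \<sigma> e} = {v, y}" "y \<noteq> v" "y \<in> insert n (alive n \<sigma>)"
  using e_count(4) link_ends[OF e_link] vn unfolding incident_def y_def by auto

lemma y_le: "y \<le> n"
  using e_ends(3) unfolding alive_def by auto

lemma e_attached: "attached \<sigma> n (links \<sigma>) v e y"
  using e_link e_pos e_ends unfolding attached_def by auto

lemma inv_fill0:
  assumes "y = n" "s0 \<sigma> = 0"
  shows "valid n m (\<tau>\<lparr>s0 := e\<rparr>)"
proof (rule inv_pop_sameI)
  show sl: "same_log (\<tau>\<lparr>s0 := e\<rparr>) \<sigma>" unfolding same_log_def by simp
  show "slots_ok n (\<tau>\<lparr>s0 := e\<rparr>)"
    using slots e_attached assms cur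
    unfolding slots_ok_def same_log_live[OF sl] same_log_attached[OF sl] by (simp add: alive_def)
qed (use adj_le assms cur go_open v_lt in \<open>auto dest: live_gt0\<close>)

lemma inv_fill1:
  assumes "y \<noteq> n" "p1 \<sigma> = n"
  shows "valid n m (\<tau>\<lparr>s1 := e, p1 := y\<rparr>)"
proof (rule inv_pop_sameI)
  show sl: "same_log (\<tau>\<lparr>s1 := e, p1 := y\<rparr>) \<sigma>" unfolding same_log_def by simp
  show "slots_ok n (\<tau>\<lparr>s1 := e, p1 := y\<rparr>)"
    using slots e_attached assms cur p1p2
    unfolding slots_ok_def same_log_live[OF sl] same_log_attached[OF sl] by (simp add: alive_def)
qed (use adj_le assms cur go_open v_lt p1n in \<open>auto dest: live_gt0\<close>)

lemma inv_fill2: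
  assumes "y \<noteq> n" "p1 \<sigma> \<noteq> n" "p1 \<sigma> \<noteq> y" "p2 \<sigma> = n"
  shows "valid n m (\<tau>\<lparr>s2 := e, p2 := y\<rparr>)"
proof (rule inv_pop_sameI)
  show sl: "same_log (\<tau>\<lparr>s2 := e, p2 := y\<rparr>) \<sigma>" unfolding same_log_def by simp
  show "slots_ok n (\<tau>\<lparr>s2 := e, p2 := y\<rparr>)"
    using slots e_attached assms cur
    unfolding slots_ok_def same_log_live[OF sl] same_log_attached[OF sl] by (simp add: alive_def)
qed (use adj_le assms cur go_open v_lt p2n in \<open>auto dest: live_gt0\<close>)

lemma slot_nbr:
  assumes "attached \<sigma> n (links \<sigma>) v c p" "p \<noteq> n"
  shows "{p, v} \<in> link_graph n \<sigma> (links \<sigma>)" "p < n"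
proof -
  have c: "c \<noteq> 0" using assms unfolding attached_def by (auto split: if_splits)
  note s = slot_target[OF assms(1) c]
  show "p < n" using s(1) assms(2) alive_lt by blast
  then show "{p, v} \<in> link_graph n \<sigma> (links \<sigma>)"
    using s v_lt unfolding link_graph_iff by (auto simp: insert_commute)
qed

lemma inv_third:
  assumes "y \<noteq> n" "p1 \<sigma> \<noteq> n" "p1 \<sigma> \<noteq> y" "p2 \<sigma> \<noteq> n" "p2 \<sigma> \<noteq> y"
  shows "valid n m (close n e \<tau>)"
proof (rule inv_pop_sameI)
  show sl: "same_log (close n e \<tau>) \<sigma>" unfolding same_log_def by simp
  show "slots_ok n (close n e \<tau>)" unfolding slots_ok_def by simp
  show "3 \<le> card {u. {u, v} \<in> link_graph n \<sigma> (links \<sigma>)}"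
  proof -
    have "{p1 \<sigma>, p2 \<sigma>, y} \<subseteq> {u. {u, v} \<in> link_graph n \<sigma> (links \<sigma>)}"
      using slot_nbr[OF at1] slot_nbr[OF at2] slot_nbr[OF e_attached] assms by simp
    moreover have "finite {u. {u, v} \<in> link_graph n \<sigma> (links \<sigma>)}"
      by (rule finite_subset[of _ "{..<n}"]) (auto simp: link_graph_iff)
    ultimately have "card {p1 \<sigma>, p2 \<sigma>, y} \<le> card {u. {u, v} \<in> link_graph n \<sigma> (links \<sigma>)}"
      by (intro card_mono)
    moreover have "p1 \<sigma> \<noteq> p2 \<sigma>" using assms p12 by metis
    then have "card {p1 \<sigma>, p2 \<sigma>, y} = 3" using assms by simp
    ultimately show ?thesis by simp
  qed
  show "set (adj (close n e \<tau>) w) \<subseteq> {..rcnt \<sigma>}" if "w \<le> n" for w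
    using adj_le[OF that] slots_le e_le cur by auto
  show "(if w = cur (close n e \<tau>) then of_bool (s0 (close n e \<tau>) = f) + of_bool (s1 (close n e \<tau>) = f) + of_bool (s2 (close n e \<tau>) = f) else 0) +
        count_list (adj (close n e \<tau>) w) f =
        of_bool (w = v) * (of_bool (s0 \<sigma> = f) + of_bool (s1 \<sigma> = f) + of_bool (s2 \<sigma> = f) + of_bool (e = f)) +
        count_list (adj \<tau> w) f" if "w \<in> alive n \<sigma>" for w f
    using alive_Suc[OF that] cur by simp
qed (use cur go_open v_lt in \<open>auto simp: push_def\<close>)

lemma inv_merge:
  assumes at: "attached \<sigma> n (links \<sigma>) v s y" and s: "s \<noteq> 0" "s \<in> {s0 \<sigma>, s1 \<sigma>, s2 \<sigma>}"
  shows "valid n m (merge_links n s e y \<tau>)"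
proof -
  let ?g = "Suc (rcnt \<sigma>)"
  define \<rho> where "\<rho> = new_link n 1 0 s e v y \<tau>"
  have \<rho>: "merge_links n s e y \<tau> = close n e \<rho>" unfolding merge_links_def \<rho>_def using cur by simp
  have sl: "same_log (close n e \<rho>) \<rho>" unfolding same_log_def by simp
  have se: "s \<noteq> e" using s e_count by auto
  have li: "links \<tau> = links \<sigma>" using same_log_live[OF same_log_pop] by simp
  have op: "op_ok n \<rho> (links \<tau>) (Suc (rcnt \<tau>))" unfolding \<rho>_def
    by (rule op_ok_new_link[of n m])
      (use log same_log_log_ok[OF same_log_pop] same_log_attached[OF same_log_pop] li
        at e_attached s se e_pos cur in simp_all)
  have lo: "log_ok n m \<rho>" unfolding \<rho>_def
    by (rule log_ok_new_link) (use log same_log_log_ok[OF same_log_pop] v_lt cur op in \<open>simp_all add: \<rho>_def\<close>)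
  have R: "links \<rho> = insert ?g (links \<sigma> - {s, e})"
    using live_new_link(2)[of n 1 0 s e v y \<tau>] li live_pos[of \<sigma>] unfolding \<rho>_def by simp
  have R': "links (close n e \<rho>) = links \<rho>" using same_log_live[OF sl] by simp
  have sel: "ex \<rho> = (ex \<sigma>)(?g := v)" "ey \<rho> = (ey \<sigma>)(?g := y)" "rcnt \<rho> = ?g"
    "kind \<rho> = (kind \<sigma>)(?g := 1)" "vtx \<rho> = (vtx \<sigma>)(?g := v)"
    "rdead \<rho> = rdead \<sigma> \<union> {0, s, e}" "vdead \<rho> = vdead \<sigma>" "go \<rho> = go \<sigma>" "cur \<rho> = v"
    "adj \<rho> = push (Suc n) y (push (Suc n) v (push y ?g (push v ?g (adj \<tau>))))"
    "s0 \<rho> = s0 \<sigma>" "s1 \<rho> = s1 \<sigma>" "s2 \<rho> = s2 \<sigma>"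
    unfolding \<rho>_def using cur by simp_all
  have gle: "f \<noteq> ?g" if "f \<in> links \<sigma>" for f using live_le[OF that] by auto
  have al: "alive n \<rho> = alive n \<sigma>" unfolding alive_def sel ..
  have al': "alive n (close n e \<rho>) = alive n \<sigma>" unfolding alive_def by (simp add: sel)
  have sle: "s \<le> rcnt \<sigma>" using s slots_le by auto
  \<comment> \<open>The merged link joins the same vertices as its two children, so the simple graph
    below the links is unchanged, and with it outerplanarity and all degrees.\<close>
  have gr: "link_graph n \<rho> (links \<rho>) = link_graph n \<sigma> (links \<sigma>)"
  proof (intro equalityI subsetI)
    fix f assume "f \<in> link_graph n \<rho> (links \<rho>)"
    then obtain h where h: "f = {ex \<rho> h, ey \<rho> h}" "h \<in> links \<rho>" "ex \<rho> h < n" "ey \<rho> h < n"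
      unfolding link_graph_def by blast
    show "f \<in> link_graph n \<sigma> (links \<sigma>)"
    proof (cases "h = ?g")
      case True
      then have f: "f = {v, y}" and yn: "y < n" using h by (simp_all add: sel)
      show ?thesis unfolding f link_graph_iff using e_ends(1) e_link v_lt yn by blast
    next
      case False
      then show ?thesis using h R unfolding link_graph_def by (auto simp: sel)
    qed
  next
    fix f assume "f \<in> link_graph n \<sigma> (links \<sigma>)"
    then obtain h where h: "f = {ex \<sigma> h, ey \<sigma> h}" "h \<in> links \<sigma>" "ex \<sigma> h < n" "ey \<sigma> h < n"
      unfolding link_graph_def by blast
    show "f \<in> link_graph n \<rho> (links \<rho>)"
    proof (cases "h \<in> {s, e}")
      case True
      then have f: "f = {v, y}" using h(1) e_ends slot_target(3)[OF at s(1)] by blast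
      then have "y < n" using h by (auto simp: doubleton_eq_iff)
      moreover have "?g \<in> links \<rho>" "{ex \<rho> ?g, ey \<rho> ?g} = {v, y}" using R by (simp_all add: sel)
      ultimately show ?thesis unfolding f link_graph_iff using v_lt by blast
    next
      case False
      then show ?thesis using h R gle[OF h(2)] unfolding link_graph_def
        by (auto simp: sel intro!: exI[of _ h])
    qed
  qed
  have core': "core n m (close n e \<rho>)" unfolding same_log_core[OF sl close_sel(11)]
  proof (unfold core_def al gr, intro conjI)
    show "\<forall>f\<le>rcnt \<rho>. (f \<in> rdead \<rho>) = (f \<notin> links \<rho>)"
    proof (intro allI impI)
      fix f assume f: "f \<le> rcnt \<rho>"
      have "?g \<notin> rdead \<sigma>" using core unfolding core_def by auto
      then show "(f \<in> rdead \<rho>) = (f \<notin> links \<rho>)"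
        using f dead_iff[of f] R sle e_le s e_pos live_pos[of \<sigma>] by (cases "f = ?g") (auto simp: sel)
    qed
    show "rdead \<rho> \<subseteq> {..rcnt \<rho>}" using core sle e_le unfolding core_def by (auto simp: sel)
    show "\<forall>f\<in>links \<rho>. ex \<rho> f \<in> insert n (alive n \<sigma>) \<and> ey \<rho> f \<in> insert n (alive n \<sigma>) \<and>
        (ex \<rho> f = ey \<rho> f \<longrightarrow> ex \<rho> f = n)"
    proof
      fix f assume f: "f \<in> links \<rho>"
      show "ex \<rho> f \<in> insert n (alive n \<sigma>) \<and> ey \<rho> f \<in> insert n (alive n \<sigma>) \<and> (ex \<rho> f = ey \<rho> f \<longrightarrow> ex \<rho> f = n)"
        using f R link_ends[of f] e_ends v_alive gle[of f] by (cases "f = ?g") (auto simp: sel)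
    qed
    show "\<forall>w<n. w \<in> vdead \<rho> \<longrightarrow> (\<exists>g. m < g \<and> g \<le> rcnt \<rho> \<and> kind \<rho> g = 0 \<and> vtx \<rho> g = w)"
    proof (intro allI impI)
      fix w assume "w < n" "w \<in> vdead \<rho>"
      then obtain g where "m < g \<and> g \<le> rcnt \<sigma> \<and> kind \<sigma> g = 0 \<and> vtx \<sigma> g = w"
        using core unfolding core_def sel by blast
      then show "\<exists>g. m < g \<and> g \<le> rcnt \<rho> \<and> kind \<rho> g = 0 \<and> vtx \<rho> g = w"
        by (intro exI[of _ g]) (auto simp: sel)
    qed
  qed (use core in \<open>auto simp: core_def sel\<close>)
  have lists': "lists_ok n (close n e \<rho>)"
  proof (rule lists_okI)
    fix w f assume "w \<in> alive n (close n e \<rho>)" and "f \<in> links (close n e \<rho>)"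
    then have w: "w \<in> alive n \<sigma>" and f: "f \<in> links \<rho>" using al' R' by simp_all
    have wn: "w \<noteq> n" "w \<noteq> Suc n" using alive_Suc[OF w] by auto
    have "count_list (adj (close n e \<rho>) w) f = of_bool (incident \<rho> f w)"
    proof (cases "f = ?g")
      case True
      \<comment> \<open>The new index is larger than every entry of the old lists, so its only
        occurrences are those just pushed.\<close>
      have "f \<notin> set (adj \<tau> w)" using adj_le[of w] w alive_lt True by force
      then have "count_list (adj \<tau> w) f = 0" by (simp add: count_list_0_iff)
      moreover have "of_bool (w = v) + of_bool (w = y) = (of_bool (incident \<rho> f w) :: nat)"
        using e_ends True by (auto simp: incident_def sel)
      ultimately show ?thesis using True slots_le e_le wn by (simp add: sel)
    next
      case False
      then have f: "f \<in> links \<sigma>" using f R by auto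
      have "incident \<rho> f w = incident \<sigma> f w" using False by (simp add: incident_def sel)
      then show ?thesis using count_pop[OF w f] False wn
        by (cases "w = v") (simp_all add: sel)
    qed
    then show "(if w = cur (close n e \<rho>) then of_bool (s0 (close n e \<rho>) = f) + of_bool (s1 (close n e \<rho>) = f) +
          of_bool (s2 (close n e \<rho>) = f) else 0) +
        count_list (adj (close n e \<rho>) w) f = of_bool (incident (close n e \<rho>) f w)"
      using wn by (simp add: incident_def)
  next
    fix w assume "w \<le> n"
    then show "set (adj (close n e \<rho>) w) \<subseteq> {..rcnt (close n e \<rho>)}"
      using adj_le[of w] slots_le e_le by (auto simp: sel simp del: fun_upd_apply)
  next
    show "set (adj (close n e \<rho>) (Suc n)) \<subseteq> {..n}"
      using work_le v_lt y_le by (auto simp: sel)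
  qed
  \<comment> \<open>The interrupted scan of \<open>v\<close> is no loss: \<open>v\<close> was queued
    again together with the new link.\<close>
  have work': "work_ok n (close n e \<rho>)"
    using work v_lt cur go_open R' gr
    unfolding work_ok_def by (auto simp: sel alive_def link_graph_def)
  have "slots_ok n (close n e \<rho>)" unfolding slots_ok_def by simp
  then show ?thesis unfolding \<rho> valid_def
    using same_log_log_ok[OF sl] lo core' lists' work' by blast
qed

end

context machine_open
begin

lemma inv_eliminate:
  assumes nil: "adj \<sigma> v = []"
  shows "valid n m (eliminate n \<sigma>)"
proof -
  let ?g = "Suc (rcnt \<sigma>)" and ?R = "links \<sigma> - {s0 \<sigma>, s1 \<sigma>, s2 \<sigma>}"
  define \<rho> where "\<rho> = new_link n 0 (s0 \<sigma>) (s1 \<sigma>) (s2 \<sigma>) (p1 \<sigma>) (p2 \<sigma>) \<sigma>"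
  define \<tau> where "\<tau> = eliminate n \<sigma>"
  have \<tau>: "\<tau> = close n 0 (\<rho>\<lparr>vdead := insert v (vdead \<sigma>)\<rparr>)"
    unfolding \<tau>_def eliminate_def \<rho>_def using cur by simp
  have sl: "same_log \<tau> \<rho>" unfolding same_log_def \<tau> by simp
  \<comment> \<open>The list of \<open>v\<close> is exhausted, so the single occurrence of each live
    link at \<open>v\<close> must be a slot.\<close>
  have cover: "f \<in> {s0 \<sigma>, s1 \<sigma>, s2 \<sigma>}" if "f \<in> links \<sigma>" "incident \<sigma> f v" for f
    using count_v[OF that(1)] that(2) nil
    by (cases "s0 \<sigma> = f"; cases "s1 \<sigma> = f"; cases "s2 \<sigma> = f") auto
  have op: "op_ok n \<rho> (links \<sigma>) ?g" unfolding \<rho>_def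
    by (rule op_ok_new_link[OF log])
      (use cur v_lt at0 at1 at2 slots_distinct cover in \<open>simp add: incident_def\<close>)
  have lo: "log_ok n m \<rho>" unfolding \<rho>_def
    by (rule log_ok_new_link[OF log]) (use v_lt cur op p1n p2n in \<open>simp_all add: \<rho>_def\<close>)
  have sel: "ex \<tau> = (ex \<sigma>)(?g := p1 \<sigma>)" "ey \<tau> = (ey \<sigma>)(?g := p2 \<sigma>)" "rcnt \<tau> = ?g"
    "kind \<tau> = (kind \<sigma>)(?g := 0)" "vtx \<tau> = (vtx \<sigma>)(?g := v)"
    "rdead \<tau> = rdead \<sigma> \<union> {s0 \<sigma>, s1 \<sigma>, s2 \<sigma>}" "vdead \<tau> = insert v (vdead \<sigma>)" "go \<tau> = go \<sigma>" "cur \<tau> = n"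
    "adj \<tau> = push v (s2 \<sigma>) (push v (s1 \<sigma>) (push v (s0 \<sigma>) (push v 0
       (push (Suc n) (p2 \<sigma>) (push (Suc n) (p1 \<sigma>) (push (p2 \<sigma>) ?g (push (p1 \<sigma>) ?g (adj \<sigma>))))))))"
    unfolding \<tau> \<rho>_def using cur by simp_all
  have "links \<rho> = insert ?g ?R" unfolding \<rho>_def using live_new_link(2)[of n 0 _ _ _ _ _ \<sigma>] by simp
  moreover have "links \<tau> = links \<rho>"
    using same_log_live[OF sl] sl unfolding same_log_def by metis
  ultimately have R: "links \<tau> = insert ?g ?R" by (simp only:)
  have gle: "f \<noteq> ?g" if "f \<in> links \<sigma>" for f using live_le[OF that] by auto
  have al: "alive n \<tau> = alive n \<sigma> - {v}" unfolding alive_def sel by auto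
  have p: "p1 \<sigma> \<in> insert n (alive n \<sigma>)" "p2 \<sigma> \<in> insert n (alive n \<sigma>)" "p1 \<sigma> \<noteq> v" "p2 \<sigma> \<noteq> v"
    using slot_target(1,4)[OF at1] slot_target(1,4)[OF at2] at1 at2 vn
    by (cases "s1 \<sigma> = 0"; cases "s2 \<sigma> = 0"; auto simp: attached_def)+
  have ple: "p1 \<sigma> \<le> n" "p2 \<sigma> \<le> n" using p(1,2) unfolding alive_def by auto
  have rest: "ex \<sigma> f \<noteq> v" "ey \<sigma> f \<noteq> v" if "f \<in> ?R" for f
    using cover[of f] that unfolding incident_def by auto
  let ?G = "link_graph n \<sigma> (links \<sigma>)" and ?H = "link_graph n \<tau> (links \<tau>)"
  have nbrs: "u = p1 \<sigma> \<or> u = p2 \<sigma>" if uv: "{u, v} \<in> ?G" for u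
  proof -
    obtain f where f: "f \<in> links \<sigma>" "{ex \<sigma> f, ey \<sigma> f} = {u, v}" "u < n"
      using uv unfolding link_graph_iff by blast
    then have "f \<in> {s0 \<sigma>, s1 \<sigma>, s2 \<sigma>}" using cover[of f] by (auto simp: incident_def doubleton_eq_iff)
    moreover have f0: "f \<noteq> 0" using live_gt0[OF f(1)] by simp
    ultimately consider "f = s0 \<sigma>" | "f = s1 \<sigma>" | "f = s2 \<sigma>" by blast
    then have "{u, v} = {v, n} \<or> {u, v} = {v, p1 \<sigma>} \<or> {u, v} = {v, p2 \<sigma>}"
    proof cases
      case 1 then show ?thesis using f(2) f0 slot_target(3)[OF at0] by metis
    next
      case 2 then show ?thesis using f(2) f0 slot_target(3)[OF at1] by metis
    next
      case 3 then show ?thesis using f(2) f0 slot_target(3)[OF at2] by metis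
    qed
    then show ?thesis using f(3) by (auto simp: doubleton_eq_iff)
  qed
  \<comment> \<open>The new link shows in the link graph only when there are two neighbors, which is
    suppression of \<open>v\<close>. Otherwise one of its ends is \<open>n\<close>, and the effect
    is plain deletion.\<close>
  have H: "?H = (if p1 \<sigma> \<noteq> n \<and> p2 \<sigma> \<noteq> n then insert {p1 \<sigma>, p2 \<sigma>} {f \<in> ?G. v \<notin> f} else {f \<in> ?G. v \<notin> f})"
    (is "_ = ?H'")
  proof (intro equalityI subsetI)
    fix f assume "f \<in> ?H"
    then obtain h where h: "f = {ex \<tau> h, ey \<tau> h}" "h \<in> links \<tau>" "ex \<tau> h < n" "ey \<tau> h < n"
      unfolding link_graph_def by blast
    show "f \<in> ?H'"
    proof (cases "h = ?g")
      case True then show ?thesis using h by (auto simp: sel)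
    next
      case False
      then have hR: "h \<in> ?R" using h R by auto
      then have "f = {ex \<sigma> h, ey \<sigma> h}" "ex \<sigma> h < n" "ey \<sigma> h < n" using h False by (auto simp: sel)
      then have "f \<in> {f \<in> ?G. v \<notin> f}" using hR rest[OF hR] unfolding link_graph_def by auto
      then show ?thesis by simp
    qed
  next
    fix f assume f: "f \<in> ?H'"
    show "f \<in> ?H"
    proof (cases "f \<in> {f \<in> ?G. v \<notin> f}")
      case True
      then obtain h where h: "f = {ex \<sigma> h, ey \<sigma> h}" "h \<in> links \<sigma>" "ex \<sigma> h < n" "ey \<sigma> h < n" "v \<notin> f"
        unfolding link_graph_def by blast
      have h0: "h \<noteq> 0" using live_gt0[OF h(2)] by simp
      have "h \<noteq> s0 \<sigma>" using h(1,5) h0 slot_target(3)[OF at0] by (metis insertI1)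
      moreover have "h \<noteq> s1 \<sigma>" using h(1,5) h0 slot_target(3)[OF at1] by (metis insertI1)
      moreover have "h \<noteq> s2 \<sigma>" using h(1,5) h0 slot_target(3)[OF at2] by (metis insertI1)
      ultimately have "h \<notin> {s0 \<sigma>, s1 \<sigma>, s2 \<sigma>}" by simp
      then show ?thesis using h R gle[OF h(2)] unfolding link_graph_def
        by (auto simp: sel intro!: exI[of _ h])
    next
      case False
      then have f: "f = {p1 \<sigma>, p2 \<sigma>}" "p1 \<sigma> < n" "p2 \<sigma> < n" using f ple by (auto split: if_splits)
      have "?g \<in> links \<tau>" "{ex \<tau> ?g, ey \<tau> ?g} = {p1 \<sigma>, p2 \<sigma>}" using R by (simp_all add: sel)
      then show ?thesis unfolding f(1) link_graph_iff using f by blast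
    qed
  qed
  have opl: "outerplanar (alive n \<sigma>) ?G" using core unfolding core_def by blast
  have nb: "{q, v} \<in> ?G" if "attached \<sigma> n (links \<sigma>) v c q" "q \<noteq> n" for c q
  proof -
    have c: "c \<noteq> 0" using that unfolding attached_def by (auto split: if_splits)
    note s = slot_target[OF that(1) c]
    have "q < n" using s(1) that(2) alive_lt by blast
    then show "{q, v} \<in> ?G" using s v_lt unfolding link_graph_iff by (auto simp: insert_commute)
  qed
  have core': "core n m \<tau>"
  proof (unfold core_def, intro conjI)
    show "outerplanar (alive n \<tau>) ?H"
    proof (cases "p1 \<sigma> \<noteq> n \<and> p2 \<sigma> \<noteq> n")
      case True
      then have "p1 \<sigma> \<noteq> p2 \<sigma>" using p12 by metis
      then show ?thesis unfolding al H
        using outerplanar_suppress_vertex[OF opl nb[OF at1] nb[OF at2]] True by simp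
    next
      case False
      show ?thesis unfolding al H if_not_P[OF False] by (rule outerplanar_delete_vertex[OF opl])
    qed
    show "\<forall>f\<le>rcnt \<tau>. (f \<in> rdead \<tau>) = (f \<notin> links \<tau>)"
    proof (intro allI impI)
      fix f assume f: "f \<le> rcnt \<tau>"
      have "?g \<notin> rdead \<sigma>" using core unfolding core_def by auto
      then show "(f \<in> rdead \<tau>) = (f \<notin> links \<tau>)"
        using f dead_iff[of f] R slots_le by (cases "f = ?g") (auto simp: sel)
    qed
    show "rdead \<tau> \<subseteq> {..rcnt \<tau>}" using core slots_le unfolding core_def by (auto simp: sel)
    show "vdead \<tau> \<subseteq> {..n}" "n \<in> vdead \<tau>" using core v_lt unfolding core_def by (auto simp: sel)
    show "\<forall>f\<in>links \<tau>. ex \<tau> f \<in> insert n (alive n \<tau>) \<and> ey \<tau> f \<in> insert n (alive n \<tau>) \<and>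
        (ex \<tau> f = ey \<tau> f \<longrightarrow> ex \<tau> f = n)"
    proof
      fix f assume f: "f \<in> links \<tau>"
      show "ex \<tau> f \<in> insert n (alive n \<tau>) \<and> ey \<tau> f \<in> insert n (alive n \<tau>) \<and>
        (ex \<tau> f = ey \<tau> f \<longrightarrow> ex \<tau> f = n)"
      proof (cases "f = ?g")
        case True
        then show ?thesis using p p12 by (auto simp: sel al)
      next
        case False
        then have fR: "f \<in> ?R" using f R by auto
        then show ?thesis using link_ends[of f] rest[OF fR] False by (simp add: sel al)
      qed
    qed
    show "\<forall>w<n. w \<in> vdead \<tau> \<longrightarrow> (\<exists>g. m < g \<and> g \<le> rcnt \<tau> \<and> kind \<tau> g = 0 \<and> vtx \<tau> g = w)"
    proof (intro allI impI)
      fix w assume w: "w < n" "w \<in> vdead \<tau>"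
      show "\<exists>g. m < g \<and> g \<le> rcnt \<tau> \<and> kind \<tau> g = 0 \<and> vtx \<tau> g = w"
      proof (cases "w = v")
        case True
        have "m \<le> rcnt \<sigma>" using log unfolding log_ok_def by blast
        then show ?thesis using True by (intro exI[of _ ?g]) (simp add: sel)
      next
        case False
        then obtain g where "m < g \<and> g \<le> rcnt \<sigma> \<and> kind \<sigma> g = 0 \<and> vtx \<sigma> g = w"
          using core w unfolding core_def sel by blast
        then show ?thesis by (intro exI[of _ g]) (auto simp: sel)
      qed
    qed
  qed
  have lists': "lists_ok n \<tau>"
  proof (rule lists_okI)
    fix w f assume "w \<in> alive n \<tau>" and f: "f \<in> links \<tau>"
    then have w: "w \<in> alive n \<sigma>" "w \<noteq> v" using al by auto
    have wn: "w \<noteq> n" "w \<noteq> Suc n" using alive_Suc[OF w(1)] by auto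
    have "count_list (adj \<tau> w) f = of_bool (incident \<tau> f w)"
    proof (cases "f = ?g")
      case True
      have "set (adj \<sigma> w) \<subseteq> {..rcnt \<sigma>}"
        using lists w(1) alive_lt[OF w(1)] unfolding lists_ok_def by auto
      then have "f \<notin> set (adj \<sigma> w)" using True by auto
      then have "count_list (adj \<sigma> w) f = 0" by (simp add: count_list_0_iff)
      \<comment> \<open>Equal ends would give the count 2, but
        \<open>p1 \<sigma> = p2 \<sigma>\<close> happens only when both are \<open>n\<close>, and
        \<open>n\<close> is not alive.\<close>
      moreover have "of_bool (w = p1 \<sigma>) + of_bool (w = p2 \<sigma>) = (of_bool (incident \<tau> f w) :: nat)"
        using p12 wn True by (auto simp: incident_def sel)
      ultimately show ?thesis using True wn w by (simp add: sel)
    next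
      case False
      then have fR: "f \<in> links \<sigma>" using f R by auto
      have "incident \<tau> f w = incident \<sigma> f w" using False by (simp add: incident_def sel)
      then show ?thesis using count[OF w(1) fR] False wn w cur by (simp add: sel)
    qed
    then show "(if w = cur \<tau> then of_bool (s0 \<tau> = f) + of_bool (s1 \<tau> = f) + of_bool (s2 \<tau> = f) else 0) +
        count_list (adj \<tau> w) f = of_bool (incident \<tau> f w)" using wn by (simp add: sel)
  next
    fix w assume w: "w \<le> n"
    then have "set (adj \<sigma> w) \<subseteq> {..rcnt \<sigma>}" using lists unfolding lists_ok_def by auto
    then have "set (adj \<sigma> w) \<subseteq> {..?g}" by auto
    moreover have "w \<noteq> Suc n" using w by simp
    ultimately show "set (adj \<tau> w) \<subseteq> {..rcnt \<tau>}" using slots_le by (auto simp: sel)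
  next
    show "set (adj \<tau> (Suc n)) \<subseteq> {..n}" using lists v_lt ple unfolding lists_ok_def by (simp add: sel)
  qed
  have "work_ok n \<tau>" unfolding work_ok_def
  proof (intro conjI ballI)
    show "\<not> go \<tau> \<longrightarrow> adj \<tau> (Suc n) = [] \<and> cur \<tau> = n" using work cur vn unfolding work_ok_def by (auto simp: sel)
    fix w assume "w \<in> alive n \<tau>"
    then have w: "w \<in> alive n \<sigma>" "w \<noteq> v" using al by auto
    show "w \<in> set (adj \<tau> (Suc n)) \<or> w = cur \<tau> \<or> 3 \<le> card {u. {u, w} \<in> ?H}"
    proof (cases "w = p1 \<sigma> \<or> w = p2 \<sigma> \<or> w \<in> set (adj \<sigma> (Suc n))")
      case True
      then show ?thesis using v_lt by (auto simp: sel)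
    next
      case False
      \<comment> \<open>A vertex that is not queued now is not a neighbor of \<open>v\<close>, so
        the elimination leaves its neighborhood and hence its degree alone.\<close>
      have "{v, w} \<notin> ?G" using nbrs[of w] False by (auto simp: insert_commute)
      then have "{u, w} \<in> ?H \<longleftrightarrow> {u, w} \<in> ?G" for u
        unfolding H using w False by (auto simp: doubleton_eq_iff)
      then have "{u. {u, w} \<in> ?H} = {u. {u, w} \<in> ?G}" by simp
      then show ?thesis using work w False cur unfolding work_ok_def by auto
    qed
  qed
  moreover have "slots_ok n \<tau>" unfolding slots_ok_def by (simp add: sel)
  ultimately show ?thesis unfolding \<tau>_def[symmetric] valid_def
    using same_log_log_ok[OF sl] lo core' lists' by blast
qed

end

context machine_inv
begin

lemma inv_stop:
  assumes "cur \<sigma> = n" "adj \<sigma> (Suc n) = []"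
  shows "valid n m (\<sigma>\<lparr>go := False\<rparr>)"
proof (rule inv_sameI)
  show sl: "same_log (\<sigma>\<lparr>go := False\<rparr>) \<sigma>" unfolding same_log_def by simp
  have li: "live (\<sigma>\<lparr>go := False\<rparr>) g = live \<sigma> g" for g using same_log_live[OF sl] .
  show "lists_ok n (\<sigma>\<lparr>go := False\<rparr>)"
  proof -
    have "incident (\<sigma>\<lparr>go := False\<rparr>) = incident \<sigma>" unfolding incident_def by (simp add: fun_eq_iff)
    then show ?thesis using lists unfolding lists_ok_def li by (simp add: alive_def cong: if_cong split del: if_split split_of_bool)
  qed
  show "slots_ok n (\<sigma>\<lparr>go := False\<rparr>)" using assms unfolding slots_ok_def by simp
  show "work_ok n (\<sigma>\<lparr>go := False\<rparr>)"
    using work assms unfolding work_ok_def li by (simp add: alive_def link_graph_def)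
qed simp

lemma inv_drop:
  assumes "cur \<sigma> = n" "adj \<sigma> (Suc n) = w # ws" "w \<in> vdead \<sigma>"
  shows "valid n m (\<sigma>\<lparr>adj := (adj \<sigma>)(Suc n := ws)\<rparr>)"
proof (rule inv_sameI)
  let ?\<tau> = "\<sigma>\<lparr>adj := (adj \<sigma>)(Suc n := ws)\<rparr>"
  show sl: "same_log ?\<tau> \<sigma>" unfolding same_log_def by simp
  have li: "live ?\<tau> g = live \<sigma> g" for g using same_log_live[OF sl] .
  show "lists_ok n ?\<tau>"
  proof -
    have "incident ?\<tau> = incident \<sigma>" unfolding incident_def by (simp add: fun_eq_iff)
    then show ?thesis using lists assms unfolding lists_ok_def li by (simp add: alive_def cong: if_cong split del: if_split split_of_bool)
  qed
  show "slots_ok n ?\<tau>" using assms unfolding slots_ok_def by simp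
  show "work_ok n ?\<tau>"
    using work assms unfolding work_ok_def li by (auto simp: alive_def link_graph_def)
qed simp

lemma inv_open:
  assumes "cur \<sigma> = n" "adj \<sigma> (Suc n) = w # ws" "w \<notin> vdead \<sigma>"
  shows "valid n m (\<sigma>\<lparr>adj := (adj \<sigma>)(Suc n := ws), cur := w, s0 := 0, s1 := 0, s2 := 0, p1 := n, p2 := n\<rparr>)"
    (is "valid n m ?\<tau>")
proof (rule inv_sameI)
  show sl: "same_log ?\<tau> \<sigma>" unfolding same_log_def by simp
  have li: "live ?\<tau> g = live \<sigma> g" for g using same_log_live[OF sl] .
  have "w \<le> n" using lists assms unfolding lists_ok_def by auto
  moreover have "n \<in> vdead \<sigma>" using core unfolding core_def by blast
  ultimately have w: "w < n" using assms by (cases "w = n") auto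
  show "lists_ok n ?\<tau>"
  proof (rule lists_okI)
    fix u f assume "u \<in> alive n ?\<tau>" "f \<in> links ?\<tau>"
    then have uf: "u \<in> alive n \<sigma>" "f \<in> links \<sigma>" using li by (simp_all add: alive_def)
    show "(if u = cur ?\<tau> then of_bool (s0 ?\<tau> = f) + of_bool (s1 ?\<tau> = f) + of_bool (s2 ?\<tau> = f) else 0) +
        count_list (adj ?\<tau> u) f = of_bool (incident ?\<tau> f u)"
      using count[OF uf] live_gt0[OF uf(2)] alive_Suc[OF uf(1)] assms by (simp add: incident_def)
  qed (use lists assms in \<open>auto simp: lists_ok_def\<close>)
  show "slots_ok n ?\<tau>" using w assms unfolding slots_ok_def by (simp add: alive_def)
  show "work_ok n ?\<tau>"
    using work assms unfolding work_ok_def li by (auto simp: alive_def link_graph_def)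
qed simp

lemma inv_step: "valid n m (step n \<sigma>)"
proof (cases "cur \<sigma> = n")
  case True
  show ?thesis
  proof (cases "adj \<sigma> (Suc n)")
    case Nil
    then show ?thesis using inv_stop True unfolding step_def by simp
  next
    case (Cons w ws)
    then show ?thesis using inv_drop[OF True Cons] inv_open[OF True Cons] True unfolding step_def by simp
  qed
next
  case False
  interpret machine_open n m \<sigma> "cur \<sigma>" by unfold_locales (use False in auto)
  show ?thesis
  proof (cases "adj \<sigma> (cur \<sigma>)")
    case Nil
    then show ?thesis using inv_eliminate False unfolding step_def by simp
  next
    case (Cons e es)
    interpret machine_pop n m \<sigma> "cur \<sigma>" e es by unfold_locales (rule Cons)
    show ?thesis
    proof (cases "e \<in> rdead \<sigma>")
      case True
      then show ?thesis using inv_skip False Cons unfolding step_def by simp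
    next
      case e: False
      define y where "y = (if ex \<sigma> e = cur \<sigma> then ey \<sigma> e else ex \<sigma> e)"
      interpret machine_link n m \<sigma> "cur \<sigma>" e es y by unfold_locales (use e y_def in auto)
      have step: "step n \<sigma> =
         (if y = n then (if s0 \<sigma> = 0 then \<tau>\<lparr>s0 := e\<rparr> else merge_links n (s0 \<sigma>) e y \<tau>)
            else if p1 \<sigma> = n then \<tau>\<lparr>s1 := e, p1 := y\<rparr>
            else if p1 \<sigma> = y then merge_links n (s1 \<sigma>) e y \<tau>
            else if p2 \<sigma> = n then \<tau>\<lparr>s2 := e, p2 := y\<rparr>
            else if p2 \<sigma> = y then merge_links n (s2 \<sigma>) e y \<tau>
            else close n e \<tau>)"
        using False Cons e unfolding step_def y_def by (simp add: Let_def)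
      have "s1 \<sigma> \<noteq> 0" if "p1 \<sigma> \<noteq> n" using at1 that unfolding attached_def by (auto split: if_splits)
      moreover have "s2 \<sigma> \<noteq> 0" if "p2 \<sigma> \<noteq> n" using at2 that unfolding attached_def by (auto split: if_splits)
      ultimately show ?thesis unfolding step
        using inv_fill0 inv_fill1 inv_fill2 inv_third inv_merge[of "s0 \<sigma>"] inv_merge[of "s1 \<sigma>"]
          inv_merge[of "s2 \<sigma>"] at0 at1 at2 by auto
    qed
  qed
qed

end

section \<open>Termination and correctness of the elimination\<close>

lemma live_close: "live (close n e \<sigma>) g = live \<sigma> g"
  by (rule live_eqI) simp_all

lemma links_merge:
  "links (merge_links n s e y \<sigma>) = insert (Suc (rcnt \<sigma>)) (links \<sigma> - {0, s, e})"
  unfolding merge_links_def live_close close_sel new_link_sel live_new_link(2) ..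

lemma links_eliminate:
  "links (eliminate n \<sigma>) = insert (Suc (rcnt \<sigma>)) (links \<sigma> - {s0 \<sigma>, s1 \<sigma>, s2 \<sigma>})"
proof -
  have rc: "rcnt (eliminate n \<sigma>) = Suc (rcnt \<sigma>)" by (simp add: eliminate_def)
  have "links (eliminate n \<sigma>) =
      live (new_link n 0 (s0 \<sigma>) (s1 \<sigma>) (s2 \<sigma>) (p1 \<sigma>) (p2 \<sigma>) \<sigma>) (Suc (rcnt \<sigma>))"
    unfolding rc by (rule live_eqI) (simp_all add: eliminate_def)
  then show ?thesis unfolding live_new_link(2) .
qed

lemma sum_length_upd:
  assumes "v \<le> (n :: nat)"
  shows "(\<Sum>w\<le>n. length ((a(v := es)) w)) + length (a v) = (\<Sum>w\<le>n. length (a w)) + length es"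
proof -
  have "(\<Sum>w\<in>{..n} - {v}. length ((a(v := es)) w)) = (\<Sum>w\<in>{..n} - {v}. length (a w))"
    by (intro sum.cong) auto
  then show ?thesis
    using sum.remove[of "{..n}" v "\<lambda>w. length ((a(v := es)) w)"]
      sum.remove[of "{..n}" v "\<lambda>w. length (a w)"] assms
    by (simp only: finite_atMost atMost_iff fun_upd_same)
qed

context machine_pop
begin

lemma links_pop: "live \<tau> g = live \<sigma> g"
  using same_log_live[OF same_log_pop] .

lemma sum_pop: "Suc (\<Sum>w\<le>n. length (adj \<tau> w)) = (\<Sum>w\<le>n. length (adj \<sigma> w))"
  using sum_length_upd[of v n "adj \<sigma>" es] adj_v v_lt by simp

lemma potential_pop:
  assumes "same_log \<rho> \<sigma>" "vdead \<rho> = vdead \<sigma>" "adj \<rho> = adj \<tau>" "cur \<rho> = v" "go \<rho> = go \<sigma>"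
  shows "potential n \<rho> < potential n \<sigma>"
proof -
  have "links \<rho> = links \<sigma>" using same_log_live[OF assms(1)] assms(1) unfolding same_log_def by metis
  then show ?thesis using assms(2-5) sum_pop vn v_lt cur unfolding potential_def alive_def by simp
qed

text \<open>One entry popped, four pushed, and 5 released by ending the scan: the balance is
  -2.\<close>

lemma potential_close: "potential n (close n e \<tau>) < potential n \<sigma>"
proof -
  let ?\<rho> = "close n e \<tau>"
  have w: "length (adj ?\<rho> (Suc n)) = length (adj \<sigma> (Suc n))"
    using v_lt cur by (simp add: length_push)
  have l: "(\<Sum>w\<le>n. length (adj ?\<rho> w)) = (\<Sum>w\<le>n. length (adj \<tau> w)) + 4"
    using v_lt cur by (simp add: sum_length_push)
  have "alive n ?\<rho> = alive n \<sigma>" "links ?\<rho> = links \<sigma>"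
    unfolding alive_def by (simp_all add: live_close links_pop)
  then show ?thesis unfolding potential_def w l using cur vn sum_pop by simp
qed

end

context machine_link
begin

text \<open>One entry popped, six pushed, two queue entries at 6 each, one link fewer at 13, and 5
  released by ending the scan: -1 + 6 + 12 - 13 - 5 = -1.\<close>

lemma potential_merge:
  assumes at: "attached \<sigma> n (links \<sigma>) v s y" and s: "s \<noteq> 0" "s \<in> {s0 \<sigma>, s1 \<sigma>, s2 \<sigma>}"
  shows "potential n (merge_links n s e y \<tau>) < potential n \<sigma>"
proof -
  let ?\<rho> = "merge_links n s e y \<tau>"
  have sR: "s \<in> links \<sigma>" "s \<noteq> e" using slot_target(2)[OF at s(1)] s e_count by auto
  have "links ?\<rho> = insert (Suc (rcnt \<sigma>)) (links \<sigma> - {s, e})"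
    using links_merge[of n s e y \<tau>] live_pos[of \<sigma>] by (simp add: links_pop)
  moreover have "Suc (rcnt \<sigma>) \<notin> links \<sigma>" using live_le[of "Suc (rcnt \<sigma>)" \<sigma> "rcnt \<sigma>"] by auto
  moreover have "card (links \<sigma> - {s, e}) + 2 = card (links \<sigma>)"
    using card_Diff_subset[of "{s, e}" "links \<sigma>"] sR e_link finite_live
      card_mono[of "links \<sigma>" "{s, e}"] by (simp add: finite_live)
  ultimately have c: "card (links ?\<rho>) + 1 = card (links \<sigma>)"
    by (simp add: finite_live)
  have a: "alive n ?\<rho> = alive n \<sigma>" unfolding alive_def merge_links_def by simp
  have w: "length (adj ?\<rho> (Suc n)) = length (adj \<sigma> (Suc n)) + 2"
    unfolding merge_links_def using v_lt cur y_le by (simp add: length_push)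
  have l: "(\<Sum>w\<le>n. length (adj ?\<rho> w)) = (\<Sum>w\<le>n. length (adj \<tau> w)) + 6"
    unfolding merge_links_def using v_lt cur y_le by (simp add: sum_length_push)
  have "cur ?\<rho> = n" "go ?\<rho> = go \<sigma>" unfolding merge_links_def by simp_all
  then show ?thesis unfolding potential_def a w l using c cur vn sum_pop by simp
qed

end

context machine_open
begin

text \<open>The vertex frees 27 and the end of the scan 5. The expenses are at most 13 for one more
  link, 6 for list entries and 12 for two queue entries, so the balance is at most -1.\<close>

lemma potential_eliminate: "potential n (eliminate n \<sigma>) < potential n \<sigma>"
proof -
  let ?\<rho> = "eliminate n \<sigma>"
  have le: "p1 \<sigma> \<le> n" "p2 \<sigma> \<le> n"
    using slot_target(1)[OF at1] slot_target(1)[OF at2] at1 at2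
    unfolding alive_def attached_def by (auto split: if_splits)
  have "card (links ?\<rho>) \<le> Suc (card (links \<sigma> - {s0 \<sigma>, s1 \<sigma>, s2 \<sigma>}))"
    unfolding links_eliminate by (simp add: card_insert_if finite_live)
  also have "\<dots> \<le> Suc (card (links \<sigma>))" by (simp add: card_mono finite_live)
  finally have c: "card (links ?\<rho>) \<le> Suc (card (links \<sigma>))" .
  have "alive n ?\<rho> = alive n \<sigma> - {v}" unfolding alive_def eliminate_def using cur by auto
  moreover have "finite (alive n \<sigma>)" unfolding alive_def by simp
  ultimately have a: "Suc (card (alive n ?\<rho>)) = card (alive n \<sigma>)"
    using v_alive by (metis card_Suc_Diff1)
  have w: "length (adj ?\<rho> (Suc n)) = length (adj \<sigma> (Suc n)) + 2"
    unfolding eliminate_def using v_lt cur le by (simp add: length_push)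
  have l: "(\<Sum>w\<le>n. length (adj ?\<rho> w)) = (\<Sum>w\<le>n. length (adj \<sigma> w)) + 6"
    unfolding eliminate_def using v_lt cur le by (simp add: sum_length_push)
  have "cur ?\<rho> = n" "go ?\<rho> = go \<sigma>" unfolding eliminate_def by simp_all
  then show ?thesis unfolding potential_def w l using c a cur vn by simp
qed

end

context machine_inv
begin

lemma potential_step:
  assumes "go \<sigma>"
  shows "potential n (step n \<sigma>) < potential n \<sigma>"
proof (cases "cur \<sigma> = n")
  case True
  have live_upd: "live (\<sigma>\<lparr>go := b\<rparr>) g = live \<sigma> g" "live (\<sigma>\<lparr>adj := a\<rparr>) g = live \<sigma> g"
    "live (\<sigma>\<lparr>adj := a, cur := c, s0 := 0, s1 := 0, s2 := 0, p1 := n, p2 := n\<rparr>) g = live \<sigma> g" for a b c g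
    by (rule live_eqI; simp)+
  show ?thesis
  proof (cases "adj \<sigma> (Suc n)")
    case Nil
    then show ?thesis using True assms unfolding step_def potential_def alive_def by (simp add: live_upd)
  next
    case (Cons w ws)
    then show ?thesis using True assms unfolding step_def potential_def alive_def by (simp add: live_upd)
  qed
next
  case False
  interpret machine_open n m \<sigma> "cur \<sigma>" by unfold_locales (use False in auto)
  show ?thesis
  proof (cases "adj \<sigma> (cur \<sigma>)")
    case Nil
    then show ?thesis using potential_eliminate False unfolding step_def by simp
  next
    case (Cons e es)
    interpret machine_pop n m \<sigma> "cur \<sigma>" e es by unfold_locales (rule Cons)
    show ?thesis
    proof (cases "e \<in> rdead \<sigma>")
      case True
      have "potential n \<tau> < potential n \<sigma>" by (rule potential_pop) (simp_all add: same_log_def)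
      then show ?thesis using True False Cons unfolding step_def by simp
    next
      case e: False
      define y where "y = (if ex \<sigma> e = cur \<sigma> then ey \<sigma> e else ex \<sigma> e)"
      interpret machine_link n m \<sigma> "cur \<sigma>" e es y by unfold_locales (use e y_def in auto)
      have step: "step n \<sigma> =
         (if y = n then (if s0 \<sigma> = 0 then \<tau>\<lparr>s0 := e\<rparr> else merge_links n (s0 \<sigma>) e y \<tau>)
            else if p1 \<sigma> = n then \<tau>\<lparr>s1 := e, p1 := y\<rparr>
            else if p1 \<sigma> = y then merge_links n (s1 \<sigma>) e y \<tau>
            else if p2 \<sigma> = n then \<tau>\<lparr>s2 := e, p2 := y\<rparr>
            else if p2 \<sigma> = y then merge_links n (s2 \<sigma>) e y \<tau>
            else close n e \<tau>)"
        using False Cons e unfolding step_def y_def by (simp add: Let_def)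
      have "s1 \<sigma> \<noteq> 0" if "p1 \<sigma> \<noteq> n" using at1 that unfolding attached_def by (auto split: if_splits)
      moreover have "s2 \<sigma> \<noteq> 0" if "p2 \<sigma> \<noteq> n" using at2 that unfolding attached_def by (auto split: if_splits)
      moreover have "potential n (\<tau>\<lparr>s0 := e\<rparr>) < potential n \<sigma>" "potential n (\<tau>\<lparr>s1 := e, p1 := y\<rparr>) < potential n \<sigma>"
        "potential n (\<tau>\<lparr>s2 := e, p2 := y\<rparr>) < potential n \<sigma>"
        by (rule potential_pop; simp add: same_log_def)+
      ultimately show ?thesis unfolding step
        using potential_close potential_merge[of "s0 \<sigma>"] potential_merge[of "s1 \<sigma>"]
          potential_merge[of "s2 \<sigma>"] at0 at1 at2 by auto
    qed
  qed
qed

lemma stopped_all_dead: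
  assumes "\<not> go \<sigma>"
  shows "alive n \<sigma> = {}"
proof (rule ccontr)
  assume ne: "alive n \<sigma> \<noteq> {}"
  have "outerplanar (alive n \<sigma>) (link_graph n \<sigma> (links \<sigma>))" using core unfolding core_def by blast
  then obtain v where v: "v \<in> alive n \<sigma>" "card {u. {u, v} \<in> link_graph n \<sigma> (links \<sigma>)} \<le> 2"
    using outerplanar_low_degree ne by blast
  moreover have "3 \<le> card {u. {u, v} \<in> link_graph n \<sigma> (links \<sigma>)}"
    using work v(1) assms alive_lt[OF v(1)] unfolding work_ok_def by auto
  ultimately show False by simp
qed

lemma solution_links:
  assumes "solution n \<sigma> (live \<sigma> m) q A" "m \<le> g" "g \<le> rcnt \<sigma>"
  shows "\<exists>B. solution n \<sigma> (live \<sigma> g) q B"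
  using assms(2,3)
proof (induction g rule: dec_induct)
  case base
  then show ?case using assms(1) by blast
next
  case (step g)
  then obtain B where B: "solution n \<sigma> (live \<sigma> g) q B" by auto
  have op: "op_ok n \<sigma> (live \<sigma> g) (Suc g)"
  proof -
    have "op_ok n \<sigma> (live \<sigma> (Suc g - 1)) (Suc g)"
      using log step unfolding log_ok_def by (metis Suc_leD le_imp_less_Suc)
    then show ?thesis by simp
  qed
  show ?case using solution_elim[OF op _ B] solution_merge[OF op _ B]
    by (cases "kind \<sigma> (Suc g) = 0") auto
qed

text \<open>A solution can be carried through the whole log, and at the moment a link is created it
  contains a tuple from the table of that link.\<close>

lemma solvable_feas:
  assumes "solution n \<sigma> (live \<sigma> m) q A"
  shows "feas \<sigma>"
proof -
  have "etab \<sigma> g \<noteq> {}" if g: "m < g" "g \<le> rcnt \<sigma>" for g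
  proof -
    obtain B where B: "solution n \<sigma> (live \<sigma> g) q B" using solution_links[OF assms less_imp_le[OF g(1)] g(2)] by blast
    have "g \<in> live \<sigma> g" using g by (cases g) (auto simp: after_op_def)
    then show ?thesis using B unfolding solution_def by auto
  qed
  then show ?thesis using log unfolding log_ok_def by blast
qed

text \<open>With no vertex left alive, every remaining link joins \<open>n\<close> to
  \<open>n\<close>. Such a link was made by eliminating a vertex without neighbors, so its children
  \<open>ch1\<close> and \<open>ch2\<close> are missing links; nonemptiness of its table is then all
  that is required.\<close>

lemma final_solution:
  assumes "\<not> go \<sigma>" "feas \<sigma>" "\<And>e. m < e \<Longrightarrow> e \<le> rcnt \<sigma> \<Longrightarrow> A e = ((state0, False), (state0, False))"
  shows "solution n \<sigma> (links \<sigma>) (\<lambda>_. state0) A"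
proof -
  have "A e = ((state0, False), (state0, False)) \<and> A e \<in> etab \<sigma> e" if e: "e \<in> links \<sigma>" for e
  proof -
    have ends: "ex \<sigma> e = n" "ey \<sigma> e = n"
      using link_ends(1,2)[OF e] stopped_all_dead[OF assms(1)] by auto
    have le: "e \<le> rcnt \<sigma>" "0 < e" using live_le[OF e] live_gt0[OF e] by auto
    have "m < e"
    proof (rule ccontr)
      assume "\<not> m < e"
      then have "ex \<sigma> e < n" using log le unfolding log_ok_def by simp
      then show False using ends by simp
    qed
    then have op: "op_ok n \<sigma> (live \<sigma> (e - 1)) e" "vtx \<sigma> e < n" "etab \<sigma> e \<noteq> {}"
      and ch: "kind \<sigma> e = 0 \<Longrightarrow> ch1 \<sigma> e = 0 \<and> ch2 \<sigma> e = 0"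
      using log assms(2) le ends unfolding log_ok_def by auto
    have k: "kind \<sigma> e = 0"
    proof (rule ccontr)
      assume "kind \<sigma> e \<noteq> 0"
      then have "merge_ok n \<sigma> (live \<sigma> (e - 1)) e" using op(1) unfolding op_ok_def by simp
      then show False using ends op(2) unfolding merge_ok_def by simp
    qed
    have tr: "table_from \<sigma> (vtx \<sigma> e) 0 = trivial_table"
      using op(1) unfolding op_ok_def table_from_def by (simp add: trivial_table_converse)
    have tab: "etab \<sigma> e = combine 0 (table_from \<sigma> (vtx \<sigma> e) (ch0 \<sigma> e)) trivial_table trivial_table"
      using op(1) ch[OF k] k tr unfolding op_ok_def by simp
    then obtain t a0 a1 a2 where
      "decomposes 0 (table_from \<sigma> (vtx \<sigma> e) (ch0 \<sigma> e)) trivial_table trivial_table t (a0, a1, a2)"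
      using op(3) unfolding combine_def by auto
    \<comment> \<open>The far ends of tuples in \<open>trivial_table\<close> are arbitrary, so they
      may be replaced by the default state.\<close>
    then have "decomposes 0 (table_from \<sigma> (vtx \<sigma> e) (ch0 \<sigma> e)) trivial_table trivial_table
        ((state0, False), (state0, False)) (a0, (fst a1, (state0, False)), (fst a2, (state0, False)))"
      unfolding decomposes_def trivial_table_def by auto
    then have "((state0, False), (state0, False)) \<in> etab \<sigma> e" unfolding tab by (rule combineI)
    then show ?thesis using assms(3)[of e] \<open>m < e\<close> le by simp
  qed
  then have "A e = ((state0, False), (state0, False))" "A e \<in> etab \<sigma> e" if "e \<in> links \<sigma>" for e
    using that by blast+
  then show ?thesis unfolding solution_def load_def by auto
qed

end

section \<open>Input edges and the backward pass\<close>

lemma sum_le_one: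
  fixes f :: "'a \<Rightarrow> nat"
  assumes fin: "finite R" and le: "\<And>x. x \<in> R \<Longrightarrow> f x \<le> 1"
    and uniq: "\<And>x y. x \<in> R \<Longrightarrow> y \<in> R \<Longrightarrow> f x \<noteq> 0 \<Longrightarrow> f y \<noteq> 0 \<Longrightarrow> x = y"
  shows "sum f R \<le> 1"
proof (cases "\<exists>x\<in>R. f x \<noteq> 0")
  case True
  then obtain x where x: "x \<in> R" "f x \<noteq> 0" by blast
  have "sum f (R - {x}) = 0" using uniq x by (intro sum.neutral) blast
  then show ?thesis using sum.remove[OF fin x(1), of f] le[OF x(1)] by simp
qed auto

lemma edge_tableD:
  "((a, u), (b, w)) \<in> edge_table \<Longrightarrow> fst a = fst b \<Longrightarrow> snd a \<noteq> snd b \<and> u = (\<not> snd a) \<and> w = (\<not> snd b)"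
  unfolding edge_table_def by (auto split: if_splits)

text \<open>\<open>inj\<close> says that no edge is listed twice; a repeated edge would charge a
  leaf twice for the same neighbor.\<close>

locale original_links =
  fixes n :: nat and L :: "'a log_scheme" and R :: "nat set" and E :: "nat set set"
  assumes fin: "finite R" and sg: "simple_graph {..<n} E"
    and E: "E = (\<lambda>g. {ex L g, ey L g}) ` R" and inj: "inj_on (\<lambda>g. {ex L g, ey L g}) R"
    and tab: "\<And>g. g \<in> R \<Longrightarrow> etab L g = edge_table"
begin

lemma edge_props: "e \<in> E \<Longrightarrow> e \<subseteq> {..<n} \<and> card e = 2"
proof -
  have "\<forall>e\<in>E. e \<subseteq> {..<n} \<and> card e = 2" using sg unfolding simple_graph_def by (elim conjE)
  then show "e \<in> E \<Longrightarrow> e \<subseteq> {..<n} \<and> card e = 2" by (rule bspec)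
qed

lemma ends: "g \<in> R \<Longrightarrow> ex L g < n \<and> ey L g < n \<and> ex L g \<noteq> ey L g"
proof -
  assume "g \<in> R"
  then have "{ex L g, ey L g} \<in> E" unfolding E by (rule imageI)
  then have "{ex L g, ey L g} \<subseteq> {..<n}" "card {ex L g, ey L g} = 2"
    using edge_props[of "{ex L g, ey L g}"] by auto
  then show ?thesis by (cases "ex L g = ey L g") auto
qed

lemma edge_lt: "{u, v} \<in> E \<Longrightarrow> u < n \<and> v < n"
  using edge_props[of "{u, v}"] by simp

lemma edge_link: "{u, v} \<in> E \<Longrightarrow> \<exists>g\<in>R. {ex L g, ey L g} = {u, v}"
  using E by (metis (no_types, lifting) imageE)

lemma finite_nbrs: "finite (same_color_nbrs E c v)"
  by (rule finite_subset[of _ "{..<n}"]) (use edge_lt in \<open>auto simp: same_color_nbrs_def\<close>)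

text \<open>Each neighbor of its own color brings a link that charges a leaf; two of them would
  exceed the capacity of the leaf.\<close>

lemma solution_roles:
  assumes sol: "solution n L R q A"
  shows "star_roles {..<n} E (\<lambda>v. of_bool (fst (q v))) (\<lambda>v. snd (q v))"
proof -
  have A: "A g \<in> edge_table" "fst (fst (A g)) = q (ex L g)" "fst (snd (A g)) = q (ey L g)" if "g \<in> R" for g
    using sol tab[OF that] that unfolding solution_def by auto
  have same: "snd (q (ex L g)) \<noteq> snd (q (ey L g)) \<and> snd (fst (A g)) = (\<not> snd (q (ex L g))) \<and>
      snd (snd (A g)) = (\<not> snd (q (ey L g)))" if "g \<in> R" "fst (q (ex L g)) = fst (q (ey L g))" for g
  proof -
    have "A g = ((q (ex L g), snd (fst (A g))), (q (ey L g), snd (snd (A g))))"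
      using A(2,3)[OF that(1)] by (metis prod.collapse)
    then show ?thesis using edge_tableD A(1)[OF that(1)] that(2) by metis
  qed
  show ?thesis unfolding star_roles_def
  proof (intro conjI allI impI ballI)
    fix u v assume uv: "{u, v} \<in> E \<and> (of_bool (fst (q u)) :: nat) = of_bool (fst (q v))"
    then obtain g where g: "g \<in> R" "{ex L g, ey L g} = {u, v}" using edge_link by blast
    moreover have "fst (q u) = fst (q v)" using uv by (cases "fst (q u)"; cases "fst (q v)") auto
    ultimately show "snd (q u) \<noteq> snd (q v)"
      using same[OF g(1)] unfolding doubleton_eq_iff by (elim disjE conjE) simp_all
  next
    fix v assume v: "v \<in> {..<n}" "\<not> snd (q v)"
    let ?N = "same_color_nbrs E (\<lambda>v. of_bool (fst (q v))) v"
    have finN: "finite ?N" by (rule finite_nbrs)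
    have link: "\<exists>g\<in>R. {ex L g, ey L g} = {u, v} \<and> load L A v g \<ge> 1" if "u \<in> ?N" for u
    proof -
      have u: "{u, v} \<in> E" "fst (q u) = fst (q v)"
        using that unfolding same_color_nbrs_def by (cases "fst (q u)"; cases "fst (q v)"; auto)+
      then obtain g where g: "g \<in> R" "{ex L g, ey L g} = {u, v}" using edge_link by blast
      then have "fst (q (ex L g)) = fst (q (ey L g))" using u(2) by (auto simp: doubleton_eq_iff)
      then have "load L A v g \<ge> 1"
        using same[OF g(1)] g(2) v(2) unfolding load_def by (auto simp: doubleton_eq_iff)
      then show ?thesis using g by blast
    qed
    have "u = w" if uw: "u \<in> ?N" "w \<in> ?N" for u w
    proof (rule ccontr)
      assume ne: "u \<noteq> w"
      obtain g h where g: "g \<in> R" "{ex L g, ey L g} = {u, v}" "load L A v g \<ge> 1"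
        and h: "h \<in> R" "{ex L h, ey L h} = {w, v}" "load L A v h \<ge> 1" using link uw by meson
      have "g \<noteq> h" using g(2) h(2) ne by (auto simp: doubleton_eq_iff)
      then have "2 \<le> (\<Sum>x\<in>{g, h}. load L A v x)" using g h by simp
      also have "\<dots> \<le> (\<Sum>x\<in>R. load L A v x)" using g h fin by (intro sum_mono2) auto
      also have "\<dots> \<le> of_bool (v \<noteq> n)" using sol unfolding solution_def by blast
      also have "\<dots> \<le> 1" by simp
      finally show False by simp
    qed
    then show "card ?N \<le> 1" using card_le_Suc0_iff_eq[OF finN] by auto
  qed
qed

text \<open>A leaf is charged only by the link to its unique neighbor of the same color, a center by
  none, so all capacities are respected.\<close>

lemma roles_solution:
  assumes c: "\<And>v. v < n \<Longrightarrow> c v < (2::nat)" and r: "star_roles {..<n} E c r"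
  shows "\<exists>q A. solution n L R q A"
proof -
  \<comment> \<open>Outside the graph the default state is taken, as \<open>solution\<close> demands
    at \<open>n\<close>.\<close>
  define q where "q v = (if v < n then (c v = 1, r v) else state0)" for v
  define used where "used x y \<longleftrightarrow> c x = c y \<and> \<not> r x" for x y
  define A where "A g = ((q (ex L g), used (ex L g) (ey L g)), (q (ey L g), used (ey L g) (ex L g)))" for g
  have inE: "{ex L g, ey L g} \<in> E" if "g \<in> R" for g using that unfolding E by blast
  have tA: "A g \<in> etab L g" if g: "g \<in> R" for g
  proof -
    have "c (ex L g) < 2" "c (ey L g) < 2" using ends[OF g] c by auto
    then have "(c (ex L g) = 1) = (c (ey L g) = 1) \<longleftrightarrow> c (ex L g) = c (ey L g)" by auto
    moreover have "c (ex L g) = c (ey L g) \<longrightarrow> r (ex L g) \<noteq> r (ey L g)"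
      using r inE[OF g] unfolding star_roles_def by blast
    ultimately show ?thesis unfolding tab[OF g] edge_table_def A_def q_def used_def
      using ends[OF g] by auto
  qed
  have load: "\<exists>u. {u, v} = {ex L g, ey L g} \<and> used v u" if "g \<in> R" "load L A v g \<noteq> 0" for v g
    using that(2) unfolding load_def A_def by (auto simp: insert_commute split: if_splits)
  have "(\<Sum>g\<in>R. load L A v g) \<le> of_bool (v \<noteq> n)" for v
  proof (cases "v < n")
    case True
    have "(\<Sum>g\<in>R. load L A v g) \<le> 1"
    proof (rule sum_le_one[OF fin])
      show "load L A v g \<le> 1" if "g \<in> R" for g using ends[OF that] unfolding load_def by auto
      fix g h assume gh: "g \<in> R" "h \<in> R" "load L A v g \<noteq> 0" "load L A v h \<noteq> 0"
      obtain u where u: "{u, v} = {ex L g, ey L g}" "used v u" using load gh by blast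
      obtain w where w: "{w, v} = {ex L h, ey L h}" "used v w" using load gh by blast
      let ?N = "same_color_nbrs E c v"
      have "u \<in> ?N" "w \<in> ?N" using u w inE[OF gh(1)] inE[OF gh(2)]
        unfolding same_color_nbrs_def used_def by auto
      moreover have "finite ?N" by (rule finite_nbrs)
      moreover have "card ?N \<le> 1" using r u(2) True unfolding star_roles_def used_def by auto
      ultimately have "u = w" using card_le_Suc0_iff_eq[of ?N] by auto
      then show "g = h" using inj u w gh unfolding inj_on_def by metis
    qed
    then show ?thesis using True by simp
  next
    case False
    then have "load L A v g = 0" if "g \<in> R" for g using ends[OF that] unfolding load_def by auto
    then show ?thesis by simp
  qed
  then have "solution n L R q A"
    using tA unfolding solution_def by (simp add: q_def A_def)
  then show ?thesis by blast
qed

end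

section \<open>Undoing the log\<close>

definition pick :: "nat \<Rightarrow> tuple set \<Rightarrow> tuple set \<Rightarrow> tuple set \<Rightarrow> tuple \<Rightarrow> tuple \<times> tuple \<times> tuple" where
  "pick k T0 T1 T2 t = (SOME a. decomposes k T0 T1 T2 t a)"

definition pick_at :: "'a log_scheme \<Rightarrow> nat \<Rightarrow> tuple \<Rightarrow> tuple \<times> tuple \<times> tuple" where
  "pick_at L g t = pick (kind L g) (table_from L (vtx L g) (ch0 L g))
     (table_from L (vtx L g) (ch1 L g)) (table_from L (vtx L g) (ch2 L g)) t"

definition color_of :: "tuple \<times> tuple \<times> tuple \<Rightarrow> nat" where
  "color_of a = of_bool (fst (fst (fst (fst (snd a)))))"

text \<open>The colors are tied to \<open>q\<close> through the operations already undone, not only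
  the eliminations, since undoing a merge also writes a color, the same one again.\<close>

definition unwound :: "nat \<Rightarrow> machine \<Rightarrow> nat \<Rightarrow> (nat \<Rightarrow> tuple) \<Rightarrow> (nat \<Rightarrow> nat) \<Rightarrow> bool" where
  "unwound n \<sigma> g A out \<longleftrightarrow> (\<exists>q. solution n \<sigma> (live \<sigma> g) q A \<and>
     (\<forall>h. g < h \<and> h \<le> rcnt \<sigma> \<longrightarrow> out (vtx \<sigma> h) = of_bool (fst (q (vtx \<sigma> h)))))"

context machine_inv
begin

lemma unwound_step:
  assumes u: "unwound n \<sigma> (Suc g) A out" and g: "m \<le> g" "Suc g \<le> rcnt \<sigma>"
  shows "unwound n \<sigma> g (undo \<sigma> (Suc g) (pick_at \<sigma> (Suc g) (A (Suc g))) A)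
    (out(vtx \<sigma> (Suc g) := color_of (pick_at \<sigma> (Suc g) (A (Suc g)))))"
proof -
  let ?g = "Suc g" and ?v = "vtx \<sigma> (Suc g)" and ?a = "pick_at \<sigma> (Suc g) (A (Suc g))"
  obtain q where sol: "solution n \<sigma> (live \<sigma> ?g) q A"
    and out: "\<forall>h. ?g < h \<and> h \<le> rcnt \<sigma> \<longrightarrow> out (vtx \<sigma> h) = of_bool (fst (q (vtx \<sigma> h)))"
    using u unfolding unwound_def by (elim exE conjE)
  have "\<forall>g. m < g \<and> g \<le> rcnt \<sigma> \<longrightarrow> op_ok n \<sigma> (live \<sigma> (g - 1)) g \<and> vtx \<sigma> g < n \<and>
        (kind \<sigma> g = 0 \<longrightarrow> (ex \<sigma> g = n \<longrightarrow> ch1 \<sigma> g = 0) \<and> (ey \<sigma> g = n \<longrightarrow> ch2 \<sigma> g = 0))"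
    using log unfolding log_ok_def by (elim conjE)
  from this[rule_format, of ?g] have "op_ok n \<sigma> (live \<sigma> (?g - 1)) ?g" and v: "?v < n"
    using g by simp_all
  then have op: "op_ok n \<sigma> (live \<sigma> g) ?g" by simp
  have sol': "solution n \<sigma> (after_op \<sigma> (live \<sigma> g) ?g) q A" using sol by simp
  have "A ?g \<in> etab \<sigma> ?g" using sol' unfolding solution_def after_op_def by blast
  then have dec: "decomposes (kind \<sigma> ?g) (table_from \<sigma> ?v (ch0 \<sigma> ?g)) (table_from \<sigma> ?v (ch1 \<sigma> ?g))
      (table_from \<sigma> ?v (ch2 \<sigma> ?g)) (A ?g) ?a"
    unfolding pick_at_def pick_def using op unfolding op_ok_def combine_def by (metis (mono_tags, lifting) mem_Collect_eq someI_ex)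
  have "solution n \<sigma> (live \<sigma> g) (q(?v := fst (fst (fst (snd ?a))))) (undo \<sigma> ?g ?a A)"
    using solution_undo[OF op sol' dec] v by simp
  moreover have "(out(?v := color_of ?a)) (vtx \<sigma> h) =
      of_bool (fst ((q(?v := fst (fst (fst (snd ?a))))) (vtx \<sigma> h)))" if "g < h" "h \<le> rcnt \<sigma>" for h
    using out[rule_format, of h] that by (cases "h = ?g") (auto simp: color_of_def)
  ultimately show ?thesis unfolding unwound_def by blast
qed

text \<open>Every vertex was eliminated by some operation, so after all operations are undone every
  vertex carries its color in \<open>q\<close>, and the roles in \<open>q\<close> certify the star
  coloring.\<close>

lemma unwound_coloring:
  assumes stop: "\<not> go \<sigma>" and u: "unwound n \<sigma> m A out" and "original_links n \<sigma> (live \<sigma> m) E"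
  shows "star_coloring 2 {..<n} E out"
proof -
  interpret original_links n \<sigma> "live \<sigma> m" E by fact
  obtain q where sol: "solution n \<sigma> (live \<sigma> m) q A"
    and out: "\<forall>h. m < h \<and> h \<le> rcnt \<sigma> \<longrightarrow> out (vtx \<sigma> h) = of_bool (fst (q (vtx \<sigma> h)))"
    using u unfolding unwound_def by (elim exE conjE)
  have o: "out v = of_bool (fst (q v))" if "v < n" for v
  proof -
    have "v \<in> vdead \<sigma>" using stopped_all_dead[OF stop] that unfolding alive_def by auto
    moreover have "\<forall>v<n. v \<in> vdead \<sigma> \<longrightarrow> (\<exists>g. m < g \<and> g \<le> rcnt \<sigma> \<and> kind \<sigma> g = 0 \<and> vtx \<sigma> g = v)"
      using core unfolding core_def by (elim conjE)
    ultimately have "\<exists>g. m < g \<and> g \<le> rcnt \<sigma> \<and> kind \<sigma> g = 0 \<and> vtx \<sigma> g = v" using that by simp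
    then obtain g where "m < g" "g \<le> rcnt \<sigma>" "vtx \<sigma> g = v" by blast
    then show ?thesis using out[rule_format, of g] by simp
  qed
  let ?c = "\<lambda>v. of_bool (fst (q v)) :: nat"
  have nb: "same_color_nbrs E out v = same_color_nbrs E ?c v" if "v < n" for v
  proof (intro set_eqI iffI)
    fix u
    show "u \<in> same_color_nbrs E ?c v" if "u \<in> same_color_nbrs E out v"
      using that edge_lt[of u v] o[of u] o[of v] unfolding same_color_nbrs_def by auto
    show "u \<in> same_color_nbrs E out v" if "u \<in> same_color_nbrs E ?c v"
      using that edge_lt[of u v] o[of u] o[of v] unfolding same_color_nbrs_def by auto
  qed
  note r = solution_roles[OF sol, unfolded star_roles_def]
  have "star_roles {..<n} E out (\<lambda>v. snd (q v))" unfolding star_roles_def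
  proof (intro conjI allI impI ballI)
    fix u v assume uv: "{u, v} \<in> E \<and> out u = out v"
    then have "?c u = ?c v" using edge_lt[of u v] o[of u] o[of v] by simp
    then show "snd (q u) \<noteq> snd (q v)" using r uv by blast
  next
    fix v assume "v \<in> {..<n}" "\<not> snd (q v)"
    then show "card (same_color_nbrs E out v) \<le> 1" using r nb by simp
  qed
  moreover have "out v < 2" if "v < n" for v using o[OF that] by simp
  ultimately show ?thesis using roles_star_coloring[OF sg, of out 2] by simp
qed

end

section \<open>Straight-line programs and their running time\<close>

text \<open>The machine without its word bound. Results and running times are established for it,
  and the bound is recovered afterwards from the running time.\<close>

inductive uexec :: "prog \<Rightarrow> state \<Rightarrow> nat \<Rightarrow> state \<Rightarrow> bool" where
  USkip: "uexec Skip s 1 s"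
| UConst: "uexec (Const x k) s 1 (set_reg x k s)"
| UCopy: "uexec (Copy x y) s 1 (set_reg x (regs s y) s)"
| UAdd: "uexec (Add x y z) s 1 (set_reg x (regs s y + regs s z) s)"
| USub: "uexec (Sub x y z) s 1 (set_reg x (regs s y - regs s z) s)"
| ULoad: "uexec (Load x a y) s 1 (set_reg x (arrs s a (regs s y)) s)"
| UStore: "uexec (Store a y x) s 1 (set_cell a (regs s y) (regs s x) s)"
| USeq: "uexec P s t s' \<Longrightarrow> uexec Q s' u s'' \<Longrightarrow> uexec (Seq P Q) s (t + u) s''"
| UCondT: "holds b s \<Longrightarrow> uexec P s t s' \<Longrightarrow> uexec (Cond b P Q) s (t + 1) s'"
| UCondF: "\<not> holds b s \<Longrightarrow> uexec Q s t s' \<Longrightarrow> uexec (Cond b P Q) s (t + 1) s'"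
| ULoopF: "\<not> holds b s \<Longrightarrow> uexec (Loop b P) s 1 s"
| ULoopT: "holds b s \<Longrightarrow> uexec P s t s' \<Longrightarrow> uexec (Loop b P) s' u s'' \<Longrightarrow>
    uexec (Loop b P) s (t + u + 1) s''"

fun tame :: "prog \<Rightarrow> bool" where
  "tame Skip \<longleftrightarrow> True"
| "tame (Const x k) \<longleftrightarrow> (x = 3 \<longrightarrow> k \<le> 1)"
| "tame (Copy x y) \<longleftrightarrow> x \<noteq> 3"
| "tame (Add x y z) \<longleftrightarrow> x \<noteq> 3 \<and> z = 3"
| "tame (Sub x y z) \<longleftrightarrow> x \<noteq> 3"
| "tame (Load x a y) \<longleftrightarrow> x \<noteq> 3"
| "tame (Store a y x) \<longleftrightarrow> True"
| "tame (Seq P Q) \<longleftrightarrow> tame P \<and> tame Q"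
| "tame (Cond b P Q) \<longleftrightarrow> tame P \<and> tame Q"
| "tame (Loop b P) \<longleftrightarrow> tame P"

primrec max_const :: "prog \<Rightarrow> nat" where
  "max_const Skip = 0"
| "max_const (Const x k) = k"
| "max_const (Copy x y) = 0"
| "max_const (Add x y z) = 0"
| "max_const (Sub x y z) = 0"
| "max_const (Load x a y) = 0"
| "max_const (Store a y x) = 0"
| "max_const (Seq P Q) = max (max_const P) (max_const Q)"
| "max_const (Cond b P Q) = max (max_const P) (max_const Q)"
| "max_const (Loop b P) = max_const P"

definition bounded_state :: "nat \<Rightarrow> state \<Rightarrow> bool" where
  "bounded_state B s \<longleftrightarrow> (\<forall>x. regs s x \<le> B) \<and> (\<forall>a i. arrs s a i \<le> B) \<and> regs s 3 \<le> 1"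

lemma bounded_mono: "bounded_state B s \<Longrightarrow> B \<le> B' \<Longrightarrow> bounded_state B' s"
  unfolding bounded_state_def by (meson order_trans)

lemma bounded_set_reg:
  "bounded_state B s \<Longrightarrow> k \<le> B' \<Longrightarrow> B \<le> B' \<Longrightarrow> (x = 3 \<longrightarrow> k \<le> 1) \<Longrightarrow> bounded_state B' (set_reg x k s)"
  using bounded_mono[of B s B'] unfolding bounded_state_def set_reg_def by simp

lemma bounded_set_cell:
  "bounded_state B s \<Longrightarrow> k \<le> B' \<Longrightarrow> B \<le> B' \<Longrightarrow> bounded_state B' (set_cell a i k s)"
  using bounded_mono[of B s B'] unfolding bounded_state_def set_cell_def by simp

text \<open>As register \<open>3\<close> never exceeds \<open>1\<close>, a step of a tame program increases values by at most one.\<close>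

lemma uexec_bounded:
  assumes "uexec P s t s'" "tame P" "max_const P \<le> B" "bounded_state B s"
  shows "bounded_state (B + t) s' \<and> (\<forall>W > B + t. exec W P s t s')"
  using assms
proof (induction arbitrary: B rule: uexec.induct)
  case (USkip s)
  then show ?case using bounded_mono[of B s] by (auto intro: exec.Skip[simplified])
next
  case (UConst x k s)
  have "exec W (Const x k) s 1 (set_reg x k s)" if "W > B + 1" for W
    using UConst that by (intro exec.Const) simp
  then show ?case using UConst by (auto intro!: bounded_set_reg[of B])
next
  case (UCopy x y s)
  have b: "regs s y \<le> B" using UCopy unfolding bounded_state_def by simp
  have "exec W (Copy x y) s 1 (set_reg x (regs s y) s)" if "W > B + 1" for W
    using b that by (intro exec.Copy) simp
  then show ?case using UCopy b by (auto intro!: bounded_set_reg[of B])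
next
  case (UAdd x y z s)
  have b: "regs s y \<le> B" "regs s 3 \<le> 1" using UAdd unfolding bounded_state_def by simp_all
  have z: "z = 3" "x \<noteq> 3" using UAdd by simp_all
  have "exec W (Add x y z) s 1 (set_reg x (regs s y + regs s z) s)" if "W > B + 1" for W
    using b z that by (intro exec.Add) simp
  then show ?case using UAdd b z by (auto intro!: bounded_set_reg[of B])
next
  case (USub x y z s)
  have b: "regs s y \<le> B" using USub unfolding bounded_state_def by simp
  have "exec W (Sub x y z) s 1 (set_reg x (regs s y - regs s z) s)" if "W > B + 1" for W
    using b that by (intro exec.Sub) simp
  then show ?case using USub b by (auto intro!: bounded_set_reg[of B])
next
  case (ULoad x a y s)
  have b: "arrs s a (regs s y) \<le> B" using ULoad unfolding bounded_state_def by simp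
  have "exec W (Load x a y) s 1 (set_reg x (arrs s a (regs s y)) s)" if "W > B + 1" for W
    using b that by (intro exec.Load) simp
  then show ?case using ULoad b by (auto intro!: bounded_set_reg[of B])
next
  case (UStore a y x s)
  have b: "regs s x \<le> B" using UStore unfolding bounded_state_def by simp
  have "exec W (Store a y x) s 1 (set_cell a (regs s y) (regs s x) s)" if "W > B + 1" for W
    using b that by (intro exec.Store) simp
  then show ?case using UStore b by (auto intro!: bounded_set_cell[of B])
next
  case (USeq P s t s' Q u s'')
  have 1: "bounded_state (B + t) s'" "\<forall>W > B + t. exec W P s t s'" using USeq by auto
  have 2: "bounded_state (B + t + u) s''" "\<forall>W > B + t + u. exec W Q s' u s''"
    using USeq.IH(2)[of "B + t"] USeq.prems 1 by auto
  then show ?case using 1 by (auto intro!: exec.Seq simp: add.assoc)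
next
  case (UCondT b s P t s' Q)
  have 1: "bounded_state (B + t) s'" "\<forall>W > B + t. exec W P s t s'" using UCondT by auto
  have "exec W (Cond b P Q) s (t + 1) s'" if "W > B + (t + 1)" for W
    by (rule exec.CondT[OF UCondT.hyps(1)]) (use 1 that in auto)
  then show ?case using bounded_mono[OF 1(1), of "B + (t + 1)"] by simp
next
  case (UCondF b s Q t s' P)
  have 1: "bounded_state (B + t) s'" "\<forall>W > B + t. exec W Q s t s'" using UCondF by auto
  have "exec W (Cond b P Q) s (t + 1) s'" if "W > B + (t + 1)" for W
    by (rule exec.CondF[OF UCondF.hyps(1)]) (use 1 that in auto)
  then show ?case using bounded_mono[OF 1(1), of "B + (t + 1)"] by simp
next
  case (ULoopF b s P)
  then show ?case using bounded_mono[of B s "B + 1"] by (auto intro: exec.LoopF[simplified])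
next
  case (ULoopT b s P t s' u s'')
  have 1: "bounded_state (B + t) s'" "\<forall>W > B + t. exec W P s t s'" using ULoopT by auto
  have 2: "bounded_state (B + t + u) s''" "\<forall>W > B + t + u. exec W (Loop b P) s' u s''"
    using ULoopT.IH(2)[of "B + t"] ULoopT.prems 1 by auto
  have "exec W (Loop b P) s (t + u + 1) s''" if "W > B + (t + u + 1)" for W
    by (rule exec.LoopT[OF ULoopT.hyps(1), of W P t s']) (use 1 2 that in auto)
  then show ?case using bounded_mono[OF 2(1), of "B + (t + u + 1)"] by simp
qed

section \<open>Loop-free code as a function on states, and the cost of loops\<close>

primrec loop_free :: "prog \<Rightarrow> bool" where
  "loop_free Skip = True"
| "loop_free (Const x k) = True"
| "loop_free (Copy x y) = True"
| "loop_free (Add x y z) = True"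
| "loop_free (Sub x y z) = True"
| "loop_free (Load x a y) = True"
| "loop_free (Store a y x) = True"
| "loop_free (Seq P Q) = (loop_free P \<and> loop_free Q)"
| "loop_free (Cond b P Q) = (loop_free P \<and> loop_free Q)"
| "loop_free (Loop b P) = False"

primrec ev :: "prog \<Rightarrow> state \<Rightarrow> state" where
  "ev Skip s = s"
| "ev (Const x k) s = set_reg x k s"
| "ev (Copy x y) s = set_reg x (regs s y) s"
| "ev (Add x y z) s = set_reg x (regs s y + regs s z) s"
| "ev (Sub x y z) s = set_reg x (regs s y - regs s z) s"
| "ev (Load x a y) s = set_reg x (arrs s a (regs s y)) s"
| "ev (Store a y x) s = set_cell a (regs s y) (regs s x) s"
| "ev (Seq P Q) s = ev Q (ev P s)"
| "ev (Cond b P Q) s = (if holds b s then ev P s else ev Q s)"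
| "ev (Loop b P) s = s"

text \<open>Adding both branches of a conditional is crude but only affects the constant factor.
  Only loop-free code is measured, so the value at a loop is a dummy, as it is in
  \<open>ev\<close>.\<close>

primrec time_bound :: "prog \<Rightarrow> nat" where
  "time_bound Skip = 1"
| "time_bound (Const x k) = 1"
| "time_bound (Copy x y) = 1"
| "time_bound (Add x y z) = 1"
| "time_bound (Sub x y z) = 1"
| "time_bound (Load x a y) = 1"
| "time_bound (Store a y x) = 1"
| "time_bound (Seq P Q) = time_bound P + time_bound Q"
| "time_bound (Cond b P Q) = time_bound P + time_bound Q + 1"
| "time_bound (Loop b P) = 0"

lemma uexec_ev:
  "loop_free P \<Longrightarrow> \<exists>t\<le>time_bound P. uexec P s t (ev P s)"
proof (induction P arbitrary: s)
  case (Seq P Q)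
  obtain t where t: "t \<le> time_bound P" "uexec P s t (ev P s)" using Seq by auto
  obtain u where u: "u \<le> time_bound Q" "uexec Q (ev P s) u (ev Q (ev P s))" using Seq by auto
  show ?case using USeq[OF t(2) u(2)] t(1) u(1) by (intro exI[of _ "t + u"]) simp
next
  case (Cond b P Q)
  obtain t where t: "t \<le> time_bound P" "uexec P s t (ev P s)" using Cond by auto
  obtain u where u: "u \<le> time_bound Q" "uexec Q s u (ev Q s)" using Cond by auto
  show ?case
  proof (cases "holds b s")
    case True
    then show ?thesis using UCondT[OF True t(2), of Q] t(1) by (intro exI[of _ "t + 1"]) simp
  next
    case False
    then show ?thesis using UCondF[OF False u(2), of P] u(1) by (intro exI[of _ "u + 1"]) simp
  qed
qed (auto intro: uexec.intros[simplified])

text \<open>Each round costs the body and one test, and the measure of the represented abstract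
  state bounds the number of rounds. The final \<open>+ 1\<close> is the failing test.\<close>

lemma uexec_loop:
  assumes lf: "loop_free P"
    and step: "\<And>\<sigma> s. I \<sigma> s \<Longrightarrow> holds b s \<Longrightarrow> \<exists>\<sigma>'. I \<sigma>' (ev P s) \<and> \<phi> \<sigma>' < \<phi> \<sigma>"
    and init: "I \<sigma> s"
  shows "\<exists>t s' \<sigma>'. uexec (Loop b P) s t s' \<and> t \<le> (time_bound P + 1) * \<phi> \<sigma> + 1 \<and> I \<sigma>' s' \<and> \<not> holds b s'"
  using init
proof (induction "\<phi> \<sigma>" arbitrary: \<sigma> s rule: less_induct)
  case less
  show ?case
  proof (cases "holds b s")
    case False
    then show ?thesis using less.prems ULoopF[OF False, of P]
      by (intro exI[of _ 1] exI[of _ s] exI[of _ \<sigma>]) simp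
  next
    case True
    obtain \<sigma>' where \<sigma>': "I \<sigma>' (ev P s)" "\<phi> \<sigma>' < \<phi> \<sigma>" using step[OF less.prems True] by blast
    obtain u where u: "u \<le> time_bound P" "uexec P s u (ev P s)" using uexec_ev[OF lf] by blast
    obtain t s' \<sigma>'' where t: "uexec (Loop b P) (ev P s) t s'" "t \<le> (time_bound P + 1) * \<phi> \<sigma>' + 1"
      "I \<sigma>'' s'" "\<not> holds b s'" using less.hyps[OF \<sigma>'(2,1)] by blast
    have "u + t + 1 \<le> (time_bound P + 1) * (\<phi> \<sigma>' + 1) + 1" using u(1) t(2) by (simp add: algebra_simps)
    also have "\<dots> \<le> (time_bound P + 1) * \<phi> \<sigma> + 1" using \<sigma>'(2) by (intro add_mono mult_le_mono) auto
    finally show ?thesis using ULoopT[OF True u(2) t(1)] t(3,4) by blast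
  qed
qed

fun block :: "prog list \<Rightarrow> prog" where
  "block [] = Skip"
| "block (P # Ps) = Seq P (block Ps)"

definition code :: "'a :: finite \<Rightarrow> nat" where
  "code = (SOME f. bij_betw f UNIV {0..<card (UNIV :: 'a set)})"

definition decode :: "nat \<Rightarrow> 'a :: finite" where
  "decode = inv code"

lemma bij_code: "bij_betw (code :: 'a :: finite \<Rightarrow> nat) UNIV {0..<card (UNIV :: 'a set)}"
  using someI_ex[OF ex_bij_betw_finite_nat[OF finite[of "UNIV :: 'a set"]]] unfolding code_def .

lemma decode_code [simp]: "decode (code x) = x"
  unfolding decode_def by (rule inv_f_f) (use bij_code in \<open>auto simp: bij_betw_def\<close>)

lemma code_less: "code (x :: 'a :: finite) < card (UNIV :: 'a set)"
  using bij_code bij_betwE by fastforce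

lemma code_decode: "k < card (UNIV :: 'a :: finite set) \<Longrightarrow> code (decode k :: 'a) = k"
  unfolding decode_def by (rule f_inv_into_f) (use bij_code in \<open>auto simp: bij_betw_def\<close>)

lemma code_eq [simp]: "code x = code y \<longleftrightarrow> x = y"
  by (metis decode_code)

text \<open>Any function on small numbers is computed by a decision tree; register \<open>4\<close> is scratch.\<close>

primrec branch :: "nat \<Rightarrow> reg \<Rightarrow> (nat \<Rightarrow> prog) \<Rightarrow> prog" where
  "branch 0 x k = Skip"
| "branch (Suc i) x k = Seq (Const 4 i) (Cond (Equal x 4) (k i) (branch i x k))"

primrec lut :: "nat \<Rightarrow> reg list \<Rightarrow> (nat list \<Rightarrow> nat) \<Rightarrow> reg \<Rightarrow> prog" where
  "lut N [] = (\<lambda>f z. Const z (f []))"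
| "lut N (x # xs) = (\<lambda>f z. branch N x (\<lambda>i. lut N xs (\<lambda>vs. f (i # vs)) z))"

lemma branch_props:
  "(\<And>i. loop_free (k i)) \<Longrightarrow> loop_free (branch N x k)"
  "(\<And>i. tame (k i)) \<Longrightarrow> tame (branch N x k)"
  by (induction N) auto

lemma lut_props: "loop_free (lut N xs f z)" "z \<noteq> 3 \<Longrightarrow> tame (lut N xs f z)"
  by (induction xs arbitrary: f) (auto intro!: branch_props)

lemma set_reg_sel [simp]:
  "regs (set_reg x k s) y = (if y = x then k else regs s y)" "arrs (set_reg x k s) = arrs s"
  by (simp_all add: set_reg_def)

lemma set_cell_sel [simp]:
  "regs (set_cell a i k s) = regs s"
  "arrs (set_cell a i k s) b = (if b = a then (arrs s a)(i := k) else arrs s b)"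
  by (simp_all add: set_cell_def)

lemma ev_branch:
  assumes "regs s x < N" "x \<noteq> 4"
  shows "ev (branch N x k) s = ev (k (regs s x)) (set_reg 4 (regs s x) s)"
  using assms
proof (induction N arbitrary: s)
  case (Suc N)
  have "set_reg 4 a (set_reg 4 b s) = set_reg 4 a s" for a b by (simp add: set_reg_def)
  then show ?case using Suc.IH[of "set_reg 4 N s"] Suc.prems by (auto simp: less_Suc_eq)
qed simp

text \<open>The case of register \<open>4\<close> is a tautology: it leaves the scratch register
  unspecified.\<close>

lemma ev_lut:
  assumes "\<forall>x\<in>set xs. regs s x < N \<and> x \<noteq> 4" "z \<noteq> 4"
  shows "regs (ev (lut N xs f z) s) r =
      (if r = z then f (map (regs s) xs) else if r = 4 then regs (ev (lut N xs f z) s) 4 else regs s r)"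
    "arrs (ev (lut N xs f z) s) = arrs s"
proof -
  have "(\<forall>r. r \<noteq> 4 \<longrightarrow> regs (ev (lut N xs f z) s) r = (if r = z then f (map (regs s) xs) else regs s r)) \<and>
    arrs (ev (lut N xs f z) s) = arrs s"
    using assms(1)
  proof (induction xs arbitrary: f s)
    case (Cons x xs)
    let ?s = "set_reg 4 (regs s x) s"
    have m: "map (regs ?s) xs = map (regs s) xs" using Cons.prems by auto
    have "\<forall>x\<in>set xs. regs ?s x < N \<and> x \<noteq> 4" using Cons.prems by auto
    from Cons.IH[OF this, of "\<lambda>vs. f (regs s x # vs)"]
    show ?case using ev_branch[of s x N] Cons.prems unfolding m by auto
  qed auto
  then show "regs (ev (lut N xs f z) s) r =
      (if r = z then f (map (regs s) xs) else if r = 4 then regs (ev (lut N xs f z) s) 4 else regs s r)"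
    "arrs (ev (lut N xs f z) s) = arrs s" using assms(2) by auto
qed

text \<open>
  A family of stacks: array \<open>13\<close> holds the heads, \<open>14\<close> the successors and \<open>15\<close> the items
  of the cells, \<open>0\<close> is the null pointer, and register \<open>18\<close> counts the cells.
\<close>

inductive chain :: "(nat \<Rightarrow> nat) \<Rightarrow> (nat \<Rightarrow> nat) \<Rightarrow> nat \<Rightarrow> nat \<Rightarrow> nat list \<Rightarrow> bool" for nxt item cc where
  chain_Nil: "chain nxt item cc 0 []"
| chain_Cons: "0 < c \<Longrightarrow> c \<le> cc \<Longrightarrow> chain nxt item cc (nxt c) xs \<Longrightarrow> chain nxt item cc c (item c # xs)"

lemma chain_extend:
  "chain nxt item cc c xs \<Longrightarrow> chain (nxt(Suc cc := a)) (item(Suc cc := b)) (Suc cc) c xs"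
proof (induction rule: chain.induct)
  case (chain_Cons c xs)
  have e: "(nxt(Suc cc := a)) c = nxt c" "(item(Suc cc := b)) c = item c" using chain_Cons.hyps by simp_all
  have "chain (nxt(Suc cc := a)) (item(Suc cc := b)) (Suc cc) c ((item(Suc cc := b)) c # xs)"
  proof (rule chain.chain_Cons)
    show "chain (nxt(Suc cc := a)) (item(Suc cc := b)) (Suc cc) ((nxt(Suc cc := a)) c) xs"
      unfolding e(1) by (rule chain_Cons.IH)
  qed (use chain_Cons.hyps in auto)
  then show ?case unfolding e(2) .
qed (rule chain.chain_Nil)

lemma chain_null: "chain nxt item cc c xs \<Longrightarrow> c = 0 \<longleftrightarrow> xs = []"
  by (auto elim: chain.cases)

lemma chain_head: "chain nxt item cc c (x # xs) \<Longrightarrow> item c = x \<and> chain nxt item cc (nxt c) xs"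
  by (auto elim: chain.cases)

definition stacks :: "(nat \<Rightarrow> nat list) \<Rightarrow> state \<Rightarrow> bool" where
  "stacks a s \<longleftrightarrow> (\<forall>v. chain (arrs s 14) (arrs s 15) (regs s 18) (arrs s 13 v) (a v))"

definition push_code :: "reg \<Rightarrow> reg \<Rightarrow> prog" where
  "push_code v x = block [Add 18 18 3, Store 15 18 x, Load 17 13 v, Store 14 18 17, Store 13 v 18]"

text \<open>Popped cells are not recycled; the cell counter grows with every push and is thus
  bounded by the running time.\<close>

definition pop_code :: "reg \<Rightarrow> reg \<Rightarrow> prog" where
  "pop_code v x = block [Load 17 13 v, Load x 15 17, Load 17 14 17, Store 13 v 17]"

lemma push_code_sel:
  "regs (ev (push_code v x) s) r = (if r = 18 then regs s 18 + regs s 3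
     else if r = 17 then regs (ev (push_code v x) s) 17 else regs s r)"
  "b \<noteq> 13 \<Longrightarrow> b \<noteq> 14 \<Longrightarrow> b \<noteq> 15 \<Longrightarrow> arrs (ev (push_code v x) s) b = arrs s b"
  unfolding push_code_def by simp_all

lemma stacks_push:
  assumes "stacks a s" "regs s 3 = 1" "v \<noteq> 17" "v \<noteq> 18" "x \<noteq> 17" "x \<noteq> 18"
  shows "stacks (a(regs s v := regs s x # a (regs s v))) (ev (push_code v x) s)"
proof -
  let ?s = "ev (push_code v x) s" and ?c = "Suc (regs s 18)"
  have e: "arrs ?s 14 = (arrs s 14)(?c := arrs s 13 (regs s v))" "arrs ?s 15 = (arrs s 15)(?c := regs s x)"
    "regs ?s 18 = ?c" "arrs ?s 13 = (arrs s 13)(regs s v := ?c)"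
    using assms unfolding push_code_def by simp_all
  have old: "chain (arrs ?s 14) (arrs ?s 15) (regs ?s 18) (arrs s 13 w) (a w)" for w
    using assms(1) unfolding stacks_def e by (intro chain_extend) blast
  have "chain (arrs ?s 14) (arrs ?s 15) (regs ?s 18) ?c (arrs ?s 15 ?c # a (regs s v))"
    using old[of "regs s v"] by (intro chain.chain_Cons) (simp_all add: e)
  then have "chain (arrs ?s 14) (arrs ?s 15) (regs ?s 18) ?c (regs s x # a (regs s v))"
    by (simp add: e)
  then show ?thesis using old unfolding stacks_def e(4) by simp
qed

lemma pop_code_sel:
  "r \<noteq> 17 \<Longrightarrow> r \<noteq> x \<Longrightarrow> regs (ev (pop_code v x) s) r = regs s r"
  "b \<noteq> 13 \<Longrightarrow> arrs (ev (pop_code v x) s) b = arrs s b"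
  unfolding pop_code_def by simp_all

lemma stacks_pop:
  assumes "stacks a s" "a (regs s v) = h # t" "v \<noteq> 17" "v \<noteq> x" "x \<noteq> 17" "x \<noteq> 18"
  shows "stacks (a(regs s v := t)) (ev (pop_code v x) s)" "regs (ev (pop_code v x) s) x = h"
proof -
  let ?s = "ev (pop_code v x) s"
  have c: "chain (arrs s 14) (arrs s 15) (regs s 18) (arrs s 13 (regs s v)) (h # t)"
    using assms(1,2) unfolding stacks_def by metis
  have e: "arrs ?s 14 = arrs s 14" "arrs ?s 15 = arrs s 15" "regs ?s 18 = regs s 18"
    "regs ?s x = arrs s 15 (arrs s 13 (regs s v))"
    "arrs ?s 13 = (arrs s 13)(regs s v := arrs s 14 (arrs s 13 (regs s v)))"
    using assms(3-6) unfolding pop_code_def by simp_all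
  show "regs ?s x = h" using chain_head[OF c] e by simp
  show "stacks (a(regs s v := t)) ?s"
    using assms(1) chain_head[OF c] unfolding stacks_def e by simp
qed

lemma stacks_null: "stacks a s \<Longrightarrow> arrs s 13 v = 0 \<longleftrightarrow> a v = []"
  unfolding stacks_def using chain_null by blast

lemma stacks_cong:
  assumes "stacks a s" "arrs s' 13 = arrs s 13" "arrs s' 14 = arrs s 14" "arrs s' 15 = arrs s 15"
    "regs s' 18 = regs s 18"
  shows "stacks a s'"
  using assms unfolding stacks_def by simp

section \<open>The elimination program\<close>

declare lut.simps [simp del] branch.simps [simp del]

text \<open>One range for all arguments of decision trees: codes of tables, codes of tuples, and the
  operation kinds \<open>0\<close> and \<open>1\<close>. There are 64 tuples and therefore
  \<open>2 ^ 64\<close> tables; the trees are enormous but do not depend on the input.\<close>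

definition code_size :: nat where
  "code_size = card (UNIV :: tuple set set) + card (UNIV :: tuple set) + 2"

lemma code_less_size [simp]:
  "code (T :: tuple set) < code_size" "code (t :: tuple) < code_size"
  using code_less[of T] code_less[of t] unfolding code_size_def by auto

lemma two_le_size: "k < 2 \<Longrightarrow> k < code_size"
  unfolding code_size_def by simp

definition flip_table :: "nat list \<Rightarrow> nat" where
  "flip_table vs = code ((decode (vs ! 0) :: tuple set)\<inverse>)"

definition flip_tuple :: "nat list \<Rightarrow> nat" where
  "flip_tuple vs = code (prod.swap (decode (vs ! 0) :: tuple))"

definition combine_codes :: "nat list \<Rightarrow> nat" where
  "combine_codes vs = code (combine (vs ! 0) (decode (vs ! 1)) (decode (vs ! 2)) (decode (vs ! 3)))"

definition pick_codes :: "nat list \<Rightarrow> tuple \<times> tuple \<times> tuple" where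
  "pick_codes vs = pick (vs ! 0) (decode (vs ! 1)) (decode (vs ! 2)) (decode (vs ! 3)) (decode (vs ! 4))"

definition tuple0 :: tuple where
  "tuple0 = ((state0, False), (state0, False))"

lemma lut_sel:
  assumes "\<forall>x\<in>set xs. regs s x < code_size \<and> x \<noteq> 4" "z \<noteq> 4"
  shows "regs (ev (lut code_size xs f z) s) z = f (map (regs s) xs)"
    "r \<noteq> 4 \<Longrightarrow> r \<noteq> z \<Longrightarrow> regs (ev (lut code_size xs f z) s) r = regs s r"
    "arrs (ev (lut code_size xs f z) s) = arrs s"
  using ev_lut(1)[OF assms, of f z] ev_lut(1)[OF assms, of f r] ev_lut(2)[OF assms] by simp_all

lemma push_sel:
  "r \<noteq> 17 \<Longrightarrow> r \<noteq> 18 \<Longrightarrow> regs (ev (push_code v x) s) r = regs s r"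
  "b \<noteq> 13 \<Longrightarrow> b \<noteq> 14 \<Longrightarrow> b \<noteq> 15 \<Longrightarrow> arrs (ev (push_code v x) s) b = arrs s b"
  using push_code_sel by simp_all

lemma stacks_push':
  assumes "stacks a s" "regs s 3 = 1" "v \<noteq> 17" "v \<noteq> 18" "x \<noteq> 17" "x \<noteq> 18" "regs s v = w" "regs s x = y"
  shows "stacks (push w y a) (ev (push_code v x) s)"
  using stacks_push[OF assms(1-6)] assms(7,8) unfolding push_def by simp

definition load_table :: "reg \<Rightarrow> reg \<Rightarrow> prog" where
  "load_table r c = block [Load r 4 c, Load 17 2 c, Cond (Equal 17 7) Skip (lut code_size [r] flip_table r)]"

definition tables_code :: prog where
  "tables_code = block [load_table 25 20, load_table 26 21, load_table 27 22]"

text \<open>The default tuple stored here is the starting value of the backward pass for links that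
  survive; for a link consumed later it is overwritten before it is read.\<close>

definition link_code :: prog where
  "link_code = block [tables_code, lut code_size [19, 25, 26, 27] combine_codes 28, Add 6 6 3,
     Store 2 6 23, Store 3 6 24, Store 4 6 28, Store 6 6 19, Store 7 6 7,
     Store 8 6 20, Store 9 6 21, Store 10 6 22, Store 11 20 3, Store 11 21 3, Store 11 22 3,
     Const 17 (code tuple0), Store 5 6 17, Const 17 (code ({} :: tuple set)),
     Cond (Equal 28 17) (Const 13 0) Skip,
     push_code 23 6, push_code 24 6, push_code 5 23, push_code 5 24]"

definition close_code :: prog where
  "close_code = block [push_code 7 15, push_code 7 8, push_code 7 9, push_code 7 10, Copy 7 0]"

definition merge_code :: "reg \<Rightarrow> prog" where
  "merge_code r = block [Const 19 1, Copy 20 2, Copy 21 r, Copy 22 15, Copy 23 7, Copy 24 16,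
     link_code, close_code]"

definition eliminate_code :: prog where
  "eliminate_code = block [Const 19 0, Copy 20 8, Copy 21 9, Copy 22 10, Copy 23 11, Copy 24 12,
     link_code, Store 12 7 3, Const 15 0, close_code]"

definition idle_code :: prog where
  "idle_code = block [Load 17 13 5, Cond (Equal 17 2) (Const 14 0)
     (block [pop_code 5 16, Load 32 12 16, Cond (Equal 32 3) Skip
        (block [Copy 7 16, Copy 8 2, Copy 9 2, Copy 10 2, Copy 11 0, Copy 12 0])])]"

definition link_step_code :: prog where
  "link_step_code = block [Load 16 2 15, Cond (Equal 16 7) (Load 16 3 15) Skip,
     Cond (Equal 16 0) (Cond (Equal 8 2) (Copy 8 15) (merge_code 8))
    (Cond (Equal 11 0) (block [Copy 9 15, Copy 11 16])
    (Cond (Equal 11 16) (merge_code 9)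
    (Cond (Equal 12 0) (block [Copy 10 15, Copy 12 16])
    (Cond (Equal 12 16) (merge_code 10) close_code))))]"

definition busy_code :: prog where
  "busy_code = block [Load 17 13 7, Cond (Equal 17 2) eliminate_code
     (block [pop_code 7 15, Load 32 11 15, Cond (Equal 32 3) Skip link_step_code])]"

definition step_code :: prog where
  "step_code = Cond (Equal 7 0) idle_code busy_code"

text \<open>
  Apart from the registers listed here, \<open>4\<close>, \<open>17\<close> and \<open>32\<close> are scratch, \<open>15\<close> and \<open>16\<close> hold the
  link just popped and its other end, \<open>19\<close> to \<open>24\<close> the arguments of \<open>link_code\<close>, and \<open>25\<close>
  to \<open>28\<close> tables.  Array \<open>5\<close> will hold the tuples chosen by the backward pass.
\<close>

definition represents :: "nat \<Rightarrow> nat \<Rightarrow> machine \<Rightarrow> state \<Rightarrow> bool" where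
  "represents n m \<sigma> s \<longleftrightarrow>
     regs s 0 = n \<and> regs s 1 = m \<and> regs s 2 = 0 \<and> regs s 3 = 1 \<and> regs s 5 = Suc n \<and>
     regs s 6 = rcnt \<sigma> \<and> regs s 7 = cur \<sigma> \<and> regs s 8 = s0 \<sigma> \<and> regs s 9 = s1 \<sigma> \<and> regs s 10 = s2 \<sigma> \<and>
     regs s 11 = p1 \<sigma> \<and> regs s 12 = p2 \<sigma> \<and> regs s 13 = of_bool (feas \<sigma>) \<and> regs s 14 = of_bool (go \<sigma>) \<and>
     arrs s 2 = ex \<sigma> \<and> arrs s 3 = ey \<sigma> \<and> arrs s 4 = (\<lambda>e. code (etab \<sigma> e)) \<and>
     arrs s 6 = kind \<sigma> \<and> arrs s 7 = vtx \<sigma> \<and>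
     arrs s 8 = ch0 \<sigma> \<and> arrs s 9 = ch1 \<sigma> \<and> arrs s 10 = ch2 \<sigma> \<and>
     arrs s 11 = (\<lambda>e. of_bool (e \<in> rdead \<sigma>)) \<and> arrs s 12 = (\<lambda>v. of_bool (v \<in> vdead \<sigma>)) \<and>
     (\<forall>e. kind \<sigma> e < 2) \<and> (\<forall>e. arrs s 5 e < card (UNIV :: tuple set)) \<and>
     (\<forall>e. m < e \<and> e \<le> rcnt \<sigma> \<longrightarrow> arrs s 5 e = code tuple0) \<and> stacks (adj \<sigma>) s"

lemma representsD:
  assumes "represents n m \<sigma> s"
  shows "regs s 0 = n" "regs s 1 = m" "regs s 2 = 0" "regs s 3 = 1" "regs s 5 = Suc n"
    "regs s 6 = rcnt \<sigma>" "regs s 7 = cur \<sigma>" "regs s 8 = s0 \<sigma>" "regs s 9 = s1 \<sigma>" "regs s 10 = s2 \<sigma>"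
    "regs s 11 = p1 \<sigma>" "regs s 12 = p2 \<sigma>" "regs s 13 = of_bool (feas \<sigma>)" "regs s 14 = of_bool (go \<sigma>)"
    "arrs s 2 = ex \<sigma>" "arrs s 3 = ey \<sigma>" "arrs s 4 = (\<lambda>e. code (etab \<sigma> e))"
    "arrs s 6 = kind \<sigma>" "arrs s 7 = vtx \<sigma>"
    "arrs s 8 = ch0 \<sigma>" "arrs s 9 = ch1 \<sigma>" "arrs s 10 = ch2 \<sigma>"
    "arrs s 11 = (\<lambda>e. of_bool (e \<in> rdead \<sigma>))" "arrs s 12 = (\<lambda>v. of_bool (v \<in> vdead \<sigma>))"
    "regs s (Suc 0) = m"
  using assms unfolding represents_def by simp_all

lemma representsQ:
  assumes "represents n m \<sigma> s"
  shows "\<forall>e. kind \<sigma> e < 2" "\<forall>e. arrs s 5 e < card (UNIV :: tuple set)"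
    "\<forall>e. m < e \<and> e \<le> rcnt \<sigma> \<longrightarrow> arrs s 5 e = code tuple0" "stacks (adj \<sigma>) s"
  by (insert assms[unfolded represents_def], (elim conjE, assumption)+)

lemma load_table_sel:
  assumes "arrs s 4 = (\<lambda>e. code (etab L e))" "arrs s 2 = ex L" "regs s 7 = v" "regs s c = e"
    "r \<noteq> 4" "r \<noteq> 17" "r \<noteq> 7" "c \<noteq> r"
  shows "regs (ev (load_table r c) s) r = code (table_from L v e)"
    "x \<noteq> 4 \<Longrightarrow> x \<noteq> 17 \<Longrightarrow> x \<noteq> r \<Longrightarrow> regs (ev (load_table r c) s) x = regs s x"
    "arrs (ev (load_table r c) s) = arrs s"
  using assms unfolding load_table_def table_from_def
  by (simp_all add: lut_sel flip_table_def)

lemma tables_code_sel: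
  assumes "arrs s 4 = (\<lambda>e. code (etab L e))" "arrs s 2 = ex L" "regs s 7 = v"
  shows "regs (ev tables_code s) 25 = code (table_from L v (regs s 20))"
    "regs (ev tables_code s) 26 = code (table_from L v (regs s 21))"
    "regs (ev tables_code s) 27 = code (table_from L v (regs s 22))"
    "x \<noteq> 4 \<Longrightarrow> x \<noteq> 17 \<Longrightarrow> x \<noteq> 25 \<Longrightarrow> x \<noteq> 26 \<Longrightarrow> x \<noteq> 27 \<Longrightarrow> regs (ev tables_code s) x = regs s x"
    "arrs (ev tables_code s) = arrs s"
  using assms unfolding tables_code_def
  by (simp_all add: load_table_sel[where L = L and v = v])

lemma represents_new_link:
  assumes rep: "represents n m \<sigma> s" and k: "regs s 19 = k" "k < 2"
    and c: "regs s 20 = c0" "regs s 21 = c1" "regs s 22 = c2" "regs s 23 = x" "regs s 24 = y"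
  shows "represents n m (new_link n k c0 c1 c2 x y \<sigma>) (ev link_code s)"
    "regs (ev link_code s) 15 = regs s 15"
proof -
  note r = representsD[OF rep]
  let ?T = "combine k (table_from \<sigma> (cur \<sigma>) c0) (table_from \<sigma> (cur \<sigma>) c1) (table_from \<sigma> (cur \<sigma>) c2)"
  have r4: "arrs s 4 = (\<lambda>e. code (etab \<sigma> e))" "arrs s 2 = ex \<sigma>" "regs s 7 = cur \<sigma>" using r by simp_all
  define t where "t = ev tables_code s"
  have t: "regs t 25 = code (table_from \<sigma> (cur \<sigma>) c0)" "regs t 26 = code (table_from \<sigma> (cur \<sigma>) c1)"
    "regs t 27 = code (table_from \<sigma> (cur \<sigma>) c2)" "arrs t = arrs s"
    "\<And>x. x \<noteq> 4 \<Longrightarrow> x \<noteq> 17 \<Longrightarrow> x \<noteq> 25 \<Longrightarrow> x \<noteq> 26 \<Longrightarrow> x \<noteq> 27 \<Longrightarrow> regs t x = regs s x"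
    using tables_code_sel[OF r4] c unfolding t_def by simp_all
  define u where "u = ev (lut code_size [19, 25, 26, 27] combine_codes 28) t"
  have pre: "\<forall>x\<in>set [19, 25, 26, 27]. regs t x < code_size \<and> x \<noteq> (4::nat)"
    using t k two_le_size by simp
  have u: "regs u 28 = code ?T" "arrs u = arrs s"
    "\<And>x. x \<noteq> 4 \<Longrightarrow> x \<noteq> 17 \<Longrightarrow> x \<noteq> 25 \<Longrightarrow> x \<noteq> 26 \<Longrightarrow> x \<noteq> 27 \<Longrightarrow> x \<noteq> 28 \<Longrightarrow> regs u x = regs s x"
    using lut_sel[OF pre, of 28] t k(1) unfolding u_def by (simp_all add: combine_codes_def)
  define w where "w = ev (block [Add 6 6 3,
     Store 2 6 23, Store 3 6 24, Store 4 6 28, Store 6 6 19, Store 7 6 7,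
     Store 8 6 20, Store 9 6 21, Store 10 6 22, Store 11 20 3, Store 11 21 3, Store 11 22 3,
     Const 17 (code tuple0), Store 5 6 17, Const 17 (code ({} :: tuple set)),
     Cond (Equal 28 17) (Const 13 0) Skip]) u"
  let ?g = "Suc (rcnt \<sigma>)"
  have w: "arrs w 2 = (ex \<sigma>)(?g := x)" "arrs w 3 = (ey \<sigma>)(?g := y)"
    "arrs w 4 = (\<lambda>e. code (((etab \<sigma>)(?g := ?T)) e))"
    "arrs w 5 = (arrs s 5)(?g := code tuple0)"
    "arrs w 6 = (kind \<sigma>)(?g := k)" "arrs w 7 = (vtx \<sigma>)(?g := cur \<sigma>)"
    "arrs w 8 = (ch0 \<sigma>)(?g := c0)" "arrs w 9 = (ch1 \<sigma>)(?g := c1)" "arrs w 10 = (ch2 \<sigma>)(?g := c2)"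
    "arrs w 11 = (\<lambda>e. of_bool (e \<in> rdead \<sigma> \<union> {c0, c1, c2}))" "arrs w 12 = arrs s 12"
    "arrs w 13 = arrs s 13" "arrs w 14 = arrs s 14" "arrs w 15 = arrs s 15"
    "regs w 6 = ?g" "regs w 13 = of_bool (feas \<sigma> \<and> ?T \<noteq> {})"
    unfolding w_def using u(1,2) u(3)[of 3] u(3)[of 6] u(3)[of 7] u(3)[of 13] u(3)[of 19] u(3)[of 20] u(3)[of 21]
      u(3)[of 22] u(3)[of 23] u(3)[of 24] r k c by (simp_all add: fun_eq_iff)
  have w': "regs w x = regs s x" if "x \<notin> {4, 6, 13, 17, 25, 26, 27, 28}" for x
    unfolding w_def using u(3)[of x] that by auto
  have ev: "ev link_code s = ev (push_code 5 24) (ev (push_code 5 23) (ev (push_code 24 6) (ev (push_code 23 6) w)))"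
    unfolding link_code_def w_def u_def t_def by simp
  have rw: "regs w 0 = n" "regs w 1 = m" "regs w 2 = 0" "regs w 3 = 1" "regs w 5 = Suc n" "regs w 7 = cur \<sigma>"
    "regs w 8 = s0 \<sigma>" "regs w 9 = s1 \<sigma>" "regs w 10 = s2 \<sigma>" "regs w 11 = p1 \<sigma>" "regs w 12 = p2 \<sigma>"
    "regs w 14 = of_bool (go \<sigma>)" "regs w 15 = regs s 15" "regs w 18 = regs s 18" "regs w 23 = x" "regs w 24 = y"
    using r c by (subst w'; simp)+
  have "stacks (adj \<sigma>) s" using representsQ(4)[OF rep] .
  then have "stacks (adj \<sigma>) w"
    by (rule stacks_cong) (fact w rw)+
  then have "stacks (push x ?g (adj \<sigma>)) (ev (push_code 23 6) w)"
    by (rule stacks_push') (simp_all add: w(15) rw)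
  then have "stacks (push y ?g (push x ?g (adj \<sigma>))) (ev (push_code 24 6) (ev (push_code 23 6) w))"
    by (rule stacks_push') (simp_all add: w(15) rw push_sel)
  then have "stacks (push (Suc n) x (push y ?g (push x ?g (adj \<sigma>))))
      (ev (push_code 5 23) (ev (push_code 24 6) (ev (push_code 23 6) w)))"
    by (rule stacks_push') (simp_all add: w(15) rw push_sel)
  then have st: "stacks (push (Suc n) y (push (Suc n) x (push y ?g (push x ?g (adj \<sigma>))))) (ev link_code s)"
    unfolding ev by (rule stacks_push') (simp_all add: w(15) rw push_sel)
  show "regs (ev link_code s) 15 = regs s 15"
    unfolding ev by (simp add: rw push_sel)
  note r5 = representsQ(1-3)[OF rep] representsD(24)[OF rep]
  have sel: "regs (ev link_code s) x = regs w x" if "x \<noteq> 17" "x \<noteq> 18" for x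
    unfolding ev using that by (simp add: push_sel)
  have sela: "arrs (ev link_code s) x = arrs w x" if "x \<noteq> 13" "x \<noteq> 14" "x \<noteq> 15" for x
    unfolding ev using that by (simp add: push_sel)
  have n5: "\<forall>e. ((arrs s 5)(?g := code tuple0)) e < card (UNIV :: tuple set)"
    "\<forall>e. m < e \<and> e \<le> ?g \<longrightarrow> ((arrs s 5)(?g := code tuple0)) e = code tuple0"
    "\<forall>e. ((kind \<sigma>)(?g := k)) e < 2"
    using r5(1-3) k(2) code_less[of tuple0] by (simp_all add: le_Suc_eq)
  show "represents n m (new_link n k c0 c1 c2 x y \<sigma>) (ev link_code s)"
    unfolding represents_def new_link_sel
    by (intro conjI)
      (simp_all only: sel sela rw w r5(4) n5 st, insert r5(3), simp_all add: le_Suc_eq)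
qed

lemma represents_cong:
  assumes "represents n m \<sigma> s"
    "\<And>x. x \<in> {0, 1, 2, 3, 5, 6, 7, 8, 9, 10, 11, 12, 13, 14, 18} \<Longrightarrow> regs s' x = regs s x"
    "\<And>a. a \<in> {2, 3, 4, 5, 6, 7, 8, 9, 10, 11, 12, 13, 14, 15} \<Longrightarrow> arrs s' a = arrs s a"
  shows "represents n m \<sigma> s'"
proof -
  have "stacks (adj \<sigma>) s'"
    by (rule stacks_cong[of _ s]) (use assms in \<open>auto simp: represents_def\<close>)
  then show ?thesis using assms unfolding represents_def by simp
qed

lemma represents_close:
  assumes rep: "represents n m \<sigma> s"
  shows "represents n m (close n (regs s 15) \<sigma>) (ev close_code s)"
proof -
  note r = representsD[OF rep] and st = representsQ(4)[OF rep]
  let ?s1 = "ev (push_code 7 15) s"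
  let ?s2 = "ev (push_code 7 8) ?s1"
  let ?s3 = "ev (push_code 7 9) ?s2"
  let ?s4 = "ev (push_code 7 10) ?s3"
  have ev: "ev close_code s = ev (Copy 7 0) ?s4" unfolding close_code_def by simp
  have "stacks (push (cur \<sigma>) (regs s 15) (adj \<sigma>)) ?s1"
    by (rule stacks_push'[OF st]) (simp_all add: r)
  then have "stacks (push (cur \<sigma>) (s0 \<sigma>) (push (cur \<sigma>) (regs s 15) (adj \<sigma>))) ?s2"
    by (rule stacks_push') (simp_all add: r push_sel)
  then have "stacks (push (cur \<sigma>) (s1 \<sigma>) (push (cur \<sigma>) (s0 \<sigma>) (push (cur \<sigma>) (regs s 15) (adj \<sigma>)))) ?s3"
    by (rule stacks_push') (simp_all add: r push_sel)
  then have "stacks (push (cur \<sigma>) (s2 \<sigma>) (push (cur \<sigma>) (s1 \<sigma>) (push (cur \<sigma>) (s0 \<sigma>)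
      (push (cur \<sigma>) (regs s 15) (adj \<sigma>))))) ?s4"
    by (rule stacks_push') (simp_all add: r push_sel)
  then have st': "stacks (adj (close n (regs s 15) \<sigma>)) (ev close_code s)"
    unfolding ev close_sel by (rule stacks_cong) simp_all
  have "s0 (close n e \<sigma>) = s0 \<sigma>" "s1 (close n e \<sigma>) = s1 \<sigma>" "s2 (close n e \<sigma>) = s2 \<sigma>"
    "p1 (close n e \<sigma>) = p1 \<sigma>" "p2 (close n e \<sigma>) = p2 \<sigma>" for e
    unfolding close_def by simp_all
  then show ?thesis using st' representsQ(1-3)[OF rep] unfolding represents_def ev
    by (simp add: push_sel r del: close_sel(15))
qed

lemma represents_merge:
  assumes rep: "represents n m \<sigma> s" and q: "q \<in> {8, 9, 10}"
  shows "represents n m (merge_links n (regs s q) (regs s 15) (regs s 16) \<sigma>) (ev (merge_code q) s)"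
proof -
  note r = representsD[OF rep] and st = representsQ(4)[OF rep]
  define t where "t = ev (block [Const 19 1, Copy 20 2, Copy 21 q, Copy 22 15, Copy 23 7, Copy 24 16]) s"
  have t: "regs t 19 = 1" "regs t 20 = 0" "regs t 21 = regs s q" "regs t 22 = regs s 15"
    "regs t 23 = cur \<sigma>" "regs t 24 = regs s 16" "arrs t = arrs s"
    "\<And>x. x \<notin> {19, 20, 21, 22, 23, 24} \<Longrightarrow> regs t x = regs s x"
    unfolding t_def using r q by auto
  have rt: "represents n m \<sigma> t" by (rule represents_cong[OF rep]) (use t in auto)
  note l = represents_new_link[OF rt t(1) _ t(2-6)]
  have "represents n m (close n (regs (ev link_code t) 15)
      (new_link n 1 0 (regs s q) (regs s 15) (cur \<sigma>) (regs s 16) \<sigma>)) (ev close_code (ev link_code t))"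
    by (rule represents_close) (rule l(1), simp)
  moreover have "ev (merge_code q) s = ev close_code (ev link_code t)"
    unfolding merge_code_def t_def by simp
  moreover have "regs (ev link_code t) 15 = regs s 15" using l(2) t by simp
  ultimately show ?thesis unfolding merge_links_def by simp
qed

lemma represents_eliminate:
  assumes rep: "represents n m \<sigma> s"
  shows "represents n m (eliminate n \<sigma>) (ev eliminate_code s)"
proof -
  note r = representsD[OF rep] and st = representsQ(4)[OF rep]
  define t where "t = ev (block [Const 19 0, Copy 20 8, Copy 21 9, Copy 22 10, Copy 23 11, Copy 24 12]) s"
  have t: "regs t 19 = 0" "regs t 20 = s0 \<sigma>" "regs t 21 = s1 \<sigma>" "regs t 22 = s2 \<sigma>"
    "regs t 23 = p1 \<sigma>" "regs t 24 = p2 \<sigma>" "arrs t = arrs s"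
    "\<And>x. x \<notin> {19, 20, 21, 22, 23, 24} \<Longrightarrow> regs t x = regs s x"
    unfolding t_def using r by simp_all
  have rt: "represents n m \<sigma> t" by (rule represents_cong[OF rep]) (use t in auto)
  let ?\<rho> = "new_link n 0 (s0 \<sigma>) (s1 \<sigma>) (s2 \<sigma>) (p1 \<sigma>) (p2 \<sigma>) \<sigma>"
  have l: "represents n m ?\<rho> (ev link_code t)"
    using represents_new_link(1)[OF rt t(1) _ t(2-6)] by simp
  define u where "u = ev (block [Store 12 7 3, Const 15 0]) (ev link_code t)"
  have "stacks (adj ?\<rho>) u"
    by (rule stacks_cong[OF representsQ(4)[OF l]]) (simp_all add: u_def)
  then have "represents n m (?\<rho>\<lparr>vdead := insert (cur \<sigma>) (vdead \<sigma>)\<rparr>) u"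
    using representsQ(1-3)[OF l] unfolding represents_def by (simp add: representsD[OF l] u_def fun_eq_iff)
  from represents_close[OF this]
  have "represents n m (eliminate n \<sigma>) (ev close_code u)"
    unfolding eliminate_def by (simp add: u_def)
  moreover have "ev eliminate_code s = ev close_code u"
    unfolding eliminate_code_def t_def u_def by simp
  ultimately show ?thesis by simp
qed

lemma represents_idle:
  assumes rep: "represents n m \<sigma> s" and cur: "cur \<sigma> = n"
  shows "represents n m (step n \<sigma>) (ev idle_code s)"
proof -
  note r = representsD[OF rep] and st = representsQ(4)[OF rep]
  define t where "t = ev (Load 17 13 5) s"
  have rt: "represents n m \<sigma> t" by (rule represents_cong[OF rep]) (auto simp: t_def)
  note r' = representsD[OF rt] and st' = representsQ(4)[OF rt]
  have null: "regs t 17 = 0 \<longleftrightarrow> adj \<sigma> (Suc n) = []"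
    using stacks_null[OF st, of "Suc n"] by (simp add: t_def r)
  show ?thesis
  proof (cases "adj \<sigma> (Suc n)")
    case Nil
    then have "ev idle_code s = ev (Const 14 0) t"
      unfolding idle_code_def using null r' by (simp add: t_def)
    moreover have "stacks (adj \<sigma>) (ev (Const 14 0) t)"
      by (rule stacks_cong[OF st']) simp_all
    ultimately show ?thesis using representsQ(1-3)[OF rt] Nil cur unfolding represents_def step_def
      by (simp add: r')
  next
    case (Cons w ws)
    let ?p = "ev (pop_code 5 16) t"
    define u where "u = ev (Load 32 12 16) ?p"
    have "adj \<sigma> (regs t 5) = w # ws" using Cons r' by simp
    from stacks_pop[OF st' this, of 16]
    have p: "stacks ((adj \<sigma>)(Suc n := ws)) ?p" "regs ?p 16 = w" by (simp_all add: r')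
    have "stacks ((adj \<sigma>)(Suc n := ws)) u"
      by (rule stacks_cong[OF p(1)]) (simp_all add: u_def)
    then have ru: "represents n m (\<sigma>\<lparr>adj := (adj \<sigma>)(Suc n := ws)\<rparr>) u"
      using representsQ(1-3)[OF rt] unfolding represents_def by (simp add: pop_code_sel r' u_def)
    have u: "regs u 32 = of_bool (w \<in> vdead \<sigma>)" "regs u 16 = w" "regs u 3 = 1"
      using p unfolding u_def by (simp_all add: pop_code_sel r')
    let ?q = "block [Copy 7 16, Copy 8 2, Copy 9 2, Copy 10 2, Copy 11 0, Copy 12 0]"
    have ev: "ev idle_code s = (if w \<in> vdead \<sigma> then u else ev ?q u)"
      using null Cons r' u unfolding idle_code_def
      by (simp add: t_def[symmetric] u_def[symmetric] del: block.simps(2)) (simp add: t_def u_def)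
    show ?thesis
    proof (cases "w \<in> vdead \<sigma>")
      case True
      then show ?thesis using ru ev cur Cons unfolding step_def by simp
    next
      case False
      have "stacks ((adj \<sigma>)(Suc n := ws)) (ev ?q u)"
        by (rule stacks_cong[of _ u]) (use representsQ(4)[OF ru] in simp_all)
      then have "represents n m (\<sigma>\<lparr>adj := (adj \<sigma>)(Suc n := ws), cur := w, s0 := 0, s1 := 0, s2 := 0, p1 := n, p2 := n\<rparr>) (ev ?q u)"
        using representsQ(1-3)[OF ru] representsD[OF ru] u unfolding represents_def by simp
      then show ?thesis using ev cur Cons False unfolding step_def by simp
    qed
  qed
qed

lemma represents_link_step:
  assumes rep: "represents n m \<tau> s"
    and e: "regs s 15 = e" and y: "y = (if ex \<tau> e = cur \<tau> then ey \<tau> e else ex \<tau> e)"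
  shows "represents n m
     (if y = n then (if s0 \<tau> = 0 then \<tau>\<lparr>s0 := e\<rparr> else merge_links n (s0 \<tau>) e y \<tau>)
      else if p1 \<tau> = n then \<tau>\<lparr>s1 := e, p1 := y\<rparr>
      else if p1 \<tau> = y then merge_links n (s1 \<tau>) e y \<tau>
      else if p2 \<tau> = n then \<tau>\<lparr>s2 := e, p2 := y\<rparr>
      else if p2 \<tau> = y then merge_links n (s2 \<tau>) e y \<tau>
      else close n e \<tau>) (ev link_step_code s)" (is "represents n m ?\<tau> _")
proof -
  note r = representsD[OF rep] and st = representsQ(4)[OF rep]
  define t where "t = ev (block [Load 16 2 15, Cond (Equal 16 7) (Load 16 3 15) Skip]) s"
  have t: "regs t 16 = y" "arrs t = arrs s" "\<And>x. x \<noteq> 16 \<Longrightarrow> regs t x = regs s x"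
    using r e y unfolding t_def by simp_all
  have rt: "represents n m \<tau> t" by (rule represents_cong[OF rep]) (use t in auto)
  note r' = representsD[OF rt] and st' = representsQ(4)[OF rt]
  have te: "regs t 15 = e" using t e by simp
  have fill: "represents n m (\<tau>\<lparr>s0 := e\<rparr>) (ev (Copy 8 15) t)"
    "represents n m (\<tau>\<lparr>s1 := e, p1 := y\<rparr>) (ev (block [Copy 9 15, Copy 11 16]) t)"
    "represents n m (\<tau>\<lparr>s2 := e, p2 := y\<rparr>) (ev (block [Copy 10 15, Copy 12 16]) t)"
    using representsQ(1-3)[OF rt] t(1) te st' unfolding represents_def
    by (simp_all add: r' stacks_cong[of "adj \<tau>" t])
  have mg: "represents n m (merge_links n (s0 \<tau>) e y \<tau>) (ev (merge_code 8) t)"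
    "represents n m (merge_links n (s1 \<tau>) e y \<tau>) (ev (merge_code 9) t)"
    "represents n m (merge_links n (s2 \<tau>) e y \<tau>) (ev (merge_code 10) t)"
    using represents_merge[OF rt, of 8] represents_merge[OF rt, of 9] represents_merge[OF rt, of 10]
      r' t(1) te by simp_all
  have cl: "represents n m (close n e \<tau>) (ev close_code t)"
    using represents_close[OF rt] te by simp
  have "ev link_step_code s =
     (if y = n then (if s0 \<tau> = 0 then ev (Copy 8 15) t else ev (merge_code 8) t)
      else if p1 \<tau> = n then ev (block [Copy 9 15, Copy 11 16]) t
      else if p1 \<tau> = y then ev (merge_code 9) t
      else if p2 \<tau> = n then ev (block [Copy 10 15, Copy 12 16]) t
      else if p2 \<tau> = y then ev (merge_code 10) t
      else ev close_code t)"
  proof -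
    have "ev link_step_code s = ev (Cond (Equal 16 0) (Cond (Equal 8 2) (Copy 8 15) (merge_code 8))
    (Cond (Equal 11 0) (block [Copy 9 15, Copy 11 16])
    (Cond (Equal 11 16) (merge_code 9)
    (Cond (Equal 12 0) (block [Copy 10 15, Copy 12 16])
    (Cond (Equal 12 16) (merge_code 10) close_code))))) t"
      unfolding link_step_code_def t_def by (simp del: ev.simps(9))
    then show ?thesis by (simp add: r' t(1))
  qed
  then show ?thesis using fill mg cl by (auto simp del: ev.simps block.simps)
qed

lemma represents_busy:
  assumes rep: "represents n m \<sigma> s" and cur: "cur \<sigma> \<noteq> n"
  shows "represents n m (step n \<sigma>) (ev busy_code s)"
proof -
  note r = representsD[OF rep] and st = representsQ(4)[OF rep]
  define t where "t = ev (Load 17 13 7) s"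
  have rt: "represents n m \<sigma> t" by (rule represents_cong[OF rep]) (auto simp: t_def)
  note r' = representsD[OF rt] and st' = representsQ(4)[OF rt]
  have null: "regs t 17 = 0 \<longleftrightarrow> adj \<sigma> (cur \<sigma>) = []"
    using stacks_null[OF st, of "cur \<sigma>"] by (simp add: t_def r)
  have ev: "ev busy_code s = (if adj \<sigma> (cur \<sigma>) = [] then ev eliminate_code t
      else ev (block [pop_code 7 15, Load 32 11 15, Cond (Equal 32 3) Skip link_step_code]) t)"
    using null r' unfolding busy_code_def t_def by simp
  show ?thesis
  proof (cases "adj \<sigma> (cur \<sigma>)")
    case Nil
    then show ?thesis using ev represents_eliminate[OF rt] cur unfolding step_def by simp
  next
    case (Cons e es)
    let ?p = "ev (pop_code 7 15) t"
    define u where "u = ev (Load 32 11 15) ?p"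
    define \<tau> where "\<tau> = \<sigma>\<lparr>adj := (adj \<sigma>)(cur \<sigma> := es)\<rparr>"
    have "adj \<sigma> (regs t 7) = e # es" using Cons r' by simp
    from stacks_pop[OF st' this, of 15]
    have p: "stacks ((adj \<sigma>)(cur \<sigma> := es)) ?p" "regs ?p 15 = e" by (simp_all add: r')
    have "stacks ((adj \<sigma>)(cur \<sigma> := es)) u"
      by (rule stacks_cong[OF p(1)]) (simp_all add: u_def)
    then have ru: "represents n m \<tau> u"
      using representsQ(1-3)[OF rt] unfolding represents_def \<tau>_def by (simp add: pop_code_sel r' u_def)
    have u: "regs u 32 = of_bool (e \<in> rdead \<sigma>)" "regs u 15 = e" "regs u 3 = 1"
      using p unfolding u_def by (simp_all add: pop_code_sel r')
    have ev': "ev busy_code s = (if e \<in> rdead \<sigma> then u else ev link_step_code u)"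
    proof -
      have "ev (block [pop_code 7 15, Load 32 11 15, Cond (Equal 32 3) Skip link_step_code]) t =
          (if regs u 32 = regs u 3 then u else ev link_step_code u)"
        unfolding u_def by simp
      then show ?thesis using ev Cons u by simp
    qed
    have "represents n m (if e \<in> rdead \<sigma> then \<tau> else
       (let y = (if ex \<sigma> e = cur \<sigma> then ey \<sigma> e else ex \<sigma> e) in
        if y = n then (if s0 \<sigma> = 0 then \<tau>\<lparr>s0 := e\<rparr> else merge_links n (s0 \<sigma>) e y \<tau>)
        else if p1 \<sigma> = n then \<tau>\<lparr>s1 := e, p1 := y\<rparr>
        else if p1 \<sigma> = y then merge_links n (s1 \<sigma>) e y \<tau>
        else if p2 \<sigma> = n then \<tau>\<lparr>s2 := e, p2 := y\<rparr>
        else if p2 \<sigma> = y then merge_links n (s2 \<sigma>) e y \<tau>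
        else close n e \<tau>)) (ev busy_code s)"
    proof (cases "e \<in> rdead \<sigma>")
      case True
      then show ?thesis unfolding ev' using ru by simp
    next
      case False
      have eqs: "ex \<tau> = ex \<sigma>" "ey \<tau> = ey \<sigma>" "cur \<tau> = cur \<sigma>" "s0 \<tau> = s0 \<sigma>" "s1 \<tau> = s1 \<sigma>" "s2 \<tau> = s2 \<sigma>"
        "p1 \<tau> = p1 \<sigma>" "p2 \<tau> = p2 \<sigma>" unfolding \<tau>_def by simp_all
      show ?thesis unfolding ev' Let_def if_not_P[OF False]
        using represents_link_step[OF ru u(2) refl, unfolded eqs] .
    qed
    moreover have "step n \<sigma> = (if e \<in> rdead \<sigma> then \<tau> else
       (let y = (if ex \<sigma> e = cur \<sigma> then ey \<sigma> e else ex \<sigma> e) in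
        if y = n then (if s0 \<sigma> = 0 then \<tau>\<lparr>s0 := e\<rparr> else merge_links n (s0 \<sigma>) e y \<tau>)
        else if p1 \<sigma> = n then \<tau>\<lparr>s1 := e, p1 := y\<rparr>
        else if p1 \<sigma> = y then merge_links n (s1 \<sigma>) e y \<tau>
        else if p2 \<sigma> = n then \<tau>\<lparr>s2 := e, p2 := y\<rparr>
        else if p2 \<sigma> = y then merge_links n (s2 \<sigma>) e y \<tau>
        else close n e \<tau>))"
      unfolding step_def if_not_P[OF cur] Cons list.case Let_def \<tau>_def ..
    ultimately show ?thesis by (simp only:)
  qed
qed

lemma represents_step:
  assumes "represents n m \<sigma> s"
  shows "represents n m (step n \<sigma>) (ev step_code s)"
proof -
  have "holds (Equal 7 0) s \<longleftrightarrow> cur \<sigma> = n" using representsD[OF assms] by simp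
  then show ?thesis unfolding step_code_def ev.simps
    using represents_idle[OF assms] represents_busy[OF assms] by (simp only: split: if_split) blast
qed

section \<open>The unwinding program\<close>

definition store_tuple :: "reg \<Rightarrow> reg \<Rightarrow> prog" where
  "store_tuple c r = block [Load 17 2 c, Cond (Equal 17 7) Skip (lut code_size [r] flip_tuple r), Store 5 c r]"

text \<open>The same choice of a decomposition is looked up four times, for the color and for the
  three child tuples. Register \<open>7\<close> takes the vertex of the operation so that
  \<open>tables_code\<close> can be reused, and array \<open>0\<close>, which held edge endpoints,
  receives the colors.\<close>

definition unwind_code :: prog where
  "unwind_code = block [Load 7 7 31, Load 19 6 31, Load 20 8 31, Load 21 9 31, Load 22 10 31,
     tables_code, Load 28 5 31,
     lut code_size [19, 25, 26, 27, 28] (\<lambda>vs. color_of (pick_codes vs)) 32, Store 0 7 32,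
     lut code_size [19, 25, 26, 27, 28] (\<lambda>vs. code (fst (pick_codes vs))) 23,
     lut code_size [19, 25, 26, 27, 28] (\<lambda>vs. code (fst (snd (pick_codes vs)))) 24,
     lut code_size [19, 25, 26, 27, 28] (\<lambda>vs. code (snd (snd (pick_codes vs)))) 30,
     store_tuple 20 23, store_tuple 21 24, store_tuple 22 30, Sub 31 31 3]"

text \<open>The part of the state that stays fixed while the log is undone, apart from the counter;
  tuples and colors are followed separately because they change.\<close>

definition unwinding :: "nat \<Rightarrow> machine \<Rightarrow> nat \<Rightarrow> state \<Rightarrow> bool" where
  "unwinding m \<sigma> g s \<longleftrightarrow> regs s 1 = m \<and> regs s 3 = 1 \<and> regs s 13 = of_bool (feas \<sigma>) \<and> regs s 31 = g \<and>
     arrs s 2 = ex \<sigma> \<and> arrs s 4 = (\<lambda>e. code (etab \<sigma> e)) \<and> arrs s 6 = kind \<sigma> \<and> arrs s 7 = vtx \<sigma> \<and>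
     arrs s 8 = ch0 \<sigma> \<and> arrs s 9 = ch1 \<sigma> \<and> arrs s 10 = ch2 \<sigma>"

definition tuples :: "state \<Rightarrow> nat \<Rightarrow> tuple" where
  "tuples s e = decode (arrs s 5 e)"

lemma store_tuple_sel:
  assumes x: "arrs s 2 = ex L" "regs s 7 = v" and r: "regs s r = code (a :: tuple)"
    and ne: "r \<noteq> 4" "r \<noteq> 17" "r \<noteq> 7" "c \<noteq> r" "c \<noteq> 4" "c \<noteq> 17"
  shows "arrs (ev (store_tuple c r) s) 5 = (arrs s 5)(regs s c := code (turn L v (regs s c) a))"
    "b \<noteq> 5 \<Longrightarrow> arrs (ev (store_tuple c r) s) b = arrs s b"
    "x \<noteq> 4 \<Longrightarrow> x \<noteq> 17 \<Longrightarrow> x \<noteq> r \<Longrightarrow> regs (ev (store_tuple c r) s) x = regs s x"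
  using assms unfolding store_tuple_def turn_def
  by (simp_all add: lut_sel flip_tuple_def)

lemma unwind_code_step:
  assumes u: "unwinding m \<sigma> (Suc g) s" and k: "kind \<sigma> (Suc g) < 2"
    and A: "\<forall>e. arrs s 5 e < card (UNIV :: tuple set)"
  defines "a \<equiv> pick_at \<sigma> (Suc g) (tuples s (Suc g))"
  shows "unwinding m \<sigma> g (ev unwind_code s)"
    "\<forall>e. arrs (ev unwind_code s) 5 e < card (UNIV :: tuple set)"
    "tuples (ev unwind_code s) = undo \<sigma> (Suc g) a (tuples s)"
    "arrs (ev unwind_code s) 0 = (arrs s 0)(vtx \<sigma> (Suc g) := color_of a)"
proof -
  have r: "regs s 1 = m" "regs s 3 = 1" "regs s 13 = of_bool (feas \<sigma>)" "regs s 31 = Suc g"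
    "arrs s 2 = ex \<sigma>" "arrs s 4 = (\<lambda>e. code (etab \<sigma> e))" "arrs s 6 = kind \<sigma>" "arrs s 7 = vtx \<sigma>"
    "arrs s 8 = ch0 \<sigma>" "arrs s 9 = ch1 \<sigma>" "arrs s 10 = ch2 \<sigma>"
    using u unfolding unwinding_def by simp_all
  let ?v = "vtx \<sigma> (Suc g)" and ?c0 = "ch0 \<sigma> (Suc g)" and ?c1 = "ch1 \<sigma> (Suc g)" and ?c2 = "ch2 \<sigma> (Suc g)"
  define t where "t = ev (block [Load 7 7 31, Load 19 6 31, Load 20 8 31, Load 21 9 31, Load 22 10 31]) s"
  have t: "regs t 7 = ?v" "regs t 19 = kind \<sigma> (Suc g)" "regs t 20 = ?c0" "regs t 21 = ?c1" "regs t 22 = ?c2"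
    "arrs t = arrs s" "regs t 31 = Suc g" "regs t 1 = m" "regs t 3 = 1" "regs t 13 = of_bool (feas \<sigma>)"
    unfolding t_def by (simp_all add: r r(1)[simplified])
  have t4: "arrs t 4 = (\<lambda>e. code (etab \<sigma> e))" "arrs t 2 = ex \<sigma>" by (simp_all add: t r)
  note tc = tables_code_sel[OF t4 t(1)]
  define w where "w = ev (Load 28 5 31) (ev tables_code t)"
  have w: "regs w 25 = code (table_from \<sigma> ?v ?c0)" "regs w 26 = code (table_from \<sigma> ?v ?c1)"
    "regs w 27 = code (table_from \<sigma> ?v ?c2)" "regs w 28 = code (tuples s (Suc g))" "arrs w = arrs s"
    "regs w 7 = ?v" "regs w 19 = kind \<sigma> (Suc g)" "regs w 20 = ?c0" "regs w 21 = ?c1" "regs w 22 = ?c2"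
    "regs w 31 = Suc g" "regs w 1 = m" "regs w 3 = 1" "regs w 13 = of_bool (feas \<sigma>)"
    using A code_decode[of "arrs s 5 (Suc g)", where 'a = tuple]
    unfolding w_def by (simp_all add: tc t t(8)[simplified] tuples_def)
  have pre: "\<forall>x\<in>set [19, 25, 26, 27, 28]. regs z x < code_size \<and> x \<noteq> (4::nat)"
    if "regs z 19 = regs w 19" "regs z 25 = regs w 25" "regs z 26 = regs w 26" "regs z 27 = regs w 27"
      "regs z 28 = regs w 28" for z
    using two_le_size[OF k] that w by simp
  have pk: "pick_codes (map (regs z) [19, 25, 26, 27, 28]) = a"
    if "regs z 19 = regs w 19" "regs z 25 = regs w 25" "regs z 26 = regs w 26" "regs z 27 = regs w 27"
      "regs z 28 = regs w 28" for z
    unfolding pick_codes_def a_def pick_at_def using that w by (simp add: eval_nat_numeral)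
  define w1 where "w1 = ev (Store 0 7 32) (ev (lut code_size [19, 25, 26, 27, 28] (\<lambda>vs. color_of (pick_codes vs)) 32) w)"
  note l0 = lut_sel[OF pre[OF refl refl refl refl refl], of 32] and k0 = pk[OF refl refl refl refl refl]
  have w1: "regs w1 x = regs w x" if "x \<noteq> 4" "x \<noteq> 32" for x
    unfolding w1_def using that by (simp add: l0)
  have w1a: "arrs w1 = (arrs w)(0 := (arrs w 0)(?v := color_of a))"
    unfolding w1_def ev.simps set_cell_sel(2) fun_eq_iff
    by (simp only: l0 k0 w(6) simp_thms fun_upd_apply set_cell_sel)
  define w2 where "w2 = ev (lut code_size [19, 25, 26, 27, 28] (\<lambda>vs. code (fst (pick_codes vs))) 23) w1"
  have e1: "regs w1 19 = regs w 19" "regs w1 25 = regs w 25" "regs w1 26 = regs w 26" "regs w1 27 = regs w 27"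
    "regs w1 28 = regs w 28" by (simp_all add: w1)
  note l1 = lut_sel[OF pre[OF e1], of 23] and k1 = pk[OF e1]
  have w2: "regs w2 23 = code (fst a)" "arrs w2 = arrs w1" "\<And>x. x \<noteq> 4 \<Longrightarrow> x \<noteq> 23 \<Longrightarrow> regs w2 x = regs w1 x"
    unfolding w2_def by (simp_all add: l1 k1 del: list.map)
  define w3 where "w3 = ev (lut code_size [19, 25, 26, 27, 28] (\<lambda>vs. code (fst (snd (pick_codes vs)))) 24) w2"
  have e2: "regs w2 19 = regs w 19" "regs w2 25 = regs w 25" "regs w2 26 = regs w 26" "regs w2 27 = regs w 27"
    "regs w2 28 = regs w 28" by (simp_all add: w1 w2)
  note l2 = lut_sel[OF pre[OF e2], of 24] and k2 = pk[OF e2]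
  have w3: "regs w3 24 = code (fst (snd a))" "arrs w3 = arrs w2" "\<And>x. x \<noteq> 4 \<Longrightarrow> x \<noteq> 24 \<Longrightarrow> regs w3 x = regs w2 x"
    unfolding w3_def by (simp_all add: l2 k2 del: list.map)
  define w4 where "w4 = ev (lut code_size [19, 25, 26, 27, 28] (\<lambda>vs. code (snd (snd (pick_codes vs)))) 30) w3"
  have e3: "regs w3 19 = regs w 19" "regs w3 25 = regs w 25" "regs w3 26 = regs w 26" "regs w3 27 = regs w 27"
    "regs w3 28 = regs w 28" by (simp_all add: w1 w2 w3)
  note l3 = lut_sel[OF pre[OF e3], of 30] and k3 = pk[OF e3]
  have w4: "regs w4 30 = code (snd (snd a))" "arrs w4 = arrs w3" "\<And>x. x \<noteq> 4 \<Longrightarrow> x \<noteq> 30 \<Longrightarrow> regs w4 x = regs w3 x"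
    unfolding w4_def by (simp_all add: l3 k3 del: list.map)
  have r4: "regs w4 7 = ?v" "regs w4 20 = ?c0" "regs w4 21 = ?c1" "regs w4 22 = ?c2" "regs w4 31 = Suc g"
    "regs w4 1 = m" "regs w4 3 = 1" "regs w4 13 = of_bool (feas \<sigma>)"
    "regs w4 23 = code (fst a)" "regs w4 24 = code (fst (snd a))" "arrs w4 2 = ex \<sigma>" "arrs w4 5 = arrs s 5"
    "arrs w4 = (arrs s)(0 := (arrs s 0)(?v := color_of a))"
  proof -
    show a: "arrs w4 = (arrs s)(0 := (arrs s 0)(?v := color_of a))" by (simp add: w4 w3 w2 w w1a)
    show "arrs w4 2 = ex \<sigma>" "arrs w4 5 = arrs s 5" unfolding a using r(5) by simp_all
  qed (simp_all add: w4 w3 w2 w1 w w(12)[simplified])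
  define w5 where "w5 = ev (store_tuple 20 23) w4"
  note st5 = store_tuple_sel[of w4 \<sigma> ?v 23 "fst a" 20, OF r4(11,1,9), simplified]
  define w6 where "w6 = ev (store_tuple 21 24) w5"
  have r5: "arrs w5 2 = ex \<sigma>" "regs w5 7 = ?v" "regs w5 24 = code (fst (snd a))"
    unfolding w5_def by (simp_all add: st5 r4 r)
  note st6 = store_tuple_sel[of w5 \<sigma> ?v 24 "fst (snd a)" 21, OF r5, simplified]
  define w7 where "w7 = ev (store_tuple 22 30) w6"
  have r6: "arrs w6 2 = ex \<sigma>" "regs w6 7 = ?v" "regs w6 30 = code (snd (snd a))"
    unfolding w6_def by (simp_all add: st6 r5) (simp add: w5_def st5 w4)
  note st7 = store_tuple_sel[of w6 \<sigma> ?v 30 "snd (snd a)" 22, OF r6, simplified]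
  have ev: "ev unwind_code s = ev (Sub 31 31 3) w7"
    unfolding unwind_code_def w7_def w6_def w5_def w4_def w3_def w2_def w1_def w_def t_def by simp
  have r7: "regs w7 x = regs w4 x" if "x \<notin> {4, 17, 23, 24, 30}" for x
    using that unfolding w7_def w6_def w5_def
    by (simp add: st7[unfolded w6_def w5_def] st6[unfolded w5_def] st5)
  have a7: "arrs w7 b = arrs w4 b" if "b \<noteq> 5" for b
    using that unfolding w7_def w6_def w5_def
    by (simp add: st7[unfolded w6_def w5_def] st6[unfolded w5_def] st5)
  have c: "regs w5 21 = ?c1" "regs w6 22 = ?c2"
    unfolding w6_def w5_def by (simp_all add: st6[unfolded w5_def] st5 r4)
  have a57: "arrs w7 5 = ((arrs s 5)(?c0 := code (turn \<sigma> ?v ?c0 (fst a)), ?c1 := code (turn \<sigma> ?v ?c1 (fst (snd a))),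
      ?c2 := code (turn \<sigma> ?v ?c2 (snd (snd a)))))"
    unfolding w7_def st7(1) c unfolding w6_def st6(1) c unfolding w5_def st5(1) by (simp add: r4)
  show "\<forall>e. arrs (ev unwind_code s) 5 e < card (UNIV :: tuple set)"
    unfolding ev using A code_less[where 'a = tuple] by (simp add: a57)
  show "tuples (ev unwind_code s) = undo \<sigma> (Suc g) a (tuples s)"
    unfolding ev undo_def by (simp add: fun_eq_iff tuples_def a57 split: prod.split)
  show "arrs (ev unwind_code s) 0 = (arrs s 0)(?v := color_of a)"
    unfolding ev by (simp add: a7 r4)
  show "unwinding m \<sigma> g (ev unwind_code s)"
    unfolding unwinding_def ev by (simp add: a7 r7 r4 r r4(6)[simplified])
qed

section \<open>Reading the input\<close>

definition init_code :: prog where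
  "init_code = block [Const 3 1, Add 5 0 3, Const 17 (code trivial_table), Store 4 2 17, Store 11 2 3,
     Store 12 0 3, Const 13 1, Const 14 1, Copy 7 0]"

definition edge_code :: prog where
  "edge_code = block [Load 23 0 6, Load 24 1 6, Add 6 6 3, Store 2 6 23, Store 3 6 24,
     Const 17 (code edge_table), Store 4 6 17, push_code 23 6, push_code 24 6]"

definition vertex_code :: prog where
  "vertex_code = block [push_code 5 32, Add 32 32 3]"

text \<open>The default table is \<open>decode 0\<close> because the arrays of the machine start
  with zeros. Link \<open>0\<close> and vertex \<open>n\<close> are dead from the beginning, which
  lets them serve as markers for missing objects.\<close>

definition machine0 :: "nat \<Rightarrow> machine" where
  "machine0 n = \<lparr>ex = (\<lambda>_. 0), ey = (\<lambda>_. 0), etab = (\<lambda>_. decode 0)(0 := trivial_table), kind = (\<lambda>_. 0),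
     vtx = (\<lambda>_. 0), ch0 = (\<lambda>_. 0), ch1 = (\<lambda>_. 0), ch2 = (\<lambda>_. 0), rcnt = 0, rdead = {0}, vdead = {n},
     adj = (\<lambda>_. []), cur = n, s0 = 0, s1 = 0, s2 = 0, p1 = 0, p2 = 0, feas = True, go = True\<rparr>"

definition add_edge :: "nat \<Rightarrow> nat \<Rightarrow> machine \<Rightarrow> machine" where
  "add_edge x y \<sigma> = (let g = Suc (rcnt \<sigma>) in \<sigma>\<lparr>ex := (ex \<sigma>)(g := x), ey := (ey \<sigma>)(g := y),
     etab := (etab \<sigma>)(g := edge_table), rcnt := g, adj := push y g (push x g (adj \<sigma>))\<rparr>)"

text \<open>The invariant while the edges are read and no vertex is queued yet. No link has
  children, so nothing read so far has been consumed.\<close>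

definition building :: "nat \<Rightarrow> (nat \<times> nat) list \<Rightarrow> machine \<Rightarrow> bool" where
  "building n es \<sigma> \<longleftrightarrow> rcnt \<sigma> \<le> length es \<and>
     (\<forall>e. 1 \<le> e \<and> e \<le> rcnt \<sigma> \<longrightarrow> ex \<sigma> e = fst (es ! (e - 1)) \<and> ey \<sigma> e = snd (es ! (e - 1)) \<and> etab \<sigma> e = edge_table) \<and>
     etab \<sigma> 0 = trivial_table \<and> ch0 \<sigma> = (\<lambda>_. 0) \<and> ch1 \<sigma> = (\<lambda>_. 0) \<and> ch2 \<sigma> = (\<lambda>_. 0) \<and>
     rdead \<sigma> = {0} \<and> vdead \<sigma> = {n} \<and> cur \<sigma> = n \<and> feas \<sigma> \<and> go \<sigma> \<and>
     (\<forall>w\<le>n. set (adj \<sigma> w) \<subseteq> {..rcnt \<sigma>}) \<and>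
     (\<forall>w<n. \<forall>e. 1 \<le> e \<and> e \<le> rcnt \<sigma> \<longrightarrow> count_list (adj \<sigma> w) e = of_bool (ex \<sigma> e = w) + of_bool (ey \<sigma> e = w)) \<and>
     (\<Sum>w\<le>n. length (adj \<sigma> w)) = 2 * rcnt \<sigma> \<and> adj \<sigma> (Suc n) = []"

lemma building_machine0: "building n es (machine0 n)"
  unfolding building_def machine0_def by simp

lemma building_add_edge:
  assumes b: "building n es \<sigma>" and lt: "rcnt \<sigma> < length es"
    and xy: "es ! rcnt \<sigma> = (x, y)" "x < n" "y < n"
  shows "building n es (add_edge x y \<sigma>)"
proof -
  let ?\<tau> = "add_edge x y \<sigma>" and ?g = "Suc (rcnt \<sigma>)"
  have sel: "rcnt ?\<tau> = ?g" "ex ?\<tau> = (ex \<sigma>)(?g := x)" "ey ?\<tau> = (ey \<sigma>)(?g := y)"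
    "etab ?\<tau> = (etab \<sigma>)(?g := edge_table)" "ch0 ?\<tau> = ch0 \<sigma>" "ch1 ?\<tau> = ch1 \<sigma>" "ch2 ?\<tau> = ch2 \<sigma>"
    "rdead ?\<tau> = rdead \<sigma>" "vdead ?\<tau> = vdead \<sigma>" "cur ?\<tau> = cur \<sigma>" "feas ?\<tau> = feas \<sigma>" "go ?\<tau> = go \<sigma>"
    "adj ?\<tau> = push y ?g (push x ?g (adj \<sigma>))"
    unfolding add_edge_def Let_def by simp_all
  note b = b[unfolded building_def]
  have sub: "\<forall>w\<le>n. set (adj \<sigma> w) \<subseteq> {..rcnt \<sigma>}" using b by (elim conjE)
  have len: "(\<Sum>w\<le>n. length (adj ?\<tau> w)) = 2 * ?g"
    unfolding sel using b xy by (simp add: sum_length_push)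
  have "count_list (adj ?\<tau> w) e = of_bool (ex ?\<tau> e = w) + of_bool (ey ?\<tau> e = w)"
    if "w < n" "1 \<le> e" "e \<le> ?g" for w e
  proof (cases "e = ?g")
    case True
    have "?g \<notin> set (adj \<sigma> w)" using sub that(1) by (metis Suc_n_not_le_n atMost_iff less_imp_le subsetD)
    then show ?thesis unfolding sel using True by (simp add: count_list_0_iff eq_commute)
  next
    case False
    then show ?thesis unfolding sel using b that by auto
  qed
  moreover have "set (adj ?\<tau> w) \<subseteq> {..?g}" if "w \<le> n" for w
  proof -
    have "set (adj \<sigma> w) \<subseteq> {..?g}" using sub that by (metis atMost_subset_iff le_SucI order_refl subset_trans)
    then show ?thesis unfolding sel by (cases "w = x"; cases "w = y"; simp)
  qed
  moreover have "adj ?\<tau> (Suc n) = []" unfolding sel push_def using b xy by simp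
  ultimately show ?thesis unfolding building_def using b lt xy len
    by (simp add: sel le_Suc_eq)
qed

lemma represents_add_edge:
  assumes rep: "represents n m \<sigma> s" and lt: "rcnt \<sigma> < m"
    and xy: "arrs s 0 (rcnt \<sigma>) = x" "arrs s 1 (rcnt \<sigma>) = y"
  shows "represents n m (add_edge x y \<sigma>) (ev edge_code s)"
    "arrs (ev edge_code s) 0 = arrs s 0" "arrs (ev edge_code s) 1 = arrs s 1"
    "regs (ev edge_code s) 32 = regs s 32"
proof -
  note r = representsD[OF rep]
  let ?\<tau> = "add_edge x y \<sigma>" and ?g = "Suc (rcnt \<sigma>)"
  define w where "w = ev (block [Load 23 0 6, Load 24 1 6, Add 6 6 3, Store 2 6 23, Store 3 6 24,
     Const 17 (code edge_table), Store 4 6 17]) s"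
  have w: "regs w 23 = x" "regs w 24 = y" "regs w 6 = ?g" "regs w 3 = 1" "regs w 18 = regs s 18"
    "arrs w 2 = (ex \<sigma>)(?g := x)" "arrs w 3 = (ey \<sigma>)(?g := y)"
    "arrs w 4 = (\<lambda>e. code (((etab \<sigma>)(?g := edge_table)) e))"
    unfolding w_def using xy by (simp_all add: r fun_eq_iff)
  have wr: "regs w x = regs s x" if "x \<notin> {6, 17, 23, 24}" for x
    using that unfolding w_def by simp
  have wa: "arrs w b = arrs s b" if "b \<notin> {2, 3, 4}" for b
    using that unfolding w_def by simp
  have ev: "ev edge_code s = ev (push_code 24 6) (ev (push_code 23 6) w)"
    unfolding edge_code_def w_def by simp
  have "stacks (adj \<sigma>) w"
    by (rule stacks_cong[OF representsQ(4)[OF rep]]) (simp_all add: wa wr)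
  then have "stacks (push x ?g (adj \<sigma>)) (ev (push_code 23 6) w)"
    by (rule stacks_push') (simp_all add: w)
  then have st: "stacks (push y ?g (push x ?g (adj \<sigma>))) (ev edge_code s)"
    unfolding ev by (rule stacks_push') (simp_all add: w push_sel)
  have q3: "\<forall>e. m < e \<and> e \<le> ?g \<longrightarrow> arrs s 5 e = code tuple0" using lt by auto
  have sel: "rcnt ?\<tau> = ?g" "ex ?\<tau> = (ex \<sigma>)(?g := x)" "ey ?\<tau> = (ey \<sigma>)(?g := y)"
    "etab ?\<tau> = (etab \<sigma>)(?g := edge_table)" "ch0 ?\<tau> = ch0 \<sigma>" "ch1 ?\<tau> = ch1 \<sigma>" "ch2 ?\<tau> = ch2 \<sigma>"
    "rdead ?\<tau> = rdead \<sigma>" "vdead ?\<tau> = vdead \<sigma>" "cur ?\<tau> = cur \<sigma>" "feas ?\<tau> = feas \<sigma>" "go ?\<tau> = go \<sigma>"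
    "adj ?\<tau> = push y ?g (push x ?g (adj \<sigma>))" "kind ?\<tau> = kind \<sigma>" "vtx ?\<tau> = vtx \<sigma>"
    "s0 ?\<tau> = s0 \<sigma>" "s1 ?\<tau> = s1 \<sigma>" "s2 ?\<tau> = s2 \<sigma>" "p1 ?\<tau> = p1 \<sigma>" "p2 ?\<tau> = p2 \<sigma>"
    unfolding add_edge_def Let_def by simp_all
  show "represents n m ?\<tau> (ev edge_code s)"
    unfolding represents_def sel using st representsQ(1,2)[OF rep] q3
    unfolding ev by (simp add: push_sel w wr wa r)
  show "arrs (ev edge_code s) 0 = arrs s 0" "arrs (ev edge_code s) 1 = arrs s 1"
    "regs (ev edge_code s) 32 = regs s 32"
    unfolding ev by (simp_all add: push_sel wa wr)
qed

abbreviation queued :: "nat \<Rightarrow> nat \<Rightarrow> machine \<Rightarrow> machine" where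
  "queued n j \<sigma> \<equiv> \<sigma>\<lparr>adj := (adj \<sigma>)(Suc n := rev [0..<j])\<rparr>"

lemma represents_queue:
  assumes rep: "represents n m (queued n j \<sigma>) s" and j: "regs s 32 = j"
  shows "represents n m (queued n (Suc j) \<sigma>) (ev vertex_code s)" "regs (ev vertex_code s) 32 = Suc j"
proof -
  note r = representsD[OF rep]
  have ev: "ev vertex_code s = ev (Add 32 32 3) (ev (push_code 5 32) s)" unfolding vertex_code_def by simp
  show "regs (ev vertex_code s) 32 = Suc j" unfolding ev using j by (simp add: push_sel r)
  have "stacks (push (Suc n) j (adj (queued n j \<sigma>))) (ev (push_code 5 32) s)"
    by (rule stacks_push'[OF representsQ(4)[OF rep]]) (simp_all add: r j)
  moreover have "push (Suc n) j (adj (queued n j \<sigma>)) = adj (queued n (Suc j) \<sigma>)"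
    unfolding push_def by simp
  ultimately have "stacks (adj (queued n (Suc j) \<sigma>)) (ev (push_code 5 32) s)" by (simp only:)
  then have "stacks (adj (queued n (Suc j) \<sigma>)) (ev vertex_code s)"
    unfolding ev by (rule stacks_cong) simp_all
  then show "represents n m (queued n (Suc j) \<sigma>) (ev vertex_code s)"
    using representsQ(1-3)[OF rep] r unfolding represents_def unfolding ev
    by (simp add: push_sel del: upt_Suc)
qed

lemma original_links_building:
  assumes lg: "lists_graph n es V E" and b: "building n es \<sigma>" and full: "rcnt \<sigma> = length es"
  shows "original_links n \<sigma> {1..length es} E"
proof -
  have l: "V = {..<n}" "E = (\<lambda>(u, v). {u, v}) ` set es" "distinct (map (\<lambda>(u, v). {u, v}) es)" "simple_graph V E"
    by (insert lg[unfolded lists_graph_def], (elim conjE, assumption)+)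
  have e: "{ex \<sigma> g, ey \<sigma> g} = map (\<lambda>(u, v). {u, v}) es ! (g - 1)" "etab \<sigma> g = edge_table"
    if "g \<in> {1..length es}" for g
    using b that full unfolding building_def by (auto simp: nth_map case_prod_beta)
  show ?thesis
  proof
    show "simple_graph {..<n} E" using l(4) unfolding l(1) .
    show "E = (\<lambda>g. {ex \<sigma> g, ey \<sigma> g}) ` {1..length es}"
    proof -
      have "E = set (map (\<lambda>(u, v). {u, v}) es)" using l(2) by simp
      also have "\<dots> = (\<lambda>i. map (\<lambda>(u, v). {u, v}) es ! i) ` {0..<length es}"
        by (subst set_conv_nth) (auto simp del: nth_map)
      also have "\<dots> = (\<lambda>g. map (\<lambda>(u, v). {u, v}) es ! (g - 1)) ` {1..length es}"
      proof -
        have "{0..<length es} = (\<lambda>g. g - 1) ` {1..length es}"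
          by (auto simp: image_iff intro!: bexI[of _ "Suc _"])
        then show ?thesis by (simp add: image_image)
      qed
      also have "\<dots> = (\<lambda>g. {ex \<sigma> g, ey \<sigma> g}) ` {1..length es}" using e(1) by (intro image_cong) simp_all
      finally show ?thesis .
    qed
    show "inj_on (\<lambda>g. {ex \<sigma> g, ey \<sigma> g}) {1..length es}"
    proof (rule inj_onI)
      fix g h assume gh: "g \<in> {1..length es}" "h \<in> {1..length es}" "{ex \<sigma> g, ey \<sigma> g} = {ex \<sigma> h, ey \<sigma> h}"
      then have "map (\<lambda>(u, v). {u, v}) es ! (g - 1) = map (\<lambda>(u, v). {u, v}) es ! (h - 1)" using e(1) by simp
      then have "g - 1 = h - 1" using l(3) gh(1,2) by (subst (asm) nth_eq_iff_index_eq) auto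
      then show "g = h" using gh by auto
    qed
  qed (use e in auto)
qed

lemma original_links_cong:
  assumes "original_links n L R E"
    and eq: "\<And>g. g \<in> R \<Longrightarrow> ex L' g = ex L g \<and> ey L' g = ey L g \<and> etab L' g = etab L g"
  shows "original_links n L' R E"
proof -
  interpret original_links n L R E by fact
  have "(\<lambda>g. {ex L' g, ey L' g}) ` R = (\<lambda>g. {ex L g, ey L g}) ` R" by (rule image_cong) (simp_all add: eq)
  moreover have "inj_on (\<lambda>g. {ex L' g, ey L' g}) R"
    using inj by (rule inj_on_cong[THEN iffD2, rotated]) (simp add: eq)
  ultimately show ?thesis using fin sg E tab eq by unfold_locales simp_all
qed

text \<open>At most one link per step bounds the length of the log by the number of steps, and
  unchanged old entries keep the input links intact for the final argument.\<close>

lemma step_keeps: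
  "rcnt \<sigma> \<le> rcnt (step n \<sigma>)" "rcnt (step n \<sigma>) \<le> Suc (rcnt \<sigma>)"
  "e \<le> rcnt \<sigma> \<Longrightarrow> ex (step n \<sigma>) e = ex \<sigma> e \<and> ey (step n \<sigma>) e = ey \<sigma> e \<and> etab (step n \<sigma>) e = etab \<sigma> e"
  unfolding step_def merge_links_def eliminate_def
  by (simp_all add: Let_def split: list.split)

lemma represents_init:
  "represents n (length es) (machine0 n) (ev init_code (input_state n es))"
  "arrs (ev init_code (input_state n es)) 0 = arrs (input_state n es) 0"
  "arrs (ev init_code (input_state n es)) 1 = arrs (input_state n es) 1"
  "regs (ev init_code (input_state n es)) 32 = 0"
proof -
  let ?s = "ev init_code (input_state n es)"
  have d0: "code (decode 0 :: tuple set) = 0" "0 < card (UNIV :: tuple set)"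
    using code_decode[of 0, where 'a = "tuple set"] code_less[where 'a = tuple] code_less[where 'a = "tuple set"]
    by (metis gr0I less_nat_zero_code, metis gr0I less_nat_zero_code)
  show "arrs ?s 0 = arrs (input_state n es) 0" "arrs ?s 1 = arrs (input_state n es) 1" "regs ?s 32 = 0"
    unfolding init_code_def by (simp_all add: input_state_def)
  have "stacks (\<lambda>_. []) ?s"
    unfolding stacks_def init_code_def by (simp add: input_state_def chain.chain_Nil)
  then show "represents n (length es) (machine0 n) ?s"
    unfolding represents_def machine0_def using d0
    by (simp add: init_code_def input_state_def fun_eq_iff)
qed

lemma live_building:
  assumes "building n es \<sigma>"
  shows "live (queued n j \<sigma>) g = {1..g}"
proof -
  have "ch0 (queued n j \<sigma>) = (\<lambda>_. 0)" "ch1 (queued n j \<sigma>) = (\<lambda>_. 0)" "ch2 (queued n j \<sigma>) = (\<lambda>_. 0)"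
    using assms unfolding building_def by simp_all
  then show ?thesis by (induction g) (auto simp: after_op_def)
qed

text \<open>The initial potential is 27 + 6 per vertex for being alive and queued, 13 + 2 per edge
  for the link and its two list entries, and 1 for \<open>go\<close>.\<close>

lemma inv_queued:
  assumes lg: "lists_graph n es V E" and op: "outerplanar V E" and b: "building n es \<sigma>"
    and full: "rcnt \<sigma> = length es"
  shows "valid n (length es) (queued n n \<sigma>)"
    and "potential n (queued n n \<sigma>) \<le> 33 * n + 15 * length es + 1"
proof -
  let ?m = "length es" and ?\<sigma> = "queued n n \<sigma>"
  interpret original_links n \<sigma> "{1..?m}" E by (rule original_links_building[OF lg b full])
  have V: "V = {..<n}" using lg unfolding lists_graph_def by simp
  note b' = b[unfolded building_def]
  have links: "links ?\<sigma> = {1..?m}" using live_building[OF b, of n] full by simp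
  have al: "alive n ?\<sigma> = {..<n}" using b' unfolding alive_def by auto
  have graph: "link_graph n ?\<sigma> {1..?m} = E"
    unfolding link_graph_def E using ends by auto
  have ends': "ex \<sigma> g < n" "ey \<sigma> g < n" "ex \<sigma> g \<noteq> ey \<sigma> g" if "1 \<le> g" "g \<le> ?m" for g
    using ends[of g] that by simp_all
  have log: "log_ok n ?m ?\<sigma>"
    unfolding log_ok_def by (intro conjI) (use b' full ends' in \<open>simp_all split del: if_split\<close>, linarith+)
  have core: "core n ?m ?\<sigma>"
    unfolding core_def links al graph using b' full ends' op V by auto
  have cnt: "\<forall>w<n. \<forall>e. 1 \<le> e \<and> e \<le> rcnt \<sigma> \<longrightarrow> count_list (adj \<sigma> w) e = of_bool (ex \<sigma> e = w) + of_bool (ey \<sigma> e = w)"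
    using b' by (elim conjE)
  have cnt': "count_list (adj \<sigma> w) e = of_bool (incident ?\<sigma> e w)" if "w < n" "1 \<le> e" "e \<le> ?m" for w e
    using cnt[rule_format, of w e] that full ends'(3)[of e] unfolding incident_def by auto
  have lists: "lists_ok n ?\<sigma>"
    unfolding lists_ok_def links al
  proof (intro conjI ballI allI impI)
    show "set (adj ?\<sigma> w) \<subseteq> {..rcnt ?\<sigma>}" if "w \<le> n" for w using b' that by simp
    show "set (adj ?\<sigma> (Suc n)) \<subseteq> {..n}" by auto
    show "(if w = cur ?\<sigma> then of_bool (s0 ?\<sigma> = e) + of_bool (s1 ?\<sigma> = e) + of_bool (s2 ?\<sigma> = e) else 0) +
        count_list (adj ?\<sigma> w) e = of_bool (incident ?\<sigma> e w)" if "w \<in> {..<n}" "e \<in> {1..?m}" for w e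
      using b' that cnt'[of w e] by simp
  qed
  have slots: "slots_ok n ?\<sigma>" using b' unfolding slots_ok_def by simp
  have work: "work_ok n ?\<sigma>" using b' unfolding work_ok_def al by simp
  show "valid n ?m ?\<sigma>" unfolding valid_def using log core lists slots work by (intro conjI)
  have "(\<Sum>w\<le>n. length (adj ?\<sigma> w)) = 2 * ?m" using b' full by simp
  then show "potential n ?\<sigma> \<le> 33 * n + 15 * ?m + 1"
    unfolding potential_def links al using b' by simp
qed

section \<open>The complete program\<close>

definition program :: prog where
  "program = block [init_code, Loop (Less 6 1) edge_code, Loop (Less 32 0) vertex_code,
     Loop (Less 2 14) step_code, Copy 31 6, Loop (Less 1 31) unwind_code, Copy 0 13]"

text \<open>The elimination loop and the backward loop run at most 33 rounds per unit of input size,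
  by the initial potential. In 80 are contained 33 + 33 for the tests of these two loops, 1 + 1 for
  those of the two input loops, and 12 for single steps.\<close>

definition time_factor :: nat where
  "time_factor = time_bound init_code + time_bound edge_code + time_bound vertex_code +
     33 * time_bound step_code + 33 * time_bound unwind_code + 80"

lemma loop_free_parts:
  "loop_free (push_code v x)" "loop_free (pop_code v x)" "loop_free tables_code" "loop_free (store_tuple c r)"
  by (simp_all add: push_code_def pop_code_def load_table_def tables_code_def store_tuple_def lut_props)

lemma loop_free_link: "loop_free link_code" "loop_free close_code"
  by (simp_all add: link_code_def close_code_def loop_free_parts lut_props)

lemma loop_free_step: "loop_free (merge_code r)" "loop_free eliminate_code" "loop_free idle_code"
  by (simp_all add: merge_code_def eliminate_code_def idle_code_def loop_free_parts loop_free_link)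

lemma loop_free_codes:
  "loop_free init_code" "loop_free edge_code" "loop_free vertex_code" "loop_free step_code"
  "loop_free unwind_code"
  by (simp_all add: init_code_def edge_code_def vertex_code_def step_code_def unwind_code_def
    link_step_code_def busy_code_def loop_free_parts loop_free_link loop_free_step lut_props)

lemma tame_parts:
  "tame (push_code v x)" "x \<noteq> 3 \<Longrightarrow> tame (pop_code v x)" "tame tables_code"
  "c \<noteq> 3 \<Longrightarrow> r \<noteq> 3 \<Longrightarrow> tame (store_tuple c r)"
  by (simp_all add: push_code_def pop_code_def load_table_def tables_code_def store_tuple_def lut_props)

lemma tame_link: "tame link_code" "tame close_code"
  by (simp_all add: link_code_def close_code_def tame_parts lut_props)

lemma tame_step: "tame (merge_code r)" "tame eliminate_code" "tame idle_code"
  by (simp_all add: merge_code_def eliminate_code_def idle_code_def tame_parts tame_link)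

lemma tame_program: "tame program"
  by (simp add: program_def init_code_def edge_code_def vertex_code_def step_code_def unwind_code_def
    link_step_code_def busy_code_def tame_parts tame_link tame_step lut_props)

lemma lists_graph_less:
  assumes "lists_graph n es V E" "(x, y) \<in> set es"
  shows "x < n \<and> y < n"
proof -
  have g: "V = {..<n}" "E = (\<lambda>(u, v). {u, v}) ` set es" "\<forall>e\<in>E. e \<subseteq> V \<and> card e = 2"
    by (insert assms(1)[unfolded lists_graph_def simple_graph_def], (elim conjE, assumption)+)
  have "{x, y} \<in> E" unfolding g(2) by (rule image_eqI[OF _ assms(2)]) simp
  then have "{x, y} \<subseteq> V" using g(3)[THEN bspec] by (simp only:)
  then show ?thesis unfolding g(1) by simp
qed

lemma bounded_input:
  assumes "lists_graph n es V E"
  shows "bounded_state (n + length es) (input_state n es)"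
proof -
  have e: "fst p < n \<and> snd p < n" if "p \<in> set es" for p
    using lists_graph_less[OF assms, of "fst p" "snd p"] that by simp
  have "fst (es ! i) \<le> n + length es" "snd (es ! i) \<le> n + length es" if "i < length es" for i
    using e[OF nth_mem[OF that]] by simp_all
  then show ?thesis unfolding bounded_state_def input_state_def by simp
qed

lemma run_init:
  assumes lg: "lists_graph n es V E"
  shows "\<exists>t s \<sigma>. uexec (Loop (Less 6 1) edge_code) (ev init_code (input_state n es)) t s \<and>
    t \<le> (time_bound edge_code + 1) * length es + 1 \<and> building n es \<sigma> \<and> rcnt \<sigma> = length es \<and>
    represents n (length es) \<sigma> s \<and> regs s 32 = 0"
proof -
  let ?m = "length es"
  define I where "I \<sigma> s \<longleftrightarrow> building n es \<sigma> \<and> represents n ?m \<sigma> s \<and> arrs s 0 = arrs (input_state n es) 0 \<and>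
     arrs s 1 = arrs (input_state n es) 1 \<and> regs s 32 = 0" for \<sigma> s
  have "\<exists>t s \<sigma>. uexec (Loop (Less 6 1) edge_code) (ev init_code (input_state n es)) t s \<and>
      t \<le> (time_bound edge_code + 1) * (?m - rcnt (machine0 n)) + 1 \<and> I \<sigma> s \<and> \<not> holds (Less 6 1) s"
  proof (rule uexec_loop[OF loop_free_codes(2), where I = I and \<phi> = "\<lambda>\<sigma>. ?m - rcnt \<sigma>"])
    show "I (machine0 n) (ev init_code (input_state n es))"
      unfolding I_def using building_machine0 represents_init by blast
  next
    fix \<sigma> s assume I: "I \<sigma> s" and h: "holds (Less 6 1) s"
    have rep: "represents n ?m \<sigma> s" and b: "building n es \<sigma>" using I unfolding I_def by simp_all
    have lt: "rcnt \<sigma> < ?m" using h by (simp add: representsD[OF rep])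
    obtain x y where xy: "es ! rcnt \<sigma> = (x, y)" by fastforce
    have "(x, y) \<in> set es" using nth_mem[OF lt] xy by simp
    then have "x < n \<and> y < n" by (rule lists_graph_less[OF lg])
    then have "building n es (add_edge x y \<sigma>)" by (intro building_add_edge[OF b lt xy]) simp_all
    moreover have "arrs s 0 (rcnt \<sigma>) = x" "arrs s 1 (rcnt \<sigma>) = y"
      using I lt xy unfolding I_def input_state_def by simp_all
    note represents_add_edge[OF rep lt this]
    ultimately have "I (add_edge x y \<sigma>) (ev edge_code s)" using I unfolding I_def by simp
    moreover have "?m - rcnt (add_edge x y \<sigma>) < ?m - rcnt \<sigma>" using lt by (simp add: add_edge_def Let_def)
    ultimately show "\<exists>\<sigma>'. I \<sigma>' (ev edge_code s) \<and> ?m - rcnt \<sigma>' < ?m - rcnt \<sigma>" by blast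
  qed
  then obtain t s \<sigma> where t: "uexec (Loop (Less 6 1) edge_code) (ev init_code (input_state n es)) t s"
    "t \<le> (time_bound edge_code + 1) * (?m - rcnt (machine0 n)) + 1" and I: "I \<sigma> s" and h: "\<not> holds (Less 6 1) s"
    by blast
  have rep: "represents n ?m \<sigma> s" "building n es \<sigma>" "regs s 32 = 0" using I unfolding I_def by simp_all
  have "rcnt \<sigma> = ?m" using h rep(2) unfolding building_def by (simp add: representsD[OF rep(1)])
  then show ?thesis using t rep by (auto simp: machine0_def)
qed

lemma run_queue:
  assumes rep: "represents n m \<sigma> s" "adj \<sigma> (Suc n) = []" "regs s 32 = 0"
  shows "\<exists>t s'. uexec (Loop (Less 32 0) vertex_code) s t s' \<and>
    t \<le> (time_bound vertex_code + 1) * n + 1 \<and> represents n m (queued n n \<sigma>) s'"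
proof -
  define I where "I j s \<longleftrightarrow> represents n m (queued n j \<sigma>) s \<and> regs s 32 = j \<and> j \<le> n" for j s
  have "\<exists>t s' j. uexec (Loop (Less 32 0) vertex_code) s t s' \<and>
      t \<le> (time_bound vertex_code + 1) * (n - 0) + 1 \<and> I j s' \<and> \<not> holds (Less 32 0) s'"
  proof (rule uexec_loop[OF loop_free_codes(3), where I = I and \<phi> = "\<lambda>j. n - j"])
    have "queued n 0 \<sigma> = \<sigma>" using rep(2) by (simp add: fun_upd_idem)
    then show "I 0 s" unfolding I_def using rep by simp
  next
    fix j s assume I: "I j s" and h: "holds (Less 32 0) s"
    have r: "represents n m (queued n j \<sigma>) s" "regs s 32 = j" using I unfolding I_def by simp_all
    have lt: "j < n" using h by (simp add: representsD[OF r(1)] r(2))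
    have "I (Suc j) (ev vertex_code s)" unfolding I_def using represents_queue[OF r] lt by simp
    then show "\<exists>k. I k (ev vertex_code s) \<and> n - k < n - j" using lt by (intro exI[of _ "Suc j"]) simp
  qed
  then obtain t s' j where t: "uexec (Loop (Less 32 0) vertex_code) s t s'"
    "t \<le> (time_bound vertex_code + 1) * n + 1" and I: "I j s'" and h: "\<not> holds (Less 32 0) s'" by auto
  have r: "represents n m (queued n j \<sigma>) s'" "regs s' 32 = j" "j \<le> n" using I unfolding I_def by simp_all
  have "j = n" using h r(3) by (simp add: representsD[OF r(1)] r(2))
  then show ?thesis using t r(1) by blast
qed

lemma run_steps:
  assumes inv: "valid n m \<sigma>" and ol: "original_links n \<sigma> {1..m} E" and rep: "represents n m \<sigma> s"
  shows "\<exists>t s' \<sigma>'. uexec (Loop (Less 2 14) step_code) s t s' \<and>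
    t \<le> (time_bound step_code + 1) * potential n \<sigma> + 1 \<and> valid n m \<sigma>' \<and> original_links n \<sigma>' {1..m} E \<and>
    represents n m \<sigma>' s' \<and> rcnt \<sigma>' \<le> rcnt \<sigma> + potential n \<sigma> \<and> \<not> go \<sigma>'"
proof -
  \<comment> \<open>A step adds at most one link and lowers the potential, so the sum of both never
    grows. This bounds the final length of the log and thereby the backward pass.\<close>
  define I where "I \<tau> s \<longleftrightarrow> valid n m \<tau> \<and> original_links n \<tau> {1..m} E \<and> represents n m \<tau> s \<and>
    rcnt \<tau> + potential n \<tau> \<le> rcnt \<sigma> + potential n \<sigma>" for \<tau> s
  have "\<exists>t s' \<sigma>'. uexec (Loop (Less 2 14) step_code) s t s' \<and>
      t \<le> (time_bound step_code + 1) * potential n \<sigma> + 1 \<and> I \<sigma>' s' \<and> \<not> holds (Less 2 14) s'"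
  proof (rule uexec_loop[OF loop_free_codes(4), where I = I and \<phi> = "potential n"])
    show "I \<sigma> s" unfolding I_def using assms by simp
  next
    fix \<tau> s assume I: "I \<tau> s" and h: "holds (Less 2 14) s"
    have i: "valid n m \<tau>" "original_links n \<tau> {1..m} E" "represents n m \<tau> s"
      and le: "rcnt \<tau> + potential n \<tau> \<le> rcnt \<sigma> + potential n \<sigma>" using I unfolding I_def by simp_all
    interpret machine_inv n m \<tau> by unfold_locales (rule i)
    have "go \<tau>" using h by (simp add: representsD[OF i(3)])
    then have p: "potential n (step n \<tau>) < potential n \<tau>" by (rule potential_step)
    have "m \<le> rcnt \<tau>" using i(1) unfolding valid_def log_ok_def by simp
    then have "original_links n (step n \<tau>) {1..m} E"
      by (intro original_links_cong[OF i(2)] step_keeps(3)) simp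
    moreover have "represents n m (step n \<tau>) (ev step_code s)" by (rule represents_step[OF i(3)])
    ultimately have "I (step n \<tau>) (ev step_code s)"
      unfolding I_def using inv_step p le step_keeps(2)[of n \<tau>] by simp
    then show "\<exists>\<tau>'. I \<tau>' (ev step_code s) \<and> potential n \<tau>' < potential n \<tau>" using p by blast
  qed
  then obtain t s' \<sigma>' where t: "uexec (Loop (Less 2 14) step_code) s t s'"
    "t \<le> (time_bound step_code + 1) * potential n \<sigma> + 1" and I: "I \<sigma>' s'" and h: "\<not> holds (Less 2 14) s'" by blast
  have r: "valid n m \<sigma>'" "original_links n \<sigma>' {1..m} E" "represents n m \<sigma>' s'"
    "rcnt \<sigma>' + potential n \<sigma>' \<le> rcnt \<sigma> + potential n \<sigma>" using I unfolding I_def by simp_all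
  have "\<not> go \<sigma>'" using h by (simp add: representsD[OF r(3)])
  then show ?thesis using t r by (intro exI[of _ t] exI[of _ s'] exI[of _ \<sigma>']) simp
qed

lemma run_unwind:
  assumes inv: "valid n m \<sigma>" and rep: "represents n m \<sigma> s" and stop: "\<not> go \<sigma>"
    and s: "regs s 31 = rcnt \<sigma>"
  shows "\<exists>t s'. uexec (Loop (Less 1 31) unwind_code) s t s' \<and>
    t \<le> (time_bound unwind_code + 1) * (rcnt \<sigma> - m) + 1 \<and> regs s' 13 = of_bool (feas \<sigma>) \<and>
    (feas \<sigma> \<longrightarrow> unwound n \<sigma> m (tuples s') (arrs s' 0))"
proof -
  interpret machine_inv n m \<sigma> by unfold_locales (rule inv)
  note q = representsQ[OF rep] and r = representsD[OF rep]
  define I where "I g s \<longleftrightarrow> unwinding m \<sigma> g s \<and> m \<le> g \<and> g \<le> rcnt \<sigma> \<and>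
    (\<forall>e. arrs s 5 e < card (UNIV :: tuple set)) \<and> (feas \<sigma> \<longrightarrow> unwound n \<sigma> g (tuples s) (arrs s 0))" for g s
  have mle: "m \<le> rcnt \<sigma>" using inv unfolding valid_def log_ok_def by simp
  have "\<exists>t s' g. uexec (Loop (Less 1 31) unwind_code) s t s' \<and>
    t \<le> (time_bound unwind_code + 1) * (rcnt \<sigma> - m) + 1 \<and> I g s' \<and> \<not> holds (Less 1 31) s'"
  proof (rule uexec_loop[OF loop_free_codes(5), where I = I and \<phi> = "\<lambda>g. g - m"])
    have "tuples s e = ((state0, False), (state0, False))" if "m < e" "e \<le> rcnt \<sigma>" for e
      using q(3) that unfolding tuples_def tuple0_def[symmetric] by simp
    then have "unwound n \<sigma> (rcnt \<sigma>) (tuples s) (arrs s 0)" if "feas \<sigma>"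
      unfolding unwound_def using final_solution[OF stop that, of "tuples s"] by auto
    moreover have "unwinding m \<sigma> (rcnt \<sigma>) s" unfolding unwinding_def by (simp add: r s)
    ultimately show "I (rcnt \<sigma>) s" unfolding I_def using mle q(2) by simp
  next
    fix g s assume I: "I g s" and h: "holds (Less 1 31) s"
    have u: "unwinding m \<sigma> g s" and A: "\<forall>e. arrs s 5 e < card (UNIV :: tuple set)"
      and g: "m \<le> g" "g \<le> rcnt \<sigma>" and w: "feas \<sigma> \<Longrightarrow> unwound n \<sigma> g (tuples s) (arrs s 0)"
      using I unfolding I_def by simp_all
    have "m < g" using h u unfolding unwinding_def by simp
    then obtain k where k: "g = Suc k" "m \<le> k" by (cases g) auto
    note st = unwind_code_step[OF u[unfolded k(1)] q(1)[rule_format] A]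
    have "I k (ev unwind_code s)"
      unfolding I_def using st(1,2) k g unwound_step[OF w[unfolded k(1)] k(2)] unfolding st(3,4) by simp
    then show "\<exists>g'. I g' (ev unwind_code s) \<and> g' - m < g - m" using k by (intro exI[of _ k]) simp
  qed
  then obtain t s' g where t: "uexec (Loop (Less 1 31) unwind_code) s t s'"
    "t \<le> (time_bound unwind_code + 1) * (rcnt \<sigma> - m) + 1" and I: "I g s'" and h: "\<not> holds (Less 1 31) s'" by blast
  have u: "unwinding m \<sigma> g s'" "m \<le> g" "feas \<sigma> \<longrightarrow> unwound n \<sigma> g (tuples s') (arrs s' 0)"
    using I unfolding I_def by simp_all
  have "g = m" using h u(1,2) unfolding unwinding_def by simp
  moreover have "regs s' 13 = of_bool (feas \<sigma>)" using u(1) unfolding unwinding_def by (elim conjE)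
  ultimately show ?thesis using t u(3) by (intro exI[of _ t] exI[of _ s']) simp
qed

lemma feas_iff_colorable:
  assumes inv: "valid n m \<sigma>" and ol: "original_links n \<sigma> {1..m} E" and stop: "\<not> go \<sigma>"
  shows "(\<exists>c. star_coloring 2 {..<n} E c) \<Longrightarrow> feas \<sigma>"
    and "unwound n \<sigma> m A out \<Longrightarrow> star_coloring 2 {..<n} E out"
proof -
  interpret machine_inv n m \<sigma> by unfold_locales (rule inv)
  interpret original_links n \<sigma> "{1..m}" E by fact
  have z: "ch0 \<sigma> g = 0 \<and> ch1 \<sigma> g = 0 \<and> ch2 \<sigma> g = 0" if "g \<le> m" for g
    using inv that unfolding valid_def log_ok_def by simp
  have live: "live \<sigma> m = {1..m}"
  proof -
    have "live \<sigma> g = {1..g}" if "g \<le> m" for g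
      using that by (induction g) (auto simp: after_op_def z)
    then show ?thesis by simp
  qed
  show "feas \<sigma>" if col: "\<exists>c. star_coloring 2 {..<n} E c"
  proof -
    obtain c where c: "star_coloring 2 {..<n} E c" using col by blast
    obtain r where "star_roles {..<n} E c r" using star_coloring_roles[OF sg c] by blast
    moreover have "c v < 2" if "v < n" for v using c that unfolding star_coloring_def by simp
    ultimately obtain q A where "solution n \<sigma> {1..m} q A" using roles_solution by blast
    then show ?thesis using solvable_feas live by metis
  qed
  show "star_coloring 2 {..<n} E out" if "unwound n \<sigma> m A out"
    using unwound_coloring[OF stop that] ol live by simp
qed

lemma program_correct:
  assumes lg: "lists_graph n es V E" and op: "outerplanar V E"
  shows "\<exists>t s. uexec program (input_state n es) t s \<and> t \<le> time_factor * (n + length es + 1) \<and>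
    (accepts s \<longleftrightarrow> (\<exists>c. star_coloring 2 V E c)) \<and> (accepts s \<longrightarrow> star_coloring 2 V E (output_coloring s))"
proof -
  let ?m = "length es"
  have V: "V = {..<n}" using lg unfolding lists_graph_def by simp
  obtain t0 where t0: "t0 \<le> time_bound init_code"
    "uexec init_code (input_state n es) t0 (ev init_code (input_state n es))"
    using uexec_ev[OF loop_free_codes(1)] by blast
  obtain t1 s1 \<sigma> where t1: "uexec (Loop (Less 6 1) edge_code) (ev init_code (input_state n es)) t1 s1"
      "t1 \<le> (time_bound edge_code + 1) * ?m + 1"
    and b: "building n es \<sigma>" "rcnt \<sigma> = ?m" "represents n ?m \<sigma> s1" "regs s1 32 = 0"
    using run_init[OF lg] by blast
  have "adj \<sigma> (Suc n) = []" using b(1) unfolding building_def by simp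
  from run_queue[OF b(3) this b(4)] obtain t2 s2 where
    t2: "uexec (Loop (Less 32 0) vertex_code) s1 t2 s2" "t2 \<le> (time_bound vertex_code + 1) * n + 1"
      "represents n ?m (queued n n \<sigma>) s2" by blast
  note iq = inv_queued[OF lg op b(1,2)]
  have ol: "original_links n (queued n n \<sigma>) {1..?m} E"
    by (rule original_links_cong[OF original_links_building[OF lg b(1,2)]]) simp
  obtain t3 s3 \<tau> where t3: "uexec (Loop (Less 2 14) step_code) s2 t3 s3"
      "t3 \<le> (time_bound step_code + 1) * potential n (queued n n \<sigma>) + 1"
    and \<tau>: "valid n ?m \<tau>" "original_links n \<tau> {1..?m} E" "represents n ?m \<tau> s3"
      "rcnt \<tau> \<le> rcnt (queued n n \<sigma>) + potential n (queued n n \<sigma>)" "\<not> go \<tau>"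
    using run_steps[OF iq(1) ol t2(3)] by blast
  define s4 where "s4 = set_reg 31 (regs s3 6) s3"
  have t4: "uexec (Copy 31 6) s3 1 s4" unfolding s4_def by (rule uexec.UCopy)
  have "represents n ?m \<tau> s4"
    unfolding s4_def by (rule represents_cong[OF \<tau>(3)]) auto
  moreover have "regs s4 31 = rcnt \<tau>" unfolding s4_def by (simp add: representsD[OF \<tau>(3)])
  ultimately obtain t5 s5 where
    t5: "uexec (Loop (Less 1 31) unwind_code) s4 t5 s5" "t5 \<le> (time_bound unwind_code + 1) * (rcnt \<tau> - ?m) + 1"
    and s5: "regs s5 13 = of_bool (feas \<tau>)" "feas \<tau> \<longrightarrow> unwound n \<tau> ?m (tuples s5) (arrs s5 0)" using run_unwind[OF \<tau>(1) _ \<tau>(5)] by blast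
  define s6 where "s6 = set_reg 0 (regs s5 13) s5"
  have t6: "uexec (Copy 0 13) s5 1 s6" unfolding s6_def by (rule uexec.UCopy)
  have run: "uexec program (input_state n es) (t0 + (t1 + (t2 + (t3 + (1 + (t5 + (1 + 1))))))) s6"
    unfolding program_def block.simps
    by (rule USeq[OF t0(2) USeq[OF t1(1) USeq[OF t2(1) USeq[OF t3(1) USeq[OF t4 USeq[OF t5(1) USeq[OF t6 USkip]]]]]]])
  let ?N = "n + ?m + 1"
  have P: "potential n (queued n n \<sigma>) \<le> 33 * ?N" using iq(2) by simp
  define a b c d e where abcd: "a = (time_bound step_code + 1) * (33 * ?N)"
    "b = (time_bound unwind_code + 1) * (33 * ?N)" "c = (time_bound edge_code + 1) * ?N"
    "d = (time_bound vertex_code + 1) * ?N" "e = time_bound init_code * ?N"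
  have "t3 \<le> a + 1"
    using t3(2) mult_le_mono2[OF P, of "time_bound step_code + 1"] unfolding abcd by linarith
  moreover have "rcnt \<tau> - ?m \<le> 33 * ?N" using \<tau>(4) b(2) P by simp
  then have "t5 \<le> b + 1"
    using t5(2) mult_le_mono2[of "rcnt \<tau> - ?m" "33 * ?N" "time_bound unwind_code + 1"]
    unfolding abcd by linarith
  moreover have "t1 \<le> c + 1"
    using t1(2) mult_le_mono2[of ?m ?N "time_bound edge_code + 1"] unfolding abcd by linarith
  moreover have "t2 \<le> d + 1"
    using t2(2) mult_le_mono2[of n ?N "time_bound vertex_code + 1"] unfolding abcd by linarith
  moreover have "time_bound init_code \<le> e" unfolding abcd by simp
  \<comment> \<open>Seven single steps are left over: the last tests of four loops, two copies and
    the closing \<open>Skip\<close>. They are absorbed by \<open>12 * ?N\<close>.\<close>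
  ultimately have "t0 + (t1 + (t2 + (t3 + (1 + (t5 + (1 + 1)))))) \<le> e + c + d + a + b + 12 * ?N"
    using t0(1) by simp
  also have "e + c + d + a + b + 12 * ?N = time_factor * ?N"
    unfolding time_factor_def abcd by (simp only: algebra_simps)
  finally have time: "t0 + (t1 + (t2 + (t3 + (1 + (t5 + (1 + 1)))))) \<le> time_factor * ?N" .
  have "accepts s6 \<longleftrightarrow> feas \<tau>" "output_coloring s6 = arrs s5 0"
    unfolding accepts_def output_coloring_def s6_def using s5(1) by simp_all
  moreover have col: "star_coloring 2 V E (arrs s5 0)" if "feas \<tau>"
    unfolding V by (rule feas_iff_colorable(2)[OF \<tau>(1,2,5)]) (use s5(2) that in blast)
  moreover have "feas \<tau> \<longleftrightarrow> (\<exists>c. star_coloring 2 V E c)"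
    using col feas_iff_colorable(1)[OF \<tau>(1,2,5)] unfolding V by blast
  ultimately show ?thesis using run time by (intro exI conjI impI) (assumption | simp only:)+
qed

theorem theorem1:
  "\<exists>(P :: prog) (K :: nat) (w :: nat). \<forall>(n :: nat) (es :: (nat \<times> nat) list) V E.
     lists_graph n es V E \<and> outerplanar V E \<longrightarrow>
       (\<exists>t s. exec ((card V + card E + 2) ^ w) P (input_state n es) t s \<and>
          t \<le> K * (card V + card E + 1) \<and>
          (accepts s \<longleftrightarrow> (\<exists>c. star_coloring 2 V E c)) \<and>
          (accepts s \<longrightarrow> star_coloring 2 V E (output_coloring s)))"
proof (rule exI[of _ program], rule exI[of _ time_factor], rule exI[of _ "max_const program + time_factor + 2"],
    intro allI impI)
  fix n es V E assume g: "lists_graph n es V E \<and> outerplanar V E"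
  let ?W = "(card V + card E + 2) ^ (max_const program + time_factor + 2)"
  let ?N = "n + length es + 1"
  have "E = set (map (\<lambda>(u, v). {u, v}) es)" "distinct (map (\<lambda>(u, v). {u, v}) es)"
    using g unfolding lists_graph_def by simp_all
  then have E: "card E = length es" using distinct_card by fastforce
  have V: "card V = n" using g unfolding lists_graph_def by simp
  obtain t s where run: "uexec program (input_state n es) t s" "t \<le> time_factor * ?N"
    and ok: "accepts s \<longleftrightarrow> (\<exists>c. star_coloring 2 V E c)" "accepts s \<longrightarrow> star_coloring 2 V E (output_coloring s)"
    using program_correct g by blast
  \<comment> \<open>The constants in the program can exceed the size of a small input, so they enter
    the initial bound on values.\<close>
  let ?B = "max_const program + (n + length es)"
  have "\<forall>W > ?B + t. exec W program (input_state n es) t s"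
    using uexec_bounded[OF run(1) tame_program, of ?B] bounded_mono[OF bounded_input, of n es V E ?B] g by simp
  \<comment> \<open>One factor of the power covers the size of the input; the others cover the
    constant through \<open>k < 2 ^ k\<close>, since the base is at least 2 even for the empty
    graph.\<close>
  moreover have "?B + t < ?W"
  proof -
    let ?k = "max_const program + time_factor"
    have "?B + t \<le> max_const program * ?N + ?N + time_factor * ?N" using run(2) by simp
    also have "\<dots> = (?k + 1) * ?N" by (simp add: algebra_simps)
    also have "\<dots> < 2 ^ (?k + 1) * (n + length es + 2)"
      by (rule mult_less_le_imp_less[OF less_exp]) simp_all
    also have "\<dots> \<le> (n + length es + 2) ^ (?k + 1) * (n + length es + 2)"
      by (intro mult_le_mono1 power_mono) simp_all
    also have "\<dots> = ?W" unfolding V E by simp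
    finally show ?thesis .
  qed
  ultimately have "exec ?W program (input_state n es) t s" by blast
  then show "\<exists>t s. exec ?W program (input_state n es) t s \<and> t \<le> time_factor * (card V + card E + 1) \<and>
      (accepts s \<longleftrightarrow> (\<exists>c. star_coloring 2 V E c)) \<and> (accepts s \<longrightarrow> star_coloring 2 V E (output_coloring s))"
    using run(2) ok unfolding V E by blast
qed

end
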